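(* Let $M$ be a finite (von Neumann) regular monoid. Then $H_n(M,\mathbb Z)$ is finite for all $n$ sufficiently large.
   Context: A monoid $M$ is (von Neumann) regular if for every $s\in M$ there is $t\in M$ with $sts=s$. $H_n(M,\mathbb Z)=\operatorname{Tor}_n^{\mathbb ZM}(\mathbb Z,\mathbb Z)$, where $\mathbb ZM$ is the integral monoid ring and $\mathbb Z$ is the trivial (right, respectively left) $\mathbb ZM$-module, on which every element of $M$ acts as the identity. *)

theory Defs
  imports "HOL-Algebra.Algebra"
begin

section \<open>Regular monoids and integral monoid rings\<close>

definition regular_monoid :: "('m, 'u) monoid_scheme \<Rightarrow> bool" where
  "regular_monoid M \<longleftrightarrow>
     (\<forall>s\<in>carrier M. \<exists>t\<in>carrier M. s \<otimes>\<^bsub>M\<^esub> t \<otimes>\<^bsub>M\<^esub> s = s)"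

text \<open>
  A formal integral combination of elements of \<open>M\<close> is encoded as its coefficient function, which
  vanishes off \<open>carrier M\<close> and has finite support; the product is convolution.
\<close>

definition monoid_ring :: "('m, 'u) monoid_scheme \<Rightarrow> ('m \<Rightarrow> int) ring" where
  "monoid_ring M =
    \<lparr> carrier = {a. finite {x. a x \<noteq> 0} \<and> {x. a x \<noteq> 0} \<subseteq> carrier M},
      monoid.mult = (\<lambda>a b z. \<Sum>(x, y) \<in> {x. a x \<noteq> 0} \<times> {y. b y \<noteq> 0}.
                       if x \<otimes>\<^bsub>M\<^esub> y = z then a x * b y else 0),
      one = (\<lambda>z. if z = \<one>\<^bsub>M\<^esub> then 1 else 0),
      ring.zero = (\<lambda>z. 0),
      ring.add = (\<lambda>a b z. a z + b z) \<rparr>"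

lemma monoid_ring_mult_eq:
  assumes "finite A" "finite B" "{x. a x \<noteq> 0} \<subseteq> A" "{x. b x \<noteq> 0} \<subseteq> B"
  shows "(a \<otimes>\<^bsub>monoid_ring M\<^esub> b) z = (\<Sum>x\<in>A. \<Sum>y\<in>B. if x \<otimes>\<^bsub>M\<^esub> y = z then a x * b y else 0)"
proof -
  have "(a \<otimes>\<^bsub>monoid_ring M\<^esub> b) z =
      (\<Sum>(x, y) \<in> A \<times> B. if x \<otimes>\<^bsub>M\<^esub> y = z then a x * b y else 0)"
    unfolding monoid_ring_def
    by (simp, rule sum.mono_neutral_left) (use assms in auto)
  then show ?thesis by (simp add: sum.cartesian_product)
qed

lemma monoid_ring_carrierD:
  "a \<in> carrier (monoid_ring M) \<Longrightarrow> finite {x. a x \<noteq> 0}"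
  "a \<in> carrier (monoid_ring M) \<Longrightarrow> {x. a x \<noteq> 0} \<subseteq> carrier M"
  by (auto simp: monoid_ring_def)

lemma monoid_ring_carrierI:
  "finite A \<Longrightarrow> A \<subseteq> carrier M \<Longrightarrow> {x. a x \<noteq> 0} \<subseteq> A \<Longrightarrow> a \<in> carrier (monoid_ring M)"
  unfolding monoid_ring_def by (auto intro: finite_subset)

lemma monoid_ring_mult_closed:
  assumes "monoid M" "a \<in> carrier (monoid_ring M)" "b \<in> carrier (monoid_ring M)"
  shows "a \<otimes>\<^bsub>monoid_ring M\<^esub> b \<in> carrier (monoid_ring M)"
proof -
  interpret monoid M by fact
  let ?A = "{x. a x \<noteq> 0}" and ?B = "{x. b x \<noteq> 0}"
  note ab = monoid_ring_carrierD[OF assms(2)] monoid_ring_carrierD[OF assms(3)]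
  have sub: "{z. (a \<otimes>\<^bsub>monoid_ring M\<^esub> b) z \<noteq> 0} \<subseteq> (\<lambda>(x,y). x \<otimes>\<^bsub>M\<^esub> y) ` (?A \<times> ?B)"
  proof
    fix z assume "z \<in> {z. (a \<otimes>\<^bsub>monoid_ring M\<^esub> b) z \<noteq> 0}"
    then have "(\<Sum>x\<in>?A. \<Sum>y\<in>?B. if x \<otimes>\<^bsub>M\<^esub> y = z then a x * b y else 0) \<noteq> 0"
      using monoid_ring_mult_eq[OF ab(1) ab(3), of a b M z] by simp
    then obtain x where x: "x \<in> ?A"
        and "(\<Sum>y\<in>?B. if x \<otimes>\<^bsub>M\<^esub> y = z then a x * b y else 0) \<noteq> 0"
      by (rule sum.not_neutral_contains_not_neutral)
    then obtain y where y: "y \<in> ?B" "(if x \<otimes>\<^bsub>M\<^esub> y = z then a x * b y else 0) \<noteq> 0"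
      by (elim sum.not_neutral_contains_not_neutral)
    then have "x \<otimes>\<^bsub>M\<^esub> y = z" by (metis (full_types))
    with x y show "z \<in> (\<lambda>(x,y). x \<otimes>\<^bsub>M\<^esub> y) ` (?A \<times> ?B)" by blast
  qed
  moreover have "finite ((\<lambda>(x,y). x \<otimes>\<^bsub>M\<^esub> y) ` (?A \<times> ?B))" using ab by simp
  moreover have "(\<lambda>(x,y). x \<otimes>\<^bsub>M\<^esub> y) ` (?A \<times> ?B) \<subseteq> carrier M" using ab by auto
  ultimately show ?thesis
    by (intro monoid_ring_carrierI)
qed

lemma monoid_ring_mult_pair:
  assumes "finite A" "finite B" "{x. a x \<noteq> 0} \<subseteq> A" "{x. b x \<noteq> 0} \<subseteq> B"
    "finite C" "{x. (a \<otimes>\<^bsub>monoid_ring M\<^esub> b) x \<noteq> 0} \<subseteq> C"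
  shows "(\<Sum>z\<in>C. (a \<otimes>\<^bsub>monoid_ring M\<^esub> b) z * f z) = (\<Sum>x\<in>A. \<Sum>y\<in>B. a x * b y * f (x \<otimes>\<^bsub>M\<^esub> y))"
proof -
  let ?D = "C \<union> (\<lambda>(x,y). x \<otimes>\<^bsub>M\<^esub> y) ` (A \<times> B)"
  have fD: "finite ?D" using assms by simp
  have "(\<Sum>z\<in>C. (a \<otimes>\<^bsub>monoid_ring M\<^esub> b) z * f z) = (\<Sum>z\<in>?D. (a \<otimes>\<^bsub>monoid_ring M\<^esub> b) z * f z)"
    by (rule sum.mono_neutral_left) (use fD assms in auto)
  also have "\<dots> = (\<Sum>z\<in>?D. \<Sum>x\<in>A. \<Sum>y\<in>B. if x \<otimes>\<^bsub>M\<^esub> y = z then a x * b y * f z else 0)"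
    unfolding monoid_ring_mult_eq[OF assms(1-4)]
    by (auto simp: sum_distrib_right intro!: sum.cong)
  also have "\<dots> = (\<Sum>x\<in>A. \<Sum>y\<in>B. \<Sum>z\<in>?D. if x \<otimes>\<^bsub>M\<^esub> y = z then a x * b y * f z else 0)"
    by (subst sum.swap, rule sum.cong[OF refl], rule sum.swap)
  also have "\<dots> = (\<Sum>x\<in>A. \<Sum>y\<in>B. a x * b y * f (x \<otimes>\<^bsub>M\<^esub> y))"
  proof (intro sum.cong refl)
    fix x y assume "x \<in> A" "y \<in> B"
    then have "x \<otimes>\<^bsub>M\<^esub> y \<in> ?D" by auto
    then show "(\<Sum>z\<in>?D. if x \<otimes>\<^bsub>M\<^esub> y = z then a x * b y * f z else 0) = a x * b y * f (x \<otimes>\<^bsub>M\<^esub> y)"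
      by (subst sum.delta'[OF fD]) (simp only: if_True)
  qed
  finally show ?thesis .
qed

lemma ring_monoid_ring:
  assumes "monoid M"
  shows "ring (monoid_ring M)"
proof -
  interpret monoid M by fact
  let ?R = "monoid_ring M"
  have add: "(a \<oplus>\<^bsub>?R\<^esub> b) = (\<lambda>z. a z + b z)" for a b by (simp add: monoid_ring_def)
  have zero: "\<zero>\<^bsub>?R\<^esub> = (\<lambda>z. 0)" by (simp add: monoid_ring_def)
  have one: "\<one>\<^bsub>?R\<^esub> = (\<lambda>z. if z = \<one>\<^bsub>M\<^esub> then 1 else 0)" by (simp add: monoid_ring_def)
  have onec: "\<one>\<^bsub>?R\<^esub> \<in> carrier ?R" by (auto simp add: monoid_ring_def)
  have addc: "a \<oplus>\<^bsub>?R\<^esub> b \<in> carrier ?R" if "a \<in> carrier ?R" "b \<in> carrier ?R" for a b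
  proof -
    have "{x. a x + b x \<noteq> 0} \<subseteq> {x. a x \<noteq> 0} \<union> {x. b x \<noteq> 0}" by auto
    then show ?thesis unfolding add
      by (rule monoid_ring_carrierI[rotated 2])
        (use monoid_ring_carrierD[OF that(1)] monoid_ring_carrierD[OF that(2)] in auto)
  qed
  have ag: "abelian_group ?R"
  proof (rule abelian_groupI)
    fix a assume a: "a \<in> carrier ?R"
    show "\<exists>y\<in>carrier ?R. y \<oplus>\<^bsub>?R\<^esub> a = \<zero>\<^bsub>?R\<^esub>"
      by (rule bexI[of _ "\<lambda>z. - a z"]) (use a in \<open>auto simp: monoid_ring_def\<close>)
    show "\<zero>\<^bsub>?R\<^esub> \<oplus>\<^bsub>?R\<^esub> a = a" by (simp add: add zero)
  next
    show "\<zero>\<^bsub>?R\<^esub> \<in> carrier ?R" by (simp add: monoid_ring_def)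
  qed (rule addc, assumption+, simp_all add: add add_ac)
  have mon: "monoid ?R"
  proof (rule monoidI)
    fix a b c assume abc: "a \<in> carrier ?R" "b \<in> carrier ?R" "c \<in> carrier ?R"
    let ?ab = "a \<otimes>\<^bsub>?R\<^esub> b" and ?bc = "b \<otimes>\<^bsub>?R\<^esub> c"
    have cl: "?ab \<in> carrier ?R" "?bc \<in> carrier ?R"
      using abc monoid_ring_mult_closed assms by auto
    note ca = monoid_ring_carrierD[OF abc(1)] and cb = monoid_ring_carrierD[OF abc(2)]
      and cc = monoid_ring_carrierD[OF abc(3)] and cab = monoid_ring_carrierD[OF cl(1)]
      and cbc = monoid_ring_carrierD[OF cl(2)]
    let ?A = "{x. a x \<noteq> 0}" and ?B = "{x. b x \<noteq> 0}" and ?C = "{x. c x \<noteq> 0}"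
    show "?ab \<otimes>\<^bsub>?R\<^esub> c = a \<otimes>\<^bsub>?R\<^esub> ?bc"
    proof
      fix z
      have "(?ab \<otimes>\<^bsub>?R\<^esub> c) z = (\<Sum>x\<in>{x. ?ab x \<noteq> 0}. ?ab x * (\<Sum>y\<in>?C. if x \<otimes>\<^bsub>M\<^esub> y = z then c y else 0))"
        unfolding monoid_ring_mult_eq[OF cab(1) cc(1) order_refl order_refl]
        by (auto simp: sum_distrib_left intro!: sum.cong)
      also have "\<dots> = (\<Sum>x\<in>?A. \<Sum>y\<in>?B. a x * b y * (\<Sum>w\<in>?C. if x \<otimes>\<^bsub>M\<^esub> y \<otimes>\<^bsub>M\<^esub> w = z then c w else 0))"
        by (rule monoid_ring_mult_pair[OF ca(1) cb(1) order_refl order_refl cab(1) order_refl])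
      also have "\<dots> = (\<Sum>x\<in>?A. \<Sum>y\<in>?B. \<Sum>w\<in>?C. if x \<otimes>\<^bsub>M\<^esub> (y \<otimes>\<^bsub>M\<^esub> w) = z then a x * b y * c w else 0)"
        unfolding sum_distrib_left
      proof (intro sum.cong refl)
        fix x y w assume "x \<in> ?A" "y \<in> ?B" "w \<in> ?C"
        then have "x \<in> carrier M" "y \<in> carrier M" "w \<in> carrier M" using ca cb cc by auto
        then show "a x * b y * (if x \<otimes>\<^bsub>M\<^esub> y \<otimes>\<^bsub>M\<^esub> w = z then c w else 0)
          = (if x \<otimes>\<^bsub>M\<^esub> (y \<otimes>\<^bsub>M\<^esub> w) = z then a x * b y * c w else 0)" by (simp add: m_assoc)
      qed
      also have "\<dots> = (\<Sum>x\<in>?A. \<Sum>y\<in>?B. \<Sum>w\<in>?C. b y * c w * (if x \<otimes>\<^bsub>M\<^esub> (y \<otimes>\<^bsub>M\<^esub> w) = z then a x else 0))"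
        by (intro sum.cong refl) auto
      also have "\<dots> = (\<Sum>x\<in>?A. \<Sum>y\<in>{x. ?bc x \<noteq> 0}. ?bc y * (if x \<otimes>\<^bsub>M\<^esub> y = z then a x else 0))"
        by (intro sum.cong refl monoid_ring_mult_pair[OF cb(1) cc(1) order_refl order_refl cbc(1) order_refl, symmetric])
      also have "\<dots> = (a \<otimes>\<^bsub>?R\<^esub> ?bc) z"
        unfolding monoid_ring_mult_eq[OF ca(1) cbc(1) order_refl order_refl]
        by (auto intro!: sum.cong)
      finally show "(?ab \<otimes>\<^bsub>?R\<^esub> c) z = (a \<otimes>\<^bsub>?R\<^esub> ?bc) z" .
    qed
  next
    fix a assume a: "a \<in> carrier ?R"
    note ca = monoid_ring_carrierD[OF a]
    have o: "{x. \<one>\<^bsub>?R\<^esub> x \<noteq> 0} \<subseteq> {\<one>\<^bsub>M\<^esub>}" by (auto simp: one)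
    show "\<one>\<^bsub>?R\<^esub> \<otimes>\<^bsub>?R\<^esub> a = a"
    proof
      fix z
      have "(\<one>\<^bsub>?R\<^esub> \<otimes>\<^bsub>?R\<^esub> a) z = (\<Sum>y\<in>{x. a x \<noteq> 0}. if \<one>\<^bsub>M\<^esub> \<otimes>\<^bsub>M\<^esub> y = z then a y else 0)"
        by (subst monoid_ring_mult_eq[OF _ ca(1) o order_refl]) (auto simp: one intro!: sum.cong)
      also have "\<dots> = (\<Sum>y\<in>{x. a x \<noteq> 0}. if y = z then a y else 0)"
        by (rule sum.cong[OF refl]) (use ca in auto)
      also have "\<dots> = a z" using ca(1) by simp
      finally show "(\<one>\<^bsub>?R\<^esub> \<otimes>\<^bsub>?R\<^esub> a) z = a z" .
    qed
    show "a \<otimes>\<^bsub>?R\<^esub> \<one>\<^bsub>?R\<^esub> = a"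
    proof
      fix z
      have "(a \<otimes>\<^bsub>?R\<^esub> \<one>\<^bsub>?R\<^esub>) z = (\<Sum>y\<in>{x. a x \<noteq> 0}. if y \<otimes>\<^bsub>M\<^esub> \<one>\<^bsub>M\<^esub> = z then a y else 0)"
        by (subst monoid_ring_mult_eq[OF ca(1) _ order_refl o]) (auto simp: one intro!: sum.cong)
      also have "\<dots> = (\<Sum>y\<in>{x. a x \<noteq> 0}. if y = z then a y else 0)"
        by (rule sum.cong[OF refl]) (use ca in auto)
      also have "\<dots> = a z" using ca(1) by simp
      finally show "(a \<otimes>\<^bsub>?R\<^esub> \<one>\<^bsub>?R\<^esub>) z = a z" .
    qed
  qed (use assms monoid_ring_mult_closed onec in auto)
  show ?thesis
  proof (rule ringI[OF ag mon])
    fix a b c assume abc: "a \<in> carrier ?R" "b \<in> carrier ?R" "c \<in> carrier ?R"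
    note ca = monoid_ring_carrierD[OF abc(1)] and cb = monoid_ring_carrierD[OF abc(2)]
      and cc = monoid_ring_carrierD[OF abc(3)]
    let ?A = "{x. a x \<noteq> 0}" and ?B = "{x. b x \<noteq> 0}" and ?C = "{x. c x \<noteq> 0}"
    let ?U = "?A \<union> ?B \<union> ?C"
    have U: "finite ?U" using ca cb cc by simp
    have s: "{x. (a \<oplus>\<^bsub>?R\<^esub> b) x \<noteq> 0} \<subseteq> ?U" by (auto simp: add)
    have sa: "?A \<subseteq> ?U" "?B \<subseteq> ?U" "?C \<subseteq> ?U" by auto
    show "(a \<oplus>\<^bsub>?R\<^esub> b) \<otimes>\<^bsub>?R\<^esub> c = a \<otimes>\<^bsub>?R\<^esub> c \<oplus>\<^bsub>?R\<^esub> b \<otimes>\<^bsub>?R\<^esub> c"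
      unfolding add[of "a \<otimes>\<^bsub>?R\<^esub> c"]
        monoid_ring_mult_eq[OF U U s sa(3)] monoid_ring_mult_eq[OF U U sa(1) sa(3)]
        monoid_ring_mult_eq[OF U U sa(2) sa(3)]
      unfolding sum.distrib[symmetric] by (rule ext, intro sum.cong refl) (auto simp: add algebra_simps)
    show "c \<otimes>\<^bsub>?R\<^esub> (a \<oplus>\<^bsub>?R\<^esub> b) = c \<otimes>\<^bsub>?R\<^esub> a \<oplus>\<^bsub>?R\<^esub> c \<otimes>\<^bsub>?R\<^esub> b"
      unfolding add[of "c \<otimes>\<^bsub>?R\<^esub> a"]
        monoid_ring_mult_eq[OF U U sa(3) s] monoid_ring_mult_eq[OF U U sa(3) sa(1)]
        monoid_ring_mult_eq[OF U U sa(3) sa(2)]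
      unfolding sum.distrib[symmetric] by (rule ext, intro sum.cong refl) (auto simp: add algebra_simps)
  qed
qed


section \<open>Modules over a not necessarily commutative ring\<close>

text \<open>
  The record \<^typ>\<open>('r, 'a) module\<close> is reused, but not the locale \<open>module\<close>, which requires a
  commutative ring. The ring fields \<open>mult\<close> and \<open>one\<close> of a module record play no role. For a right
  module, \<open>r \<odot> x\<close> stands for the product \<open>x r\<close>.
\<close>

definition left_module :: "('r, 'c) ring_scheme \<Rightarrow> ('r, 'a, 'd) module_scheme \<Rightarrow> bool" where
  "left_module R P \<longleftrightarrow> ring R \<and> abelian_group P \<and>
     (\<forall>r\<in>carrier R. \<forall>x\<in>carrier P. r \<odot>\<^bsub>P\<^esub> x \<in> carrier P) \<and>
     (\<forall>r\<in>carrier R. \<forall>s\<in>carrier R. \<forall>x\<in>carrier P.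
        (r \<oplus>\<^bsub>R\<^esub> s) \<odot>\<^bsub>P\<^esub> x = r \<odot>\<^bsub>P\<^esub> x \<oplus>\<^bsub>P\<^esub> s \<odot>\<^bsub>P\<^esub> x) \<and>
     (\<forall>r\<in>carrier R. \<forall>x\<in>carrier P. \<forall>y\<in>carrier P.
        r \<odot>\<^bsub>P\<^esub> (x \<oplus>\<^bsub>P\<^esub> y) = r \<odot>\<^bsub>P\<^esub> x \<oplus>\<^bsub>P\<^esub> r \<odot>\<^bsub>P\<^esub> y) \<and>
     (\<forall>r\<in>carrier R. \<forall>s\<in>carrier R. \<forall>x\<in>carrier P.
        (r \<otimes>\<^bsub>R\<^esub> s) \<odot>\<^bsub>P\<^esub> x = r \<odot>\<^bsub>P\<^esub> (s \<odot>\<^bsub>P\<^esub> x)) \<and>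
     (\<forall>x\<in>carrier P. \<one>\<^bsub>R\<^esub> \<odot>\<^bsub>P\<^esub> x = x)"

definition right_module :: "('r, 'c) ring_scheme \<Rightarrow> ('r, 'a, 'd) module_scheme \<Rightarrow> bool" where
  "right_module R P \<longleftrightarrow> ring R \<and> abelian_group P \<and>
     (\<forall>r\<in>carrier R. \<forall>x\<in>carrier P. r \<odot>\<^bsub>P\<^esub> x \<in> carrier P) \<and>
     (\<forall>r\<in>carrier R. \<forall>s\<in>carrier R. \<forall>x\<in>carrier P.
        (r \<oplus>\<^bsub>R\<^esub> s) \<odot>\<^bsub>P\<^esub> x = r \<odot>\<^bsub>P\<^esub> x \<oplus>\<^bsub>P\<^esub> s \<odot>\<^bsub>P\<^esub> x) \<and>
     (\<forall>r\<in>carrier R. \<forall>x\<in>carrier P. \<forall>y\<in>carrier P.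
        r \<odot>\<^bsub>P\<^esub> (x \<oplus>\<^bsub>P\<^esub> y) = r \<odot>\<^bsub>P\<^esub> x \<oplus>\<^bsub>P\<^esub> r \<odot>\<^bsub>P\<^esub> y) \<and>
     (\<forall>r\<in>carrier R. \<forall>s\<in>carrier R. \<forall>x\<in>carrier P.
        (r \<otimes>\<^bsub>R\<^esub> s) \<odot>\<^bsub>P\<^esub> x = s \<odot>\<^bsub>P\<^esub> (r \<odot>\<^bsub>P\<^esub> x)) \<and>
     (\<forall>x\<in>carrier P. \<one>\<^bsub>R\<^esub> \<odot>\<^bsub>P\<^esub> x = x)"

definition left_module_hom ::
    "('r, 'c) ring_scheme \<Rightarrow> ('r, 'a, 'd) module_scheme \<Rightarrow> ('r, 'b, 'e) module_scheme \<Rightarrow> ('a \<Rightarrow> 'b) set"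
  where
  "left_module_hom R P Q = {f. f \<in> hom (add_monoid P) (add_monoid Q) \<and>
     (\<forall>r\<in>carrier R. \<forall>x\<in>carrier P. f (r \<odot>\<^bsub>P\<^esub> x) = r \<odot>\<^bsub>Q\<^esub> f x)}"

text \<open>
  Every element of \<open>M\<close> acts as the identity on \<open>\<int>\<close>, so a general element of the monoid ring acts as
  multiplication by the sum of its coefficients. The same record is a left and a right module
  (lemma \<open>trivial_module_is_module\<close>).
\<close>

definition trivial_module :: "('m \<Rightarrow> int, int) module" where
  "trivial_module =
    \<lparr> carrier = UNIV, monoid.mult = (*), one = 1, ring.zero = 0, ring.add = (+),
      smult = (\<lambda>a k. (\<Sum>x \<in> {x. a x \<noteq> 0}. a x) * k) \<rparr>"

lemma trivial_module_is_module:
  assumes "monoid M"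
  shows "left_module (monoid_ring M) trivial_module" "right_module (monoid_ring M) trivial_module"
proof -
  let ?R = "monoid_ring M" and ?T = "trivial_module :: ('a \<Rightarrow> int, int) module"
  let ?e = "\<lambda>a::'a \<Rightarrow> int. \<Sum>x \<in> {x. a x \<noteq> 0}. a x"
  have ag: "abelian_group ?T"
  proof (rule abelian_groupI)
    fix x :: int
    show "\<exists>y\<in>carrier ?T. y \<oplus>\<^bsub>?T\<^esub> x = \<zero>\<^bsub>?T\<^esub>"
      by (rule bexI[of _ "- x"]) (auto simp: trivial_module_def)
  qed (auto simp: trivial_module_def)
  have e_add: "?e (a \<oplus>\<^bsub>?R\<^esub> b) = ?e a + ?e b" if "a \<in> carrier ?R" "b \<in> carrier ?R" for a b
  proof -
    let ?U = "{x. a x \<noteq> 0} \<union> {x. b x \<noteq> 0}"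
    have U: "finite ?U" using that monoid_ring_carrierD(1) by blast
    have 1: "?e a = sum a ?U" by (rule sum.mono_neutral_left) (use U in auto)
    have 2: "?e b = sum b ?U" by (rule sum.mono_neutral_left) (use U in auto)
    have 3: "?e (a \<oplus>\<^bsub>?R\<^esub> b) = sum (a \<oplus>\<^bsub>?R\<^esub> b) ?U"
      by (rule sum.mono_neutral_left) (use U in \<open>auto simp: monoid_ring_def\<close>)
    show ?thesis unfolding 1 2 3 by (simp add: monoid_ring_def sum.distrib)
  qed
  have e_mult: "?e (a \<otimes>\<^bsub>?R\<^esub> b) = ?e a * ?e b" if "a \<in> carrier ?R" "b \<in> carrier ?R" for a b
    using monoid_ring_mult_pair[OF monoid_ring_carrierD(1)[OF that(1)] monoid_ring_carrierD(1)[OF that(2)]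
      order_refl order_refl monoid_ring_carrierD(1)[OF monoid_ring_mult_closed[OF assms that]] order_refl,
      of "\<lambda>_. 1"]
    by (simp add: sum_product)
  have e_one: "?e \<one>\<^bsub>?R\<^esub> = 1"
    by (simp add: monoid_ring_def)
  show "left_module ?R ?T" "right_module ?R ?T"
    unfolding left_module_def right_module_def
    using ring_monoid_ring[OF assms] ag e_add e_mult e_one
    by (auto simp: trivial_module_def algebra_simps)
qed


section \<open>Projective resolutions\<close>

text \<open>
  Projectivity is the lifting property against surjections \<open>N \<rightarrow> N'\<close>. A definition cannot quantify
  over the types of \<open>N\<close> and \<open>N'\<close>; the ones chosen suffice, since \<open>N\<close> may be the free module on the
  set \<open>carrier P\<close> and \<open>N'\<close> may be \<open>P\<close>. Lemma \<open>projective_module_lift\<close> below gives the lifting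
  property for modules over arbitrary types.
\<close>

definition projective_module :: "('r, 'c) ring_scheme \<Rightarrow> ('r, 'p) module \<Rightarrow> bool" where
  "projective_module R P \<longleftrightarrow> left_module R P \<and>
     (\<forall>(N :: ('r, 'p \<Rightarrow> 'r) module) (N' :: ('r, 'p) module) g f.
        left_module R N \<and> left_module R N' \<and>
        g \<in> left_module_hom R N N' \<and> g ` carrier N = carrier N' \<and> f \<in> left_module_hom R P N' \<longrightarrow>
        (\<exists>h\<in>left_module_hom R P N. \<forall>x\<in>carrier P. g (h x) = f x))"

definition free_left_module :: "('r, 'c) ring_scheme \<Rightarrow> 'p set \<Rightarrow> ('r, 'p \<Rightarrow> 'r) module" where
  "free_left_module R S =
    \<lparr> carrier = {\<phi>. finite {x. \<phi> x \<noteq> \<zero>\<^bsub>R\<^esub>} \<and> {x. \<phi> x \<noteq> \<zero>\<^bsub>R\<^esub>} \<subseteq> S \<and> range \<phi> \<subseteq> carrier R},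
      monoid.mult = undefined, one = undefined,
      ring.zero = (\<lambda>x. \<zero>\<^bsub>R\<^esub>), ring.add = (\<lambda>\<phi> \<psi> x. \<phi> x \<oplus>\<^bsub>R\<^esub> \<psi> x),
      smult = (\<lambda>r \<phi> x. r \<otimes>\<^bsub>R\<^esub> \<phi> x) \<rparr>"

lemma left_module_free:
  assumes "ring R"
  shows "left_module R (free_left_module R S)"
proof -
  interpret ring R by fact
  let ?F = "free_left_module R S"
  have c: "\<phi> x \<in> carrier R" if "\<phi> \<in> carrier ?F" for \<phi> x
    using that by (auto simp: free_left_module_def)
  have add: "\<phi> \<oplus>\<^bsub>?F\<^esub> \<psi> = (\<lambda>x. \<phi> x \<oplus>\<^bsub>R\<^esub> \<psi> x)" for \<phi> \<psi> by (simp add: free_left_module_def)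
  have zero: "\<zero>\<^bsub>?F\<^esub> = (\<lambda>x. \<zero>\<^bsub>R\<^esub>)" by (simp add: free_left_module_def)
  have sm: "r \<odot>\<^bsub>?F\<^esub> \<phi> = (\<lambda>x. r \<otimes>\<^bsub>R\<^esub> \<phi> x)" for r \<phi> by (simp add: free_left_module_def)
  have cI: "\<phi> \<in> carrier ?F" if "finite U" "U \<subseteq> S" "{x. \<phi> x \<noteq> \<zero>\<^bsub>R\<^esub>} \<subseteq> U" "\<And>x. \<phi> x \<in> carrier R" for \<phi> U
    using that finite_subset by (auto simp: free_left_module_def)
  have cD: "finite {x. \<phi> x \<noteq> \<zero>\<^bsub>R\<^esub>}" "{x. \<phi> x \<noteq> \<zero>\<^bsub>R\<^esub>} \<subseteq> S" if "\<phi> \<in> carrier ?F" for \<phi>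
    using that by (simp_all add: free_left_module_def)
  have addc: "\<phi> \<oplus>\<^bsub>?F\<^esub> \<psi> \<in> carrier ?F" if "\<phi> \<in> carrier ?F" "\<psi> \<in> carrier ?F" for \<phi> \<psi>
    by (rule cI[of "{x. \<phi> x \<noteq> \<zero>\<^bsub>R\<^esub>} \<union> {x. \<psi> x \<noteq> \<zero>\<^bsub>R\<^esub>}"])
      (use cD[OF that(1)] cD[OF that(2)] c[OF that(1)] c[OF that(2)] in \<open>auto simp: add\<close>)
  have zc: "\<zero>\<^bsub>?F\<^esub> \<in> carrier ?F" by (rule cI[of "{}"]) (auto simp: zero)
  have smc: "r \<odot>\<^bsub>?F\<^esub> \<phi> \<in> carrier ?F" if "r \<in> carrier R" "\<phi> \<in> carrier ?F" for r \<phi>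
    by (rule cI[of "{x. \<phi> x \<noteq> \<zero>\<^bsub>R\<^esub>}"]) (use cD[OF that(2)] c[OF that(2)] that(1) in \<open>auto simp: sm\<close>)
  have ag: "abelian_group ?F"
  proof (rule abelian_groupI)
    fix \<phi> assume \<phi>: "\<phi> \<in> carrier ?F"
    show "\<zero>\<^bsub>?F\<^esub> \<oplus>\<^bsub>?F\<^esub> \<phi> = \<phi>" using c[OF \<phi>] by (simp add: add zero)
    show "\<exists>y\<in>carrier ?F. y \<oplus>\<^bsub>?F\<^esub> \<phi> = \<zero>\<^bsub>?F\<^esub>"
    proof (rule bexI[of _ "\<lambda>x. \<ominus>\<^bsub>R\<^esub> \<phi> x"])
      show "(\<lambda>x. \<ominus>\<^bsub>R\<^esub> \<phi> x) \<in> carrier ?F"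
        by (rule cI[of "{x. \<phi> x \<noteq> \<zero>\<^bsub>R\<^esub>}"]) (use cD[OF \<phi>] c[OF \<phi>] in \<open>auto\<close>)
    qed (use c[OF \<phi>] in \<open>simp add: add zero l_neg\<close>)
  next
    fix \<phi> \<psi> \<chi> assume *: "\<phi> \<in> carrier ?F" "\<psi> \<in> carrier ?F" "\<chi> \<in> carrier ?F"
    show "\<phi> \<oplus>\<^bsub>?F\<^esub> \<psi> \<oplus>\<^bsub>?F\<^esub> \<chi> = \<phi> \<oplus>\<^bsub>?F\<^esub> (\<psi> \<oplus>\<^bsub>?F\<^esub> \<chi>)"
      using c[OF *(1)] c[OF *(2)] c[OF *(3)] by (simp add: add a_assoc)
  next
    fix \<phi> \<psi> assume *: "\<phi> \<in> carrier ?F" "\<psi> \<in> carrier ?F"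
    show "\<phi> \<oplus>\<^bsub>?F\<^esub> \<psi> = \<psi> \<oplus>\<^bsub>?F\<^esub> \<phi>"
      using c[OF *(1)] c[OF *(2)] by (simp add: add a_comm)
  qed (use addc zc in auto)
  show ?thesis
    unfolding left_module_def using assms ag smc c
    by (simp add: add sm l_distr r_distr m_assoc)
qed

definition free_extend ::
    "('r, 'c) ring_scheme \<Rightarrow> ('r, 'n, 'd) module_scheme \<Rightarrow> ('p \<Rightarrow> 'n) \<Rightarrow> ('p \<Rightarrow> 'r) \<Rightarrow> 'n" where
  "free_extend R N u \<phi> = finsum N (\<lambda>x. \<phi> x \<odot>\<^bsub>N\<^esub> u x) {x. \<phi> x \<noteq> \<zero>\<^bsub>R\<^esub>}"

lemma left_module_smult_zero:
  assumes "left_module R N"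
  shows "x \<in> carrier N \<Longrightarrow> \<zero>\<^bsub>R\<^esub> \<odot>\<^bsub>N\<^esub> x = \<zero>\<^bsub>N\<^esub>" "r \<in> carrier R \<Longrightarrow> r \<odot>\<^bsub>N\<^esub> \<zero>\<^bsub>N\<^esub> = \<zero>\<^bsub>N\<^esub>"
proof -
  interpret R: ring R using assms by (simp add: left_module_def)
  interpret N: abelian_group N using assms by (simp add: left_module_def)
  have c: "r \<odot>\<^bsub>N\<^esub> x \<in> carrier N" if "r \<in> carrier R" "x \<in> carrier N" for r x
    using assms that by (simp add: left_module_def)
  {
    assume x: "x \<in> carrier N"
    have "(\<zero>\<^bsub>R\<^esub> \<oplus>\<^bsub>R\<^esub> \<zero>\<^bsub>R\<^esub>) \<odot>\<^bsub>N\<^esub> x = \<zero>\<^bsub>R\<^esub> \<odot>\<^bsub>N\<^esub> x \<oplus>\<^bsub>N\<^esub> \<zero>\<^bsub>R\<^esub> \<odot>\<^bsub>N\<^esub> x"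
      using assms x R.zero_closed by (auto simp only: left_module_def)
    then show "\<zero>\<^bsub>R\<^esub> \<odot>\<^bsub>N\<^esub> x = \<zero>\<^bsub>N\<^esub>" using c[OF R.zero_closed x] by simp
  next
    assume r: "r \<in> carrier R"
    have "r \<odot>\<^bsub>N\<^esub> (\<zero>\<^bsub>N\<^esub> \<oplus>\<^bsub>N\<^esub> \<zero>\<^bsub>N\<^esub>) = r \<odot>\<^bsub>N\<^esub> \<zero>\<^bsub>N\<^esub> \<oplus>\<^bsub>N\<^esub> r \<odot>\<^bsub>N\<^esub> \<zero>\<^bsub>N\<^esub>"
      using assms r N.zero_closed by (auto simp only: left_module_def)
    then show "r \<odot>\<^bsub>N\<^esub> \<zero>\<^bsub>N\<^esub> = \<zero>\<^bsub>N\<^esub>" using c[OF r N.zero_closed] by simp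
  }
qed

lemma free_extend_eq:
  assumes "left_module R N" "u \<in> S \<rightarrow> carrier N" "\<phi> \<in> carrier (free_left_module R S)"
    and "finite U" "U \<subseteq> S" "{x. \<phi> x \<noteq> \<zero>\<^bsub>R\<^esub>} \<subseteq> U"
  shows "free_extend R N u \<phi> = finsum N (\<lambda>x. \<phi> x \<odot>\<^bsub>N\<^esub> u x) U"
proof -
  interpret N: abelian_group N using assms by (simp add: left_module_def)
  have c: "r \<odot>\<^bsub>N\<^esub> x \<in> carrier N" if "r \<in> carrier R" "x \<in> carrier N" for r x
    using assms that by (simp add: left_module_def)
  have p: "\<phi> x \<in> carrier R" for x using assms(3) by (auto simp: free_left_module_def)
  show ?thesis
    unfolding free_extend_def
    by (rule N.add.finprod_mono_neutral_cong_left)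
      (use assms left_module_smult_zero[OF assms(1)] c p in \<open>auto simp: Pi_iff subset_iff\<close>)
qed

lemma free_extend_hom:
  assumes N: "left_module R N" and u: "u \<in> S \<rightarrow> carrier N"
  shows "free_extend R N u \<in> left_module_hom R (free_left_module R S) N"
proof -
  interpret N: abelian_group N using assms by (simp add: left_module_def)
  let ?F = "free_left_module R S"
  have ring: "ring R" using N by (simp add: left_module_def)
  interpret R: ring R by fact
  interpret F: abelian_group ?F using left_module_free[OF ring, of S] by (simp add: left_module_def)
  have c: "r \<odot>\<^bsub>N\<^esub> x \<in> carrier N" if "r \<in> carrier R" "x \<in> carrier N" for r x
    using assms that by (simp add: left_module_def)
  have FD: "finite {x. \<phi> x \<noteq> \<zero>\<^bsub>R\<^esub>}" "{x. \<phi> x \<noteq> \<zero>\<^bsub>R\<^esub>} \<subseteq> S" "\<phi> x \<in> carrier R"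
    if "\<phi> \<in> carrier ?F" for \<phi> x using that by (auto simp add: free_left_module_def)
  have term_c: "\<phi> x \<odot>\<^bsub>N\<^esub> u x \<in> carrier N" if "\<phi> \<in> carrier ?F" "x \<in> S" for \<phi> x
    using FD(3)[OF that(1)] u that c by auto
  have cl: "free_extend R N u \<phi> \<in> carrier N" if "\<phi> \<in> carrier ?F" for \<phi>
    unfolding free_extend_def
    by (rule N.finsum_closed) (use FD(2)[OF that] term_c[OF that] in auto)
  have ad: "free_extend R N u (\<phi> \<oplus>\<^bsub>?F\<^esub> \<psi>) = free_extend R N u \<phi> \<oplus>\<^bsub>N\<^esub> free_extend R N u \<psi>"
    if *: "\<phi> \<in> carrier ?F" "\<psi> \<in> carrier ?F" for \<phi> \<psi>
  proof -
    let ?U = "{x. \<phi> x \<noteq> \<zero>\<^bsub>R\<^esub>} \<union> {x. \<psi> x \<noteq> \<zero>\<^bsub>R\<^esub>}"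
    have U: "finite ?U" "?U \<subseteq> S" using FD(1,2)[OF *(1)] FD(1,2)[OF *(2)] by auto
    have e: "(\<phi> \<oplus>\<^bsub>?F\<^esub> \<psi>) x = \<phi> x \<oplus>\<^bsub>R\<^esub> \<psi> x" for x by (simp add: free_left_module_def)
    have s: "{x. (\<phi> \<oplus>\<^bsub>?F\<^esub> \<psi>) x \<noteq> \<zero>\<^bsub>R\<^esub>} \<subseteq> ?U" by (auto simp: e)
    have "finsum N (\<lambda>x. (\<phi> \<oplus>\<^bsub>?F\<^esub> \<psi>) x \<odot>\<^bsub>N\<^esub> u x) ?U =
        finsum N (\<lambda>x. \<phi> x \<odot>\<^bsub>N\<^esub> u x \<oplus>\<^bsub>N\<^esub> \<psi> x \<odot>\<^bsub>N\<^esub> u x) ?U"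
    proof (rule N.finsum_cong'[OF refl])
      show "(\<lambda>x. \<phi> x \<odot>\<^bsub>N\<^esub> u x \<oplus>\<^bsub>N\<^esub> \<psi> x \<odot>\<^bsub>N\<^esub> u x) \<in> ?U \<rightarrow> carrier N"
        using U(2) term_c[OF *(1)] term_c[OF *(2)] by blast
    next
      fix x assume "x \<in> ?U"
      then have "u x \<in> carrier N" using U(2) u by blast
      then show "(\<phi> \<oplus>\<^bsub>?F\<^esub> \<psi>) x \<odot>\<^bsub>N\<^esub> u x = \<phi> x \<odot>\<^bsub>N\<^esub> u x \<oplus>\<^bsub>N\<^esub> \<psi> x \<odot>\<^bsub>N\<^esub> u x"
        using N FD(3)[OF *(1)] FD(3)[OF *(2)] by (simp add: e left_module_def)
    qed
    also have "\<dots> = finsum N (\<lambda>x. \<phi> x \<odot>\<^bsub>N\<^esub> u x) ?U \<oplus>\<^bsub>N\<^esub> finsum N (\<lambda>x. \<psi> x \<odot>\<^bsub>N\<^esub> u x) ?U"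
      by (rule N.finsum_addf) (use U(2) term_c[OF *(1)] term_c[OF *(2)] in blast)+
    finally show ?thesis
      using free_extend_eq[OF N u _ U, of "\<phi> \<oplus>\<^bsub>?F\<^esub> \<psi>"] free_extend_eq[OF N u _ U, of \<phi>]
        free_extend_eq[OF N u _ U, of \<psi>] s * F.a_closed[OF *] by auto
  qed
  have sm: "free_extend R N u (r \<odot>\<^bsub>?F\<^esub> \<phi>) = r \<odot>\<^bsub>N\<^esub> free_extend R N u \<phi>"
    if *: "r \<in> carrier R" "\<phi> \<in> carrier ?F" for r \<phi>
  proof -
    let ?U = "{x. \<phi> x \<noteq> \<zero>\<^bsub>R\<^esub>}"
    have U: "finite ?U" "?U \<subseteq> S" using FD(1,2)[OF *(2)] by auto
    have e: "(r \<odot>\<^bsub>?F\<^esub> \<phi>) x = r \<otimes>\<^bsub>R\<^esub> \<phi> x" for x by (simp add: free_left_module_def)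
    have s: "{x. (r \<odot>\<^bsub>?F\<^esub> \<phi>) x \<noteq> \<zero>\<^bsub>R\<^esub>} \<subseteq> ?U" using * by (auto simp: e)
    have rc: "r \<odot>\<^bsub>?F\<^esub> \<phi> \<in> carrier ?F"
      using left_module_free[OF ring, of S] * by (simp add: left_module_def)
    have fin: "finite V \<Longrightarrow> V \<subseteq> S \<Longrightarrow>
      finsum N (\<lambda>x. (r \<odot>\<^bsub>?F\<^esub> \<phi>) x \<odot>\<^bsub>N\<^esub> u x) V = r \<odot>\<^bsub>N\<^esub> finsum N (\<lambda>x. \<phi> x \<odot>\<^bsub>N\<^esub> u x) V" for V
    proof (induction V rule: finite_induct)
      case empty
      then show ?case using left_module_smult_zero(2)[OF N *(1)] by simp
    next
      case (insert x V)
      have ux: "u x \<in> carrier N" using insert u by blast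
      have fc: "finsum N (\<lambda>x. \<phi> x \<odot>\<^bsub>N\<^esub> u x) V \<in> carrier N"
        by (rule N.finsum_closed) (use insert term_c[OF *(2)] in auto)
      have 1: "finsum N (\<lambda>x. (r \<odot>\<^bsub>?F\<^esub> \<phi>) x \<odot>\<^bsub>N\<^esub> u x) (insert x V) =
          (r \<odot>\<^bsub>?F\<^esub> \<phi>) x \<odot>\<^bsub>N\<^esub> u x \<oplus>\<^bsub>N\<^esub> finsum N (\<lambda>x. (r \<odot>\<^bsub>?F\<^esub> \<phi>) x \<odot>\<^bsub>N\<^esub> u x) V"
        by (rule N.finsum_insert) (use insert term_c[OF rc] in auto)
      have 2: "finsum N (\<lambda>x. \<phi> x \<odot>\<^bsub>N\<^esub> u x) (insert x V) =
          \<phi> x \<odot>\<^bsub>N\<^esub> u x \<oplus>\<^bsub>N\<^esub> finsum N (\<lambda>x. \<phi> x \<odot>\<^bsub>N\<^esub> u x) V"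
        by (rule N.finsum_insert) (use insert term_c[OF *(2)] in auto)
      have 3: "(r \<odot>\<^bsub>?F\<^esub> \<phi>) x \<odot>\<^bsub>N\<^esub> u x = r \<odot>\<^bsub>N\<^esub> (\<phi> x \<odot>\<^bsub>N\<^esub> u x)"
        using N * FD(3)[OF *(2)] ux by (simp add: e left_module_def)
      have 4: "r \<odot>\<^bsub>N\<^esub> (a \<oplus>\<^bsub>N\<^esub> b) = r \<odot>\<^bsub>N\<^esub> a \<oplus>\<^bsub>N\<^esub> r \<odot>\<^bsub>N\<^esub> b"
        if "a \<in> carrier N" "b \<in> carrier N" for a b
        using N * that by (simp add: left_module_def)
      have 5: "\<phi> x \<odot>\<^bsub>N\<^esub> u x \<in> carrier N" using insert term_c[OF *(2)] by auto
      show ?case unfolding 1 2 3 4[OF 5 fc] using insert by simp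
    qed
    show ?thesis
      unfolding free_extend_eq[OF N u rc U s] free_extend_eq[OF N u *(2) U order_refl]
      by (rule fin[OF U])
  qed
  show ?thesis using cl ad sm by (auto simp: left_module_hom_def hom_def)
qed

lemma left_module_hom_finsum:
  assumes N: "left_module R N" and N': "left_module R N'" and g: "g \<in> left_module_hom R N N'"
    and "finite U" "v \<in> U \<rightarrow> carrier N"
  shows "g (finsum N v U) = finsum N' (\<lambda>x. g (v x)) U"
proof -
  interpret N: abelian_group N using N by (simp add: left_module_def)
  interpret N': abelian_group N' using N' by (simp add: left_module_def)
  interpret abelian_group_hom N N' g
    using g by unfold_locales (simp add: left_module_hom_def)
  have "v ` U \<subseteq> carrier N \<longrightarrow> g (finsum N v U) = finsum N' (\<lambda>x. g (v x)) U"
    using assms(4)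
  proof (induction U rule: finite_induct)
    case (insert x U)
    show ?case
    proof
      assume v: "v ` insert x U \<subseteq> carrier N"
      then have "v \<in> U \<rightarrow> carrier N" "v x \<in> carrier N" "(\<lambda>x. g (v x)) \<in> U \<rightarrow> carrier N'"
        by auto
      then show "g (finsum N v (insert x U)) = finsum N' (\<lambda>x. g (v x)) (insert x U)"
        using insert v by simp
    qed
  qed simp
  then show ?thesis using assms(5) by blast
qed

lemma free_extend_comp:
  assumes N: "left_module R N" and N': "left_module R N'" and g: "g \<in> left_module_hom R N N'"
    and u: "u \<in> S \<rightarrow> carrier N" and \<phi>: "\<phi> \<in> carrier (free_left_module R S)"
  shows "g (free_extend R N u \<phi>) = free_extend R N' (\<lambda>x. g (u x)) \<phi>"
proof -
  interpret N': abelian_group N' using N' by (simp add: left_module_def)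
  have F: "finite {x. \<phi> x \<noteq> \<zero>\<^bsub>R\<^esub>}" "{x. \<phi> x \<noteq> \<zero>\<^bsub>R\<^esub>} \<subseteq> S" "\<And>x. \<phi> x \<in> carrier R"
    using \<phi> by (auto simp add: free_left_module_def)
  have ux: "u x \<in> carrier N" if "\<phi> x \<noteq> \<zero>\<^bsub>R\<^esub>" for x using that F u by blast
  have gc: "g y \<in> carrier N'" if "y \<in> carrier N" for y
    using g that by (auto simp: left_module_hom_def hom_def)
  have gs: "g (r \<odot>\<^bsub>N\<^esub> y) = r \<odot>\<^bsub>N'\<^esub> g y" if "y \<in> carrier N" "r \<in> carrier R" for r y
    using g that by (auto simp: left_module_hom_def)
  have "g (free_extend R N u \<phi>) = finsum N' (\<lambda>x. g (\<phi> x \<odot>\<^bsub>N\<^esub> u x)) {x. \<phi> x \<noteq> \<zero>\<^bsub>R\<^esub>}"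
    unfolding free_extend_def
    by (rule left_module_hom_finsum[OF N N' g F(1)]) (use N F ux in \<open>auto simp: left_module_def\<close>)
  also have "\<dots> = free_extend R N' (\<lambda>x. g (u x)) \<phi>"
    unfolding free_extend_def
    by (rule N'.finsum_cong'[OF refl]) (use N' F ux gc gs in \<open>auto simp: left_module_def\<close>)
  finally show ?thesis .
qed

lemma projective_module_lift:
  assumes P: "projective_module R P" and N: "left_module R N" and N': "left_module R N'"
    and g: "g \<in> left_module_hom R N N'" and surj: "g ` carrier N = carrier N'"
    and f: "f \<in> left_module_hom R P N'"
  shows "\<exists>h\<in>left_module_hom R P N. \<forall>x\<in>carrier P. g (h x) = f x"
proof -
  let ?S = "carrier P" and ?F = "free_left_module R (carrier P)"
  have lP: "left_module R P" using P by (simp add: projective_module_def)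
  then interpret R: ring R by (simp add: left_module_def)
  interpret P: abelian_group P using lP by (simp add: left_module_def)
  have lF: "left_module R ?F" by (rule left_module_free) unfold_locales
  let ?\<pi> = "free_extend R P (\<lambda>x. x)"
  have pi: "?\<pi> \<in> left_module_hom R ?F P" by (rule free_extend_hom[OF lP]) simp
  have pi_surj: "?\<pi> ` carrier ?F = carrier P"
  proof
    show "?\<pi> ` carrier ?F \<subseteq> carrier P" using pi by (auto simp: left_module_hom_def hom_def)
    show "carrier P \<subseteq> ?\<pi> ` carrier ?F"
    proof
      fix p assume p: "p \<in> carrier P"
      let ?\<delta> = "\<lambda>x. if x = p then \<one>\<^bsub>R\<^esub> else \<zero>\<^bsub>R\<^esub>"
      have s: "{x. ?\<delta> x \<noteq> \<zero>\<^bsub>R\<^esub>} \<subseteq> {p}" by auto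
      have d: "?\<delta> \<in> carrier ?F" using p finite_subset[OF s] by (auto simp: free_left_module_def)
      have "?\<pi> ?\<delta> = finsum P (\<lambda>x. ?\<delta> x \<odot>\<^bsub>P\<^esub> x) {p}"
        by (rule free_extend_eq[OF lP _ d _ _ s]) (use p in auto)
      also have "\<dots> = p" using p lP by (simp add: left_module_def)
      finally show "p \<in> ?\<pi> ` carrier ?F" using d by force
    qed
  qed
  have "(\<lambda>x. x) \<in> left_module_hom R P P" by (simp add: left_module_hom_def hom_def)
  then obtain s where s: "s \<in> left_module_hom R P ?F" "\<forall>x\<in>carrier P. ?\<pi> (s x) = x"
    using P lF lP pi pi_surj unfolding projective_module_def by blast
  have fc: "f x \<in> carrier N'" if "x \<in> carrier P" for x
    using f that by (auto simp: left_module_hom_def hom_def)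
  have "\<forall>x\<in>carrier P. \<exists>y\<in>carrier N. g y = f x" using fc surj by (metis imageE)
  then obtain u where u: "\<And>x. x \<in> carrier P \<Longrightarrow> u x \<in> carrier N \<and> g (u x) = f x" by metis
  let ?h = "free_extend R N u"
  have h: "?h \<in> left_module_hom R ?F N" by (rule free_extend_hom[OF N]) (use u in auto)
  have gh: "g (?h \<phi>) = f (?\<pi> \<phi>)" if \<phi>: "\<phi> \<in> carrier ?F" for \<phi>
  proof -
    interpret N': abelian_group N' using N' by (simp add: left_module_def)
    have F: "{x. \<phi> x \<noteq> \<zero>\<^bsub>R\<^esub>} \<subseteq> ?S" "\<And>x. \<phi> x \<in> carrier R"
      using \<phi> by (auto simp add: free_left_module_def)
    have "g (?h \<phi>) = free_extend R N' (\<lambda>x. g (u x)) \<phi>"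
      by (rule free_extend_comp[OF N N' g _ \<phi>]) (use u in auto)
    also have "\<dots> = free_extend R N' f \<phi>"
      unfolding free_extend_def
      by (rule N'.finsum_cong'[OF refl]) (use F u fc N' in \<open>auto simp: left_module_def\<close>)
    also have "\<dots> = f (?\<pi> \<phi>)"
      by (rule free_extend_comp[OF lP N' f _ \<phi>, symmetric]) simp
    finally show ?thesis .
  qed
  have sc: "s x \<in> carrier ?F" if "x \<in> carrier P" for x
    using s(1) that by (auto simp: left_module_hom_def hom_def)
  show ?thesis
  proof (rule bexI[of _ "\<lambda>x. ?h (s x)"])
    show "(\<lambda>x. ?h (s x)) \<in> left_module_hom R P N"
      using s(1) h sc by (auto simp: left_module_hom_def hom_def Pi_iff)
    show "\<forall>x\<in>carrier P. g (?h (s x)) = f x" using gh sc s(2) by auto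
  qed
qed

text \<open>
  An exact sequence \<open>\<dots> \<rightarrow> P 2 \<rightarrow> P 1 \<rightarrow> P 0 \<rightarrow> B \<rightarrow> 0\<close> with \<open>d n : P (n + 1) \<rightarrow> P n\<close> and augmentation
  \<open>e : P 0 \<rightarrow> B\<close>.
\<close>

definition projective_resolution ::
    "('r, 'c) ring_scheme \<Rightarrow> ('r, 'b) module \<Rightarrow>
     (nat \<Rightarrow> ('r, 'p) module) \<Rightarrow> (nat \<Rightarrow> 'p \<Rightarrow> 'p) \<Rightarrow> ('p \<Rightarrow> 'b) \<Rightarrow> bool" where
  "projective_resolution R B P d e \<longleftrightarrow>
     left_module R B \<and>
     (\<forall>n. projective_module R (P n)) \<and>
     (\<forall>n. d n \<in> left_module_hom R (P (Suc n)) (P n)) \<and>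
     e \<in> left_module_hom R (P 0) B \<and>
     e ` carrier (P 0) = carrier B \<and>
     d 0 ` carrier (P 1) = a_kernel (P 0) B e \<and>
     (\<forall>n. d (Suc n) ` carrier (P (Suc (Suc n))) = a_kernel (P (Suc n)) (P n) (d n))"


section \<open>Tensor products and Tor\<close>

text \<open>
  \<open>A \<otimes>\<^sub>R P\<close> is the free abelian group on pairs \<open>(a, p)\<close> modulo the subgroup generated by the
  bilinearity and balancing relations.
\<close>

definition tensor_relators ::
    "('r, 'c) ring_scheme \<Rightarrow> ('r, 'a) module \<Rightarrow> ('r, 'p) module \<Rightarrow> ('a \<times> 'p \<Rightarrow>\<^sub>0 int) set" where
  "tensor_relators R A P =
     {frag_of (a \<oplus>\<^bsub>A\<^esub> a', p) - frag_of (a, p) - frag_of (a', p) | a a' p.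
        a \<in> carrier A \<and> a' \<in> carrier A \<and> p \<in> carrier P} \<union>
     {frag_of (a, p \<oplus>\<^bsub>P\<^esub> p') - frag_of (a, p) - frag_of (a, p') | a p p'.
        a \<in> carrier A \<and> p \<in> carrier P \<and> p' \<in> carrier P} \<union>
     {frag_of (r \<odot>\<^bsub>A\<^esub> a, p) - frag_of (a, r \<odot>\<^bsub>P\<^esub> p) | r a p.
        r \<in> carrier R \<and> a \<in> carrier A \<and> p \<in> carrier P}"

definition tensor_relations ::
    "('r, 'c) ring_scheme \<Rightarrow> ('r, 'a) module \<Rightarrow> ('r, 'p) module \<Rightarrow> ('a \<times> 'p \<Rightarrow>\<^sub>0 int) set" where
  "tensor_relations R A P =
     generate (free_Abelian_group (carrier A \<times> carrier P)) (tensor_relators R A P)"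

definition tensor_product ::
    "('r, 'c) ring_scheme \<Rightarrow> ('r, 'a) module \<Rightarrow> ('r, 'p) module \<Rightarrow> ('a \<times> 'p \<Rightarrow>\<^sub>0 int) set monoid" where
  "tensor_product R A P = free_Abelian_group (carrier A \<times> carrier P) Mod tensor_relations R A P"

text \<open>
  The map \<open>id \<otimes> f : A \<otimes>\<^sub>R P \<rightarrow> A \<otimes>\<^sub>R Q\<close> on cosets. All members of a coset \<open>c\<close> yield the same coset
  (lemma \<open>tensor_map_coset\<close>), which is therefore the set product below.
\<close>

definition tensor_map ::
    "('r, 'c) ring_scheme \<Rightarrow> ('r, 'a) module \<Rightarrow> ('r, 'q) module \<Rightarrow> ('p \<Rightarrow> 'q) \<Rightarrow>
     ('a \<times> 'p \<Rightarrow>\<^sub>0 int) set \<Rightarrow> ('a \<times> 'q \<Rightarrow>\<^sub>0 int) set" where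
  "tensor_map R A Q f c =
     tensor_relations R A Q <#>\<^bsub>free_Abelian_group (carrier A \<times> carrier Q)\<^esub>
       frag_extend (\<lambda>(a, p). frag_of (a, f p)) ` c"

lemma tensor_relators_closed:
  fixes A :: "('r, 'a) module" and P :: "('r, 'p) module"
  assumes "left_module R P" "right_module R A"
  shows "tensor_relators R A P \<subseteq> carrier (free_Abelian_group (carrier A \<times> carrier P))"
proof -
  interpret A: abelian_group A using assms by (simp add: right_module_def)
  interpret P: abelian_group P using assms by (simp add: left_module_def)
  have r: "r \<odot>\<^bsub>A\<^esub> a \<in> carrier A" if "r \<in> carrier R" "a \<in> carrier A" for r a
    using that assms(2) by (simp add: right_module_def)
  have l: "r \<odot>\<^bsub>P\<^esub> p \<in> carrier P" if "r \<in> carrier R" "p \<in> carrier P" for r p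
    using that assms(1) by (simp add: left_module_def)
  have keys3: "frag_of u - frag_of v - frag_of w \<in> carrier (free_Abelian_group V)"
    if "u \<in> V" "v \<in> V" "w \<in> V" for u v w and V :: "('a \<times> 'p) set"
    using keys_diff[of "frag_of u - frag_of v" "frag_of w"] keys_diff[of "frag_of u" "frag_of v"] that
    by auto
  have keys2: "frag_of u - frag_of v \<in> carrier (free_Abelian_group V)"
    if "u \<in> V" "v \<in> V" for u v and V :: "('a \<times> 'p) set"
    using keys_diff[of "frag_of u" "frag_of v"] that by auto
  show ?thesis
    unfolding tensor_relators_def
    by (intro Un_least subsetI; elim CollectE exE conjE; hypsubst)
      (use r l in \<open>auto simp del: carrier_free_Abelian_group_iff intro!: keys2 keys3\<close>)
qed

lemma subgroup_tensor_relations: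
  assumes "left_module R P" "right_module R A"
  shows "subgroup (tensor_relations R A P) (free_Abelian_group (carrier A \<times> carrier P))"
  unfolding tensor_relations_def
  by (rule group.generate_is_subgroup[OF group_free_Abelian_group tensor_relators_closed[OF assms]])

lemma frag_extend_tensor_relations:
  fixes A :: "('r, 'a) module" and P :: "('r, 'p) module" and Q :: "('r, 'q) module"
  assumes "left_module R P" "left_module R Q" "right_module R A" "f \<in> left_module_hom R P Q"
    and "k \<in> tensor_relations R A P"
  shows "frag_extend (\<lambda>(a, p). frag_of (a, f p)) k \<in> tensor_relations R A Q"
proof -
  interpret K: subgroup "tensor_relations R A Q" "free_Abelian_group (carrier A \<times> carrier Q)"
    by (rule subgroup_tensor_relations[OF assms(2,3)])
  have fc: "f p \<in> carrier Q" if "p \<in> carrier P" for p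
    using assms(4) that by (auto simp: left_module_hom_def hom_def)
  have fa: "f (p \<oplus>\<^bsub>P\<^esub> p') = f p \<oplus>\<^bsub>Q\<^esub> f p'" if "p \<in> carrier P" "p' \<in> carrier P" for p p'
    using assms(4) that by (auto simp: left_module_hom_def hom_def)
  have fs: "f (r \<odot>\<^bsub>P\<^esub> p) = r \<odot>\<^bsub>Q\<^esub> f p" if "p \<in> carrier P" "r \<in> carrier R" for p r
    using assms(4) that by (auto simp: left_module_hom_def)
  let ?F = "frag_extend (\<lambda>(a, p). frag_of (a, f p)) :: ('a \<times> 'p \<Rightarrow>\<^sub>0 int) \<Rightarrow> ('a \<times> 'q \<Rightarrow>\<^sub>0 int)"
  have gen: "?F k \<in> tensor_relations R A Q" if "k \<in> tensor_relators R A P" for k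
  proof -
    have "?F k \<in> tensor_relators R A Q"
      using that unfolding tensor_relators_def
      apply (elim UnE CollectE exE conjE; simp add: frag_extend_diff fa fs)
        apply (rule disjI1, metis fc)
       apply (rule disjI2, rule disjI1, metis fc)
      apply (rule disjI2, rule disjI2, metis fc)
      done
    then show ?thesis unfolding tensor_relations_def by (rule generate.incl)
  qed
  from assms(5) show ?thesis
    unfolding tensor_relations_def[of R A P]
  proof (induction rule: generate.induct)
    case one then show ?case using K.one_closed by simp
  next
    case (incl h) then show ?case by (rule gen)
  next
    case (inv h)
    have "inv\<^bsub>free_Abelian_group (carrier A \<times> carrier P)\<^esub> h = - h"
      using subsetD[OF tensor_relators_closed[OF assms(1,3)] inv] by simp
    moreover have "- ?F h \<in> tensor_relations R A Q"
      using K.m_inv_closed[OF gen[OF inv]] K.mem_carrier[OF gen[OF inv]] by simp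
    ultimately show ?case by (simp add: frag_extend_minus)
  next
    case (eng h1 h2)
    then show ?case using K.m_closed by (simp add: frag_extend_add)
  qed
qed

lemma tensor_map_coset:
  fixes A :: "('r, 'a) module" and P :: "('r, 'p) module" and Q :: "('r, 'q) module"
  assumes "left_module R P" "left_module R Q" "right_module R A" "f \<in> left_module_hom R P Q"
    and "x \<in> carrier (free_Abelian_group (carrier A \<times> carrier P))"
  shows "tensor_map R A Q f
           (tensor_relations R A P #>\<^bsub>free_Abelian_group (carrier A \<times> carrier P)\<^esub> x) =
         tensor_relations R A Q #>\<^bsub>free_Abelian_group (carrier A \<times> carrier Q)\<^esub>
           frag_extend (\<lambda>(a, p). frag_of (a, f p)) x"
proof -
  interpret K: subgroup "tensor_relations R A Q" "free_Abelian_group (carrier A \<times> carrier Q)"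
    by (rule subgroup_tensor_relations[OF assms(2,3)])
  interpret L: subgroup "tensor_relations R A P" "free_Abelian_group (carrier A \<times> carrier P)"
    by (rule subgroup_tensor_relations[OF assms(1,3)])
  let ?F = "frag_extend (\<lambda>(a, p). frag_of (a, f p)) :: ('a \<times> 'p \<Rightarrow>\<^sub>0 int) \<Rightarrow> ('a \<times> 'q \<Rightarrow>\<^sub>0 int)"
  note F = frag_extend_tensor_relations[OF assms(1-4)]
  have K: "k + l \<in> tensor_relations R A Q"
    if "k \<in> tensor_relations R A Q" "l \<in> tensor_relations R A Q" for k l
    using K.m_closed[OF that] by simp
  show ?thesis
  proof
    show "tensor_map R A Q f
           (tensor_relations R A P #>\<^bsub>free_Abelian_group (carrier A \<times> carrier P)\<^esub> x) \<subseteq>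
         tensor_relations R A Q #>\<^bsub>free_Abelian_group (carrier A \<times> carrier Q)\<^esub> ?F x"
    proof
      fix y assume "y \<in> tensor_map R A Q f
           (tensor_relations R A P #>\<^bsub>free_Abelian_group (carrier A \<times> carrier P)\<^esub> x)"
      then obtain k l where kl: "k \<in> tensor_relations R A Q" "l \<in> tensor_relations R A P"
          "y = k + ?F (l + x)"
        by (auto simp: tensor_map_def set_mult_def r_coset_def)
      then have "y = (k + ?F l) + ?F x" by (simp add: frag_extend_add add.assoc)
      then show "y \<in> tensor_relations R A Q #>\<^bsub>free_Abelian_group (carrier A \<times> carrier Q)\<^esub> ?F x"
        using K[OF kl(1) F[OF kl(2)]] by (auto simp: r_coset_def)
    qed
    show "tensor_relations R A Q #>\<^bsub>free_Abelian_group (carrier A \<times> carrier Q)\<^esub> ?F x \<subseteq>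
        tensor_map R A Q f (tensor_relations R A P #>\<^bsub>free_Abelian_group (carrier A \<times> carrier P)\<^esub> x)"
      using L.one_closed by (force simp: tensor_map_def set_mult_def r_coset_def)
  qed
qed

fun tensor_cycles ::
    "('r, 'c) ring_scheme \<Rightarrow> ('r, 'a) module \<Rightarrow> (nat \<Rightarrow> ('r, 'p) module) \<Rightarrow> (nat \<Rightarrow> 'p \<Rightarrow> 'p) \<Rightarrow>
     nat \<Rightarrow> ('a \<times> 'p \<Rightarrow>\<^sub>0 int) set set" where
  "tensor_cycles R A P d 0 = carrier (tensor_product R A (P 0))"
| "tensor_cycles R A P d (Suc n) =
     kernel (tensor_product R A (P (Suc n))) (tensor_product R A (P n)) (tensor_map R A (P n) (d n))"

definition tensor_boundaries ::
    "('r, 'c) ring_scheme \<Rightarrow> ('r, 'a) module \<Rightarrow> (nat \<Rightarrow> ('r, 'p) module) \<Rightarrow> (nat \<Rightarrow> 'p \<Rightarrow> 'p) \<Rightarrow>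
     nat \<Rightarrow> ('a \<times> 'p \<Rightarrow>\<^sub>0 int) set set" where
  "tensor_boundaries R A P d n =
     tensor_map R A (P n) (d n) ` carrier (tensor_product R A (P (Suc n)))"

text \<open>
  \<open>Tor R A P d n\<close> is the \<open>n\<close>-th homology of the complex \<open>A \<otimes>\<^sub>R P\<close>. It is \<open>Tor\<^sub>n(A, B)\<close>, up to
  isomorphism, for every projective resolution \<open>(P, d)\<close> of \<open>B\<close>; the resolution is kept as an argument
  instead of being fixed by a choice.
\<close>

definition Tor ::
    "('r, 'c) ring_scheme \<Rightarrow> ('r, 'a) module \<Rightarrow> (nat \<Rightarrow> ('r, 'p) module) \<Rightarrow> (nat \<Rightarrow> 'p \<Rightarrow> 'p) \<Rightarrow>
     nat \<Rightarrow> ('a \<times> 'p \<Rightarrow>\<^sub>0 int) set set monoid" where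
  "Tor R A P d n =
     (tensor_product R A (P n)) \<lparr> carrier := tensor_cycles R A P d n \<rparr>
       Mod tensor_boundaries R A P d n"

end

theory Submission
  imports Defs "HOL-Library.Function_Algebras" "HOL-Library.Product_Plus"
begin

text \<open>
  Let \<open>R = \<int>M\<close>. The homology \<open>H\<^sub>n(M, V) = Tor\<^sub>n(\<int>, V)\<close> of a left \<open>R\<close>-module \<open>V\<close> is the homology of the bar
  complex. In high degrees some positive integer annihilates \<open>H\<^sub>n(M, \<int>)\<close>, and this makes the group finite,
  because the chain groups have finite rank. The bound on the exponent rests on two ideas.

  Left ideals. If \<open>D\<close> is a left ideal of \<open>M\<close> and \<open>W\<close> an abelian group, then \<open>H\<^sub>n(M, \<int>D \<otimes> W) = 0\<close> for
  \<open>n > |D|\<close> (\<open>homology_killed_left_ideal\<close>). For \<open>D = Me\<close> with \<open>e\<close> idempotent the bar complex is contractible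
  in positive degrees (\<open>homology_killed_principal\<close>). In a regular monoid every principal left ideal has
  this form, so removing a maximal \<open>L\<close>-class from \<open>D\<close> reduces the claim to smaller left ideals, at the
  cost of one degree.

  Descent through two-sided ideals. Let \<open>V\<close> be a module annihilated by a two-sided ideal \<open>I \<noteq> M\<close>. Choose
  an idempotent \<open>e \<notin> I\<close> with \<open>MeM\<close> as small as possible. Then \<open>G = eMe - I\<close> is a finite group
  (\<open>minimal_idempotent\<close>), and multiplication \<open>\<mu> : (\<int>Me / \<int>(Me \<inter> I)) \<otimes>\<^sub>G eV \<rightarrow> V\<close> has a kernel and a cokernel
  annihilated by the larger ideal \<open>I \<union> MeM\<close>. By the first idea and averaging over \<open>G\<close>, the order of \<open>G\<close>
  annihilates the homology of the source of \<open>\<mu>\<close> in high degrees. The long exact sequences then give \<open>V\<close>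
  a bound from those for \<open>ker \<mu>\<close> and \<open>coker \<mu>\<close>. Induction on the complement of \<open>I\<close>, starting with
  \<open>I = M\<close> where \<open>V = 0\<close>, reaches \<open>I = {}\<close> and hence \<open>V = \<int>\<close> (\<open>homology_killed_of_ideal_killing\<close>).

  It remains to compare the bar complex with an arbitrary projective resolution \<open>P\<close>. Projective modules are
  acyclic for the bar complex, as retracts of free ones (\<open>projective_module_embedding\<close>). Dimension shifting
  along the kernels of \<open>P\<close> therefore carries finiteness of the bar homology of \<open>\<int>\<close> down to degree zero,
  where it becomes a statement on the coinvariants of \<open>P\<close> (\<open>resolution_homology_finite\<close>). The tensor product
  \<open>\<int> \<otimes>\<^sub>R P\<close> is the group of coinvariants, so that statement says that \<open>Tor\<close> is finite (\<open>tor_finite\<close>).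

  Modules are subquotients of ambient abelian groups given by a type class: a pair of submodules
  \<open>W \<subseteq> V\<close> stands for \<open>V / W\<close>. Quotients and cokernels then need no new types.
\<close>

section \<open>Subgroups, additive maps and multiples\<close>

lemma sum_fun_apply: "(\<Sum>i\<in>A. f i) x = (\<Sum>i\<in>A. f i x)"
  by (induction A rule: infinite_finite_induct) auto

definition subgrp :: "'v::ab_group_add set \<Rightarrow> bool" where
  "subgrp V \<longleftrightarrow> 0 \<in> V \<and> (\<forall>u\<in>V. \<forall>v\<in>V. u - v \<in> V)"

lemma subgrp_0: "subgrp V \<Longrightarrow> 0 \<in> V"
  and subgrp_diff: "subgrp V \<Longrightarrow> u \<in> V \<Longrightarrow> v \<in> V \<Longrightarrow> u - v \<in> V"
  by (auto simp: subgrp_def)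

lemma subgrp_minus: "subgrp V \<Longrightarrow> v \<in> V \<Longrightarrow> - v \<in> V"
  using subgrp_diff[of V 0 v] by (simp add: subgrp_0)

lemma subgrp_add: "subgrp V \<Longrightarrow> u \<in> V \<Longrightarrow> v \<in> V \<Longrightarrow> u + v \<in> V"
  using subgrp_diff[of V u "- v"] by (simp add: subgrp_minus)

lemma subgrp_sum: "subgrp V \<Longrightarrow> (\<And>i. i \<in> A \<Longrightarrow> f i \<in> V) \<Longrightarrow> sum f A \<in> V"
  by (induction A rule: infinite_finite_induct) (auto simp: subgrp_0 subgrp_add)

lemma subgrp_zero_set [simp]: "subgrp {0}"
  by (simp add: subgrp_def)

definition nmul :: "nat \<Rightarrow> 'v::ab_group_add \<Rightarrow> 'v" where
  "nmul k v = (\<Sum>i<k. v)"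

lemma nmul_1 [simp]: "nmul 1 v = v" "nmul (Suc 0) v = v"
  by (simp_all add: nmul_def)

lemma nmul_Suc: "nmul (Suc n) v = v + nmul n v"
  by (simp add: nmul_def add.commute)

lemma sum_const_nmul: "finite S \<Longrightarrow> (\<Sum>i\<in>S. v) = nmul (card S) v"
  by (induction S rule: finite_induct) (simp_all add: nmul_Suc, simp add: nmul_def)

lemma nmul_mult: "nmul (a * b) v = nmul a (nmul b v)"
proof (induction a)
  case (Suc a)
  have "nmul (m + n) v = nmul m v + nmul n v" for m n
    by (induction n) (simp_all add: nmul_def add_ac)
  then show ?case using Suc by (simp add: nmul_def add_ac)
qed (simp add: nmul_def)

lemma nmul_diff: "nmul k (u - v) = nmul k u - nmul k v"
  by (simp add: nmul_def sum_subtractf)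

lemma nmul_fun: "nmul k f x = nmul k (f x)"
  by (simp add: nmul_def sum_fun_apply)

lemma subgrp_nmul: "subgrp V \<Longrightarrow> v \<in> V \<Longrightarrow> nmul k v \<in> V"
  by (simp add: nmul_def subgrp_sum)

text \<open>
  The domain is a subgroup instead of the whole type because the maps of a projective resolution have
  no meaningful value outside the carriers.
\<close>

definition additive_on :: "'v::ab_group_add set \<Rightarrow> ('v \<Rightarrow> 'w::ab_group_add) \<Rightarrow> bool" where
  "additive_on V \<phi> \<longleftrightarrow> subgrp V \<and> (\<forall>u\<in>V. \<forall>v\<in>V. \<phi> (u - v) = \<phi> u - \<phi> v)"

lemma additive_on_diff: "additive_on V \<phi> \<Longrightarrow> u \<in> V \<Longrightarrow> v \<in> V \<Longrightarrow> \<phi> (u - v) = \<phi> u - \<phi> v"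
  by (simp add: additive_on_def)

lemma additive_on_0: "additive_on V \<phi> \<Longrightarrow> \<phi> 0 = 0"
  using additive_on_diff[of V \<phi> 0 0] by (simp add: additive_on_def subgrp_0)

lemma additive_on_add: "additive_on V \<phi> \<Longrightarrow> u \<in> V \<Longrightarrow> v \<in> V \<Longrightarrow> \<phi> (u + v) = \<phi> u + \<phi> v"
  using additive_on_diff[of V \<phi> u "0 - v"] additive_on_diff[of V \<phi> 0 v] additive_on_0[of V \<phi>]
  by (simp add: additive_on_def subgrp_0 subgrp_minus)

lemma additive_on_sum:
  assumes "additive_on V \<phi>" "\<And>i. i \<in> A \<Longrightarrow> f i \<in> V"
  shows "\<phi> (sum f A) = (\<Sum>i\<in>A. \<phi> (f i))"
  using assms(2)
proof (induction A rule: infinite_finite_induct)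
  case (insert x F)
  have "sum f F \<in> V"
    by (rule subgrp_sum) (use insert assms in \<open>auto simp: additive_on_def\<close>)
  then show ?case using insert additive_on_add[OF assms(1)] by simp
qed (use additive_on_0[OF assms(1)] in auto)

lemma additive_on_nmul: "additive_on V \<phi> \<Longrightarrow> v \<in> V \<Longrightarrow> \<phi> (nmul k v) = nmul k (\<phi> v)"
  unfolding nmul_def by (rule additive_on_sum)

section \<open>The bar complex of a finite monoid\<close>

locale finite_monoid = monoid M for M (structure) +
  assumes finite_carrier: "finite (carrier M)"
begin

text \<open>
  The fibres of left multiplication by \<open>x\<close> partition the monoid.
\<close>

lemma sum_fibres:
  assumes "x \<in> carrier M"
  shows "(\<Sum>m\<in>carrier M. \<Sum>m'\<in>{m'\<in>carrier M. x \<otimes> m' = m}. h m m') = (\<Sum>m'\<in>carrier M. h (x \<otimes> m') m')"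
proof -
  have "(\<Sum>m\<in>carrier M. \<Sum>m'\<in>{m'\<in>carrier M. x \<otimes> m' = m}. h m m') =
        (\<Sum>m\<in>carrier M. \<Sum>m'\<in>{m'\<in>carrier M. x \<otimes> m' = m}. h (x \<otimes> m') m')"
    by (intro sum.cong) auto
  also have "\<dots> = (\<Sum>m'\<in>carrier M. h (x \<otimes> m') m')"
    by (rule sum.group) (use assms finite_carrier in auto)
  finally show ?thesis .
qed

lemma sum_fibres_comp:
  assumes "x \<in> carrier M" "y \<in> carrier M"
  shows "(\<Sum>m\<in>{m\<in>carrier M. x \<otimes> m = z}. \<Sum>m'\<in>{m'\<in>carrier M. y \<otimes> m' = m}. h m') =
         (\<Sum>m'\<in>{m'\<in>carrier M. x \<otimes> y \<otimes> m' = z}. h m')"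
proof -
  have "(\<Sum>m\<in>{m\<in>carrier M. x \<otimes> m = z}. \<Sum>m'\<in>{m'\<in>carrier M. y \<otimes> m' = m}. h m') =
      (\<Sum>m\<in>{m\<in>carrier M. x \<otimes> m = z}.
        \<Sum>m'\<in>{m' \<in> {m'\<in>carrier M. x \<otimes> y \<otimes> m' = z}. y \<otimes> m' = m}. h m')"
    using assms by (intro sum.cong) (auto simp: m_assoc)
  also have "\<dots> = (\<Sum>m'\<in>{m'\<in>carrier M. x \<otimes> y \<otimes> m' = z}. h m')"
    by (rule sum.group) (use assms finite_carrier in \<open>auto simp: m_assoc\<close>)
  finally show ?thesis .
qed

text \<open>
  The unit law is imposed on the elements of a submodule instead of the ambient group: translation by \<open>\<one>\<close>
  on functions on \<open>'a\<close> is the identity only on functions that vanish off \<open>carrier M\<close>.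
\<close>

definition action :: "('a \<Rightarrow> 'v::ab_group_add \<Rightarrow> 'v) \<Rightarrow> bool" where
  "action act \<longleftrightarrow> (\<forall>x\<in>carrier M. additive_on UNIV (act x)) \<and>
     (\<forall>x\<in>carrier M. \<forall>y\<in>carrier M. \<forall>v. act (x \<otimes> y) v = act x (act y v))"

definition msubmodule :: "('a \<Rightarrow> 'v::ab_group_add \<Rightarrow> 'v) \<Rightarrow> 'v set \<Rightarrow> bool" where
  "msubmodule act V \<longleftrightarrow> subgrp V \<and> (\<forall>x\<in>carrier M. \<forall>u\<in>V. act x u \<in> V)"

lemma action_diff: "action act \<Longrightarrow> x \<in> carrier M \<Longrightarrow> act x (u - v) = act x u - act x v"
  by (auto simp: action_def additive_on_def)

lemma action_sum: "action act \<Longrightarrow> x \<in> carrier M \<Longrightarrow> act x (sum f A) = (\<Sum>i\<in>A. act x (f i))"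
  by (auto simp: action_def intro!: additive_on_sum[where V = UNIV])

lemma action_0: "action act \<Longrightarrow> x \<in> carrier M \<Longrightarrow> act x 0 = 0"
  by (auto simp: action_def intro: additive_on_0)

lemma action_mult:
  "action act \<Longrightarrow> x \<in> carrier M \<Longrightarrow> y \<in> carrier M \<Longrightarrow> act (x \<otimes> y) v = act x (act y v)"
  by (simp add: action_def)

text \<open>
  Let \<open>B\<^sub>n = \<int>M \<otimes> \<dots> \<otimes> \<int>M \<otimes> V\<close> with \<open>n\<close> factors \<open>\<int>M\<close>. An element is given by its
  coefficients in \<open>V\<close>: a function \<open>f\<close> on lists, of which only the values at lists of length \<open>n\<close> over
  \<open>M\<close> matter. Since \<open>n\<close> is the length of the argument, one operator serves all degrees. The monoid acts on
  the first tensor factor, which is \<open>V\<close> itself for \<open>n = 0\<close>.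
\<close>

definition bar_action :: "('a \<Rightarrow> 'v::ab_group_add \<Rightarrow> 'v) \<Rightarrow> 'a \<Rightarrow> ('a list \<Rightarrow> 'v) \<Rightarrow> 'a list \<Rightarrow> 'v" where
  "bar_action act x f l = (case l of [] \<Rightarrow> act x (f [])
     | m # l' \<Rightarrow> (\<Sum>m'\<in>{m'\<in>carrier M. x \<otimes> m' = m}. f (m' # l')))"

text \<open>
  The map \<open>B\<^sub>n\<^sub>+\<^sub>1 \<rightarrow> B\<^sub>n\<close>, \<open>m \<otimes> w \<mapsto> m w\<close>.
\<close>

definition first_product :: "('a \<Rightarrow> 'v::ab_group_add \<Rightarrow> 'v) \<Rightarrow> ('a list \<Rightarrow> 'v) \<Rightarrow> 'a list \<Rightarrow> 'v" where
  "first_product act f l = (\<Sum>m\<in>carrier M. bar_action act m (\<lambda>l'. f (m # l')) l)"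

text \<open>
  The differential \<open>d\<close> of the bar resolution \<open>\<dots> \<rightarrow> B\<^sub>2 \<rightarrow> B\<^sub>1 \<rightarrow> B\<^sub>0 = V\<close>, in the recursive form
  \<open>d (m \<otimes> w) = m w - m \<otimes> d w\<close>. With this form the identities below follow by induction on
  the list, without the bookkeeping of an alternating sum.
\<close>

primrec bar_d :: "('a \<Rightarrow> 'v::ab_group_add \<Rightarrow> 'v) \<Rightarrow> 'a list \<Rightarrow> ('a list \<Rightarrow> 'v) \<Rightarrow> 'v" where
  "bar_d act [] = (\<lambda>f. first_product act f [])"
| "bar_d act (m # l) = (\<lambda>f. first_product act f (m # l) - bar_d act l (\<lambda>l'. f (m # l')))"

text \<open>
  The map \<open>B\<^sub>n\<^sub>+\<^sub>1 \<rightarrow> B\<^sub>n\<close>, \<open>m \<otimes> w \<mapsto> w\<close>, which identifies the coinvariants of \<open>B\<^sub>n\<^sub>+\<^sub>1\<close> with \<open>B\<^sub>n\<close>.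
\<close>

definition drop_first :: "('a list \<Rightarrow> 'v::ab_group_add) \<Rightarrow> 'a list \<Rightarrow> 'v" where
  "drop_first f l = (\<Sum>m\<in>carrier M. f (m # l))"

text \<open>
  The map \<open>B\<^sub>n \<rightarrow> B\<^sub>n\<^sub>-\<^sub>1\<close> induced by the differential \<open>B\<^sub>n\<^sub>+\<^sub>1 \<rightarrow> B\<^sub>n\<close> on the coinvariants: dropping the first factor
  turns \<open>d (m \<otimes> u) = m u - m \<otimes> d u\<close> into \<open>\<epsilon> u - d u\<close>, where \<open>\<epsilon>\<close> is \<open>drop_first\<close>. Its homology is the
  homology of the monoid with coefficients in \<open>V\<close>.
\<close>

definition coinv_d :: "('a \<Rightarrow> 'v::ab_group_add \<Rightarrow> 'v) \<Rightarrow> ('a list \<Rightarrow> 'v) \<Rightarrow> 'a list \<Rightarrow> 'v" where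
  "coinv_d act f l = drop_first f l - bar_d act l f"

abbreviation cells :: "nat \<Rightarrow> 'a list set" where
  "cells n \<equiv> {l. set l \<subseteq> carrier M \<and> length l = n}"

lemma finite_cells: "finite (cells n)"
  using finite_lists_length_eq[OF finite_carrier] by (simp add: conj_commute)

lemma bar_action_diff:
  assumes "action act" "x \<in> carrier M"
  shows "bar_action act x (\<lambda>l. f l - g l) l = bar_action act x f l - bar_action act x g l"
  using assms by (cases l) (auto simp: bar_action_def action_diff sum_subtractf)

lemma bar_action_sum:
  assumes "action act" "x \<in> carrier M"
  shows "bar_action act x (\<lambda>l. \<Sum>i\<in>A. f i l) l = (\<Sum>i\<in>A. bar_action act x (f i) l)"
  using assms by (cases l) (auto simp: bar_action_def action_sum intro: sum.swap)

lemma first_product_diff: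
  assumes "action act"
  shows "first_product act (\<lambda>l. f l - g l) l = first_product act f l - first_product act g l"
  using assms by (simp add: first_product_def bar_action_diff sum_subtractf)

lemma first_product_sum:
  assumes "action act"
  shows "first_product act (\<lambda>l. \<Sum>i\<in>A. f i l) l = (\<Sum>i\<in>A. first_product act (f i) l)"
  using assms by (simp add: first_product_def bar_action_sum sum.swap[of _ A])

lemma bar_d_diff:
  assumes "action act"
  shows "bar_d act l (\<lambda>l. f l - g l) = bar_d act l f - bar_d act l g"
  by (induction l arbitrary: f g) (simp_all add: first_product_diff[OF assms])

lemma bar_d_sum:
  assumes "action act"
  shows "bar_d act l (\<lambda>l. \<Sum>i\<in>A. f i l) = (\<Sum>i\<in>A. bar_d act l (f i))"
  by (induction l arbitrary: f) (simp_all add: first_product_sum[OF assms] sum_subtractf)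

lemma coinv_d_diff:
  assumes "action act"
  shows "coinv_d act (f - g) = coinv_d act f - coinv_d act g"
  using bar_d_diff[OF assms, of _ f g] by (auto simp: coinv_d_def drop_first_def sum_subtractf fun_diff_def)

lemma coinv_d_additive: "action act \<Longrightarrow> additive_on UNIV (coinv_d act)"
  by (simp add: additive_on_def subgrp_def coinv_d_diff)

lemma bar_action_mult:
  assumes "action act" "x \<in> carrier M" "y \<in> carrier M"
  shows "bar_action act x (bar_action act y f) l = bar_action act (x \<otimes> y) f l"
  using assms by (cases l) (auto simp: bar_action_def action_mult sum_fibres_comp)

lemma first_product_bar_action_sum:
  assumes "action act" "x \<in> carrier M"
  shows "first_product act (bar_action act x f) l = (\<Sum>m\<in>carrier M. bar_action act (x \<otimes> m) (\<lambda>l'. f (m # l')) l)"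
proof -
  have "first_product act (bar_action act x f) l =
    (\<Sum>m\<in>carrier M. \<Sum>m'\<in>{m'\<in>carrier M. x \<otimes> m' = m}. bar_action act m (\<lambda>l'. f (m' # l')) l)"
    unfolding first_product_def by (intro sum.cong refl) (simp add: bar_action_def[of act x] bar_action_sum assms)
  then show ?thesis by (simp add: sum_fibres assms)
qed

lemma first_product_bar_action:
  assumes "action act" "x \<in> carrier M"
  shows "first_product act (bar_action act x f) l = bar_action act x (first_product act f) l"
proof -
  have "bar_action act x (first_product act f) l = (\<Sum>m\<in>carrier M. bar_action act x (bar_action act m (\<lambda>l'. f (m # l'))) l)"
    unfolding first_product_def[abs_def] by (rule bar_action_sum[OF assms])
  then show ?thesis by (simp add: first_product_bar_action_sum bar_action_mult assms)
qed

text \<open>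
  Associativity makes \<open>first_product\<close> linear, and the other term of the recursion leaves the first factor alone.
\<close>

lemma bar_d_bar_action:
  assumes "action act" "x \<in> carrier M"
  shows "bar_d act l (bar_action act x f) = bar_action act x (\<lambda>l. bar_d act l f) l"
proof (cases l)
  case Nil
  then show ?thesis using first_product_bar_action[OF assms, of f "[]"] by (simp add: bar_action_def)
next
  case (Cons m l')
  have "bar_d act l' (\<lambda>l. bar_action act x f (m # l)) =
      (\<Sum>m'\<in>{m'\<in>carrier M. x \<otimes> m' = m}. bar_d act l' (\<lambda>l. f (m' # l)))"
    by (simp add: bar_action_def bar_d_sum assms)
  then show ?thesis using Cons first_product_bar_action[OF assms, of f "m # l'"]
    by (simp add: bar_action_def sum_subtractf)
qed

text \<open>
  This is linearity of \<open>d\<close> in the form \<open>m (d w) = d (m w)\<close>, combined with the recursion for \<open>d\<close>.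
\<close>

lemma first_product_bar_d:
  assumes "action act"
  shows "first_product act (\<lambda>l. bar_d act l f) l = first_product act (first_product act f) l - bar_d act l (first_product act f)"
proof -
  have "first_product act (\<lambda>l. bar_d act l f) l =
     (\<Sum>m\<in>carrier M. bar_action act m (\<lambda>l'. first_product act f (m # l')) l - bar_action act m (\<lambda>l'. bar_d act l' (\<lambda>l''. f (m # l''))) l)"
    by (simp add: first_product_def[of act "\<lambda>l. bar_d act l f"] bar_action_diff assms)
  also have "\<dots> = first_product act (first_product act f) l - (\<Sum>m\<in>carrier M. bar_d act l (bar_action act m (\<lambda>l''. f (m # l''))))"
    by (simp add: sum_subtractf first_product_def[of act "first_product act f"] bar_d_bar_action assms)
  also have "\<dots> = first_product act (first_product act f) l - bar_d act l (first_product act f)"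
    by (simp add: bar_d_sum[symmetric] assms first_product_def[abs_def])
  finally show ?thesis .
qed

lemma bar_d_bar_d:
  assumes "action act"
  shows "bar_d act l (\<lambda>l. bar_d act l f) = 0"
proof (induction l arbitrary: f)
  case Nil
  show ?case using first_product_bar_d[OF assms, of f "[]"] by simp
next
  case (Cons m l)
  have "bar_d act l (\<lambda>l'. bar_d act (m # l') f) = bar_d act l (\<lambda>l'. first_product act f (m # l')) - 0"
    by (simp add: bar_d_diff assms Cons.IH)
  then show ?case using first_product_bar_d[OF assms, of f "m # l"] by simp
qed

lemma drop_first_first_product: "drop_first (first_product act f) l = drop_first (drop_first f) l"
proof -
  have "drop_first (first_product act f) l = (\<Sum>x\<in>carrier M. \<Sum>m\<in>carrier M. \<Sum>m'\<in>{m'\<in>carrier M. x \<otimes> m' = m}. f (x # m' # l))"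
    by (simp add: drop_first_def first_product_def bar_action_def, rule sum.swap)
  also have "\<dots> = (\<Sum>x\<in>carrier M. \<Sum>m\<in>carrier M. f (x # m # l))"
    by (simp add: sum_fibres)
  also have "\<dots> = drop_first (drop_first f) l"
    by (simp add: drop_first_def, rule sum.swap)
  finally show ?thesis .
qed

text \<open>
  Write \<open>\<epsilon>\<close> for \<open>drop_first\<close> and \<open>\<partial>\<close> for \<open>first_product\<close>. Then \<open>\<epsilon> \<partial> = \<epsilon> \<epsilon>\<close>, as \<open>m (m' \<otimes> w)\<close> and
  \<open>m' \<otimes> w\<close> differ only in the first factor. Hence \<open>\<epsilon> d = \<epsilon> \<epsilon> - d \<epsilon>\<close>, and the mixed terms of
  \<open>(\<epsilon> - d) (\<epsilon> - d)\<close> cancel against \<open>\<epsilon> \<epsilon>\<close>.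
\<close>

lemma coinv_d_coinv_d:
  assumes "action act"
  shows "coinv_d act (coinv_d act f) = 0"
proof
  fix l
  have e: "drop_first (\<lambda>l. bar_d act l f) l = drop_first (drop_first f) l - bar_d act l (drop_first f)"
    using bar_d_sum[OF assms, of l "\<lambda>m l. f (m # l)" "carrier M"]
    by (simp add: drop_first_first_product[of act, symmetric], simp add: drop_first_def[abs_def] sum_subtractf)
  have "coinv_d act (coinv_d act f) l = drop_first (coinv_d act f) l - (bar_d act l (drop_first f) - bar_d act l (\<lambda>l. bar_d act l f))"
    unfolding bar_d_diff[OF assms, symmetric] by (simp add: coinv_d_def[abs_def])
  also have "drop_first (coinv_d act f) l = drop_first (drop_first f) l - drop_first (\<lambda>l. bar_d act l f) l"
    unfolding drop_first_def[of "coinv_d act f"] coinv_d_def sum_subtractf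
    by (simp only: drop_first_def)
  finally show "coinv_d act (coinv_d act f) l = 0 l" by (simp add: e bar_d_bar_d[OF assms])
qed

text \<open>
  The differential is built from sums, differences and the action. It therefore preserves every
  additive relation \<open>R\<close> that the actions preserve. With \<open>R = V \<times> {0}\<close> this shows that the chains of a
  submodule form a subcomplex, and with the graph of an equivariant map it is naturality.
\<close>

lemma bar_action_rel:
  assumes R: "subgrp R" "\<And>x u v. x \<in> carrier M \<Longrightarrow> (u, v) \<in> R \<Longrightarrow> (act x u, act' x v) \<in> R"
    and x: "x \<in> carrier M" and l: "set l \<subseteq> carrier M"
    and fg: "\<And>l'. l' \<in> cells (length l) \<Longrightarrow> (f l', g l') \<in> R"
  shows "(bar_action act x f l, bar_action act' x g l) \<in> R"
proof (cases l)
  case (Cons m l')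
  then show ?thesis unfolding bar_action_def
    using l by (auto simp: sum_prod[symmetric] intro!: subgrp_sum R fg)
qed (use R x fg in \<open>auto simp: bar_action_def\<close>)

lemma first_product_rel:
  assumes R: "subgrp R" "\<And>x u v. x \<in> carrier M \<Longrightarrow> (u, v) \<in> R \<Longrightarrow> (act x u, act' x v) \<in> R"
    and l: "set l \<subseteq> carrier M"
    and fg: "\<And>l'. l' \<in> cells (Suc (length l)) \<Longrightarrow> (f l', g l') \<in> R"
  shows "(first_product act f l, first_product act' g l) \<in> R"
  unfolding first_product_def using l
  by (auto simp: sum_prod[symmetric] intro!: subgrp_sum R bar_action_rel fg)

lemma bar_d_rel:
  assumes R: "subgrp R" "\<And>x u v. x \<in> carrier M \<Longrightarrow> (u, v) \<in> R \<Longrightarrow> (act x u, act' x v) \<in> R"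
    and l: "set l \<subseteq> carrier M"
    and fg: "\<And>l'. l' \<in> cells (Suc (length l)) \<Longrightarrow> (f l', g l') \<in> R"
  shows "(bar_d act l f, bar_d act' l g) \<in> R"
  using l fg
proof (induction l arbitrary: f g)
  case Nil
  then show ?case using first_product_rel[OF R, where l = "[]"] by simp
next
  case (Cons m l)
  have "(bar_d act l (\<lambda>l'. f (m # l')), bar_d act' l (\<lambda>l'. g (m # l'))) \<in> R"
    by (rule Cons.IH) (use Cons.prems in auto)
  moreover have "(first_product act f (m # l), first_product act' g (m # l)) \<in> R"
    by (rule first_product_rel[OF R]) (use Cons.prems in auto)
  ultimately show ?case using subgrp_diff[OF R(1)] by fastforce
qed

lemma coinv_d_rel:
  assumes R: "subgrp R" "\<And>x u v. x \<in> carrier M \<Longrightarrow> (u, v) \<in> R \<Longrightarrow> (act x u, act' x v) \<in> R"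
    and fg: "\<And>l'. l' \<in> cells (Suc n) \<Longrightarrow> (f l', g l') \<in> R" and l: "l \<in> cells n"
  shows "(coinv_d act f l, coinv_d act' g l) \<in> R"
proof -
  have "(drop_first f l, drop_first g l) \<in> R"
    unfolding drop_first_def using l by (auto simp: sum_prod[symmetric] intro!: subgrp_sum R fg)
  moreover have "(bar_d act l f, bar_d act' l g) \<in> R"
    by (rule bar_d_rel[OF R]) (use l fg in auto)
  ultimately show ?thesis using subgrp_diff[OF R(1)] by (fastforce simp: coinv_d_def)
qed

definition bar_chains :: "nat \<Rightarrow> 'v::ab_group_add set \<Rightarrow> ('a list \<Rightarrow> 'v) set" where
  "bar_chains n V = {f. \<forall>l\<in>cells n. f l \<in> V}"

lemma subgrp_chains: "subgrp V \<Longrightarrow> subgrp (bar_chains n V)"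
  by (auto simp: bar_chains_def subgrp_def)

lemma chains_mono: "V \<subseteq> W \<Longrightarrow> f \<in> bar_chains n V \<Longrightarrow> f \<in> bar_chains n W"
  by (auto simp: bar_chains_def)

lemma coinv_d_chains:
  assumes "msubmodule act V" "f \<in> bar_chains (Suc n) V"
  shows "coinv_d act f \<in> bar_chains n V"
proof -
  let ?R = "V \<times> {0::int}"
  have "(coinv_d act f l, coinv_d (\<lambda>x v. v) (\<lambda>l. 0::int) l) \<in> ?R" if "l \<in> cells n" for l
    by (rule coinv_d_rel[OF _ _ _ that])
      (use assms in \<open>auto simp: msubmodule_def subgrp_def bar_chains_def zero_prod_def\<close>)
  then show ?thesis by (auto simp: bar_chains_def)
qed

lemma coinv_d_natural:
  assumes "msubmodule act V" "additive_on V \<phi>"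
    and "\<And>x u. x \<in> carrier M \<Longrightarrow> u \<in> V \<Longrightarrow> \<phi> (act x u) = act' x (\<phi> u)"
    and "f \<in> bar_chains (Suc n) V"
  shows "coinv_d act' (\<phi> \<circ> f) - (\<phi> \<circ> coinv_d act f) \<in> bar_chains n {0}"
proof -
  let ?R = "{(u, \<phi> u) | u. u \<in> V}"
  have "(coinv_d act f l, coinv_d act' (\<phi> \<circ> f) l) \<in> ?R" if "l \<in> cells n" for l
  proof (rule coinv_d_rel[OF _ _ _ that])
    show "subgrp ?R"
      unfolding subgrp_def
      using assms(1) additive_on_0[OF assms(2)] additive_on_diff[OF assms(2)]
      by (auto simp: msubmodule_def subgrp_def zero_prod_def)
  qed (use assms in \<open>auto simp: msubmodule_def bar_chains_def\<close>)
  then show ?thesis by (auto simp: bar_chains_def)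
qed


section \<open>Exponents of homology groups\<close>

text \<open>
  Multiplication by \<open>k\<close> annihilates the homology of degree \<open>n + 1\<close> with coefficients in \<open>V / W\<close>. Cycles and
  boundaries of the quotient are spelled out for representatives in \<open>V\<close>.
\<close>

definition homology_killed :: "('a \<Rightarrow> 'v::ab_group_add \<Rightarrow> 'v) \<Rightarrow> nat \<Rightarrow> nat \<Rightarrow> 'v set \<Rightarrow> 'v set \<Rightarrow> bool" where
  "homology_killed act n k V W \<longleftrightarrow> (\<forall>z\<in>bar_chains (Suc n) V. coinv_d act z \<in> bar_chains n W \<longrightarrow>
     (\<exists>y\<in>bar_chains (Suc (Suc n)) V. nmul k z - coinv_d act y \<in> bar_chains (Suc n) W))"

lemma homology_killedI:
  assumes "\<And>z. z \<in> bar_chains (Suc n) V \<Longrightarrow> coinv_d act z \<in> bar_chains n W \<Longrightarrow>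
    \<exists>y\<in>bar_chains (Suc (Suc n)) V. nmul k z - coinv_d act y \<in> bar_chains (Suc n) W"
  shows "homology_killed act n k V W"
  using assms by (simp add: homology_killed_def)

lemma homology_killedE:
  assumes "homology_killed act n k V W" "z \<in> bar_chains (Suc n) V" "coinv_d act z \<in> bar_chains n W"
  obtains y where "y \<in> bar_chains (Suc (Suc n)) V" "nmul k z - coinv_d act y \<in> bar_chains (Suc n) W"
  using assms by (auto simp: homology_killed_def)

lemma msubmodule_subgrp: "msubmodule act V \<Longrightarrow> subgrp (bar_chains n V)" "msubmodule act V \<Longrightarrow> subgrp V"
  by (simp_all add: msubmodule_def subgrp_chains)

lemma homology_killed_refl: "msubmodule act V \<Longrightarrow> action act \<Longrightarrow> homology_killed act n k V V"
  unfolding homology_killed_def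
  by (auto intro!: bexI[of _ 0] subgrp_diff subgrp_nmul coinv_d_chains subgrp_0 msubmodule_subgrp(1))

lemma coinv_d_nmul: "action act \<Longrightarrow> coinv_d act (nmul k f) = nmul k (coinv_d act f)"
  by (rule additive_on_nmul[OF coinv_d_additive]) auto

lemma coinv_d_add: "action act \<Longrightarrow> coinv_d act (f + g) = coinv_d act f + coinv_d act g"
  by (rule additive_on_add[OF coinv_d_additive]) auto

lemma chains_0: "msubmodule act V \<Longrightarrow> 0 \<in> bar_chains n V"
  by (simp add: msubmodule_subgrp subgrp_0)

text \<open>
  Exactness of \<open>H\<^sub>n(W / Z) \<rightarrow> H\<^sub>n(V / Z) \<rightarrow> H\<^sub>n(V / W)\<close> in the middle.
\<close>

lemma homology_killed_extension:
  assumes act: "action act" and sub: "msubmodule act V" "msubmodule act W" "msubmodule act Z"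
    and "Z \<subseteq> W" "W \<subseteq> V"
    and h1: "homology_killed act n a W Z" and h2: "homology_killed act n b V W"
  shows "homology_killed act n (a * b) V Z"
proof (rule homology_killedI)
  fix z assume z: "z \<in> bar_chains (Suc n) V" "coinv_d act z \<in> bar_chains n Z"
  note sg = msubmodule_subgrp(1)[OF sub(1)] msubmodule_subgrp(1)[OF sub(2)] msubmodule_subgrp(1)[OF sub(3)]
  obtain y where y: "y \<in> bar_chains (Suc (Suc n)) V" "nmul b z - coinv_d act y \<in> bar_chains (Suc n) W"
    using homology_killedE[OF h2 z(1)] chains_mono[OF \<open>Z \<subseteq> W\<close> z(2)] by blast
  have "coinv_d act (nmul b z - coinv_d act y) = nmul b (coinv_d act z)"
    by (simp add: coinv_d_diff coinv_d_nmul coinv_d_coinv_d act)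
  then have "coinv_d act (nmul b z - coinv_d act y) \<in> bar_chains n Z"
    using z(2) sg by (simp add: subgrp_nmul)
  then obtain y' where y': "y' \<in> bar_chains (Suc (Suc n)) W"
      "nmul a (nmul b z - coinv_d act y) - coinv_d act y' \<in> bar_chains (Suc n) Z"
    using homology_killedE[OF h1 y(2)] by blast
  have "nmul (a * b) z - coinv_d act (nmul a y + y') = nmul a (nmul b z - coinv_d act y) - coinv_d act y'"
    by (simp add: nmul_mult nmul_diff coinv_d_add coinv_d_nmul act)
  then show "\<exists>y\<in>bar_chains (Suc (Suc n)) V. nmul (a * b) z - coinv_d act y \<in> bar_chains (Suc n) Z"
    using y' y(1) chains_mono[OF \<open>W \<subseteq> V\<close> y'(1)] sg
    by (intro bexI[of _ "nmul a y + y'"]) (auto intro: subgrp_add subgrp_nmul)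
qed

text \<open>
  Exactness of \<open>H\<^sub>n\<^sub>+\<^sub>1(V / Z) \<rightarrow> H\<^sub>n\<^sub>+\<^sub>1(V / W) \<rightarrow> H\<^sub>n(W / Z)\<close> in the middle.
\<close>

lemma homology_killed_quotient:
  assumes act: "action act" and sub: "msubmodule act V" "msubmodule act W" "msubmodule act Z"
    and "Z \<subseteq> W" "W \<subseteq> V"
    and h1: "homology_killed act (Suc n) a V Z" and h2: "homology_killed act n b W Z"
  shows "homology_killed act (Suc n) (a * b) V W"
proof (rule homology_killedI)
  fix z assume z: "z \<in> bar_chains (Suc (Suc n)) V" "coinv_d act z \<in> bar_chains (Suc n) W"
  note sg = msubmodule_subgrp(1)[OF sub(1)] msubmodule_subgrp(1)[OF sub(2)] msubmodule_subgrp(1)[OF sub(3)]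
  obtain y where y: "y \<in> bar_chains (Suc (Suc n)) W" "nmul b (coinv_d act z) - coinv_d act y \<in> bar_chains (Suc n) Z"
    using homology_killedE[OF h2 z(2)] chains_0[OF sub(3)] by (auto simp: coinv_d_coinv_d act)
  have "nmul b z - y \<in> bar_chains (Suc (Suc n)) V"
    by (intro subgrp_diff subgrp_nmul sg z chains_mono[OF \<open>W \<subseteq> V\<close>] y)
  moreover have "coinv_d act (nmul b z - y) \<in> bar_chains (Suc n) Z"
    using y(2) by (simp add: coinv_d_diff coinv_d_nmul act)
  ultimately obtain y2 where y2: "y2 \<in> bar_chains (Suc (Suc (Suc n))) V"
      "nmul a (nmul b z - y) - coinv_d act y2 \<in> bar_chains (Suc (Suc n)) Z"
    using homology_killedE[OF h1] by blast
  have "nmul (a * b) z - coinv_d act y2 = (nmul a (nmul b z - y) - coinv_d act y2) + nmul a y"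
    by (simp add: nmul_mult nmul_diff)
  also have "\<dots> \<in> bar_chains (Suc (Suc n)) W"
    by (intro subgrp_add subgrp_nmul sg y chains_mono[OF \<open>Z \<subseteq> W\<close>] y2)
  finally show "\<exists>y\<in>bar_chains (Suc (Suc (Suc n))) V. nmul (a * b) z - coinv_d act y \<in> bar_chains (Suc (Suc n)) W"
    using y2 by blast
qed

definition equivariant_on ::
    "('a \<Rightarrow> 'v::ab_group_add \<Rightarrow> 'v) \<Rightarrow> ('a \<Rightarrow> 'w::ab_group_add \<Rightarrow> 'w) \<Rightarrow> 'v set \<Rightarrow> ('v \<Rightarrow> 'w) \<Rightarrow> bool" where
  "equivariant_on act act' V \<phi> \<longleftrightarrow> additive_on V \<phi> \<and>
     (\<forall>x\<in>carrier M. \<forall>u\<in>V. \<phi> (act x u) = act' x (\<phi> u))"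

lemma additive_on_chains: "additive_on V \<phi> \<Longrightarrow> f \<in> bar_chains n V \<Longrightarrow> g \<in> bar_chains n V \<Longrightarrow>
   (\<phi> \<circ> (f - g)) - ((\<phi> \<circ> f) - (\<phi> \<circ> g)) \<in> bar_chains n {0}"
  by (auto simp: bar_chains_def additive_on_diff)

text \<open>
  The hypotheses say that \<open>\<phi>\<close> induces an isomorphism \<open>V / W \<rightarrow> V' / W'\<close>.
\<close>

lemma homology_killed_transfer:
  assumes act: "action act" "action act'"
    and sub: "msubmodule act V" "msubmodule act' V'" "msubmodule act' W'"
    and \<phi>: "equivariant_on act act' V \<phi>" "\<And>v. v \<in> V \<Longrightarrow> \<phi> v \<in> V'" "W' \<subseteq> V'"
    and ker: "\<And>v. v \<in> V \<Longrightarrow> \<phi> v \<in> W' \<longleftrightarrow> v \<in> W"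
    and surj: "\<And>v'. v' \<in> V' \<Longrightarrow> \<exists>v\<in>V. v' - \<phi> v \<in> W'"
    and h: "homology_killed act n k V W"
  shows "homology_killed act' n k V' W'"
proof (rule homology_killedI)
  fix z assume z: "z \<in> bar_chains (Suc n) V'" "coinv_d act' z \<in> bar_chains n W'"
  note sg = msubmodule_subgrp(1)[OF sub(1)] msubmodule_subgrp(1)[OF sub(2)] msubmodule_subgrp(1)[OF sub(3)]
  note W0 = subgrp_0[OF msubmodule_subgrp(2)[OF sub(3)]]
  have zero: "f \<in> bar_chains m W'" if "f \<in> bar_chains m {0}" for f m
    using that W0 by (auto simp: bar_chains_def)
  have nat: "coinv_d act' (\<phi> \<circ> f) - (\<phi> \<circ> coinv_d act f) \<in> bar_chains m W'" if "f \<in> bar_chains (Suc m) V" for f m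
    by (rule zero[OF coinv_d_natural[OF sub(1) _ _ that]]) (use \<phi> in \<open>auto simp: equivariant_on_def\<close>)
  have add: "(\<phi> \<circ> (f - g)) - ((\<phi> \<circ> f) - (\<phi> \<circ> g)) \<in> bar_chains m W'"
    if "f \<in> bar_chains m V" "g \<in> bar_chains m V" for f g m
    by (rule zero[OF additive_on_chains[OF _ that]]) (use \<phi> in \<open>auto simp: equivariant_on_def\<close>)
  have nm: "(\<phi> \<circ> nmul k f) - nmul k (\<phi> \<circ> f) \<in> bar_chains m W'" if "f \<in> bar_chains m V" for f m
    by (rule zero) (use \<phi>(1) that in
      \<open>auto simp: bar_chains_def nmul_fun equivariant_on_def additive_on_nmul\<close>)
  have im: "\<phi> \<circ> f \<in> bar_chains m V'" if "f \<in> bar_chains m V" for f m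
    using that \<phi>(2) by (auto simp: bar_chains_def)
  have ker': "f \<in> bar_chains m W" if "f \<in> bar_chains m V" "\<phi> \<circ> f \<in> bar_chains m W'" for f m
    using that ker by (auto simp: bar_chains_def)
  have "\<forall>l. \<exists>v. l \<in> cells (Suc n) \<longrightarrow> v \<in> V \<and> z l - \<phi> v \<in> W'"
    using z(1) surj by (fastforce simp: bar_chains_def)
  then obtain z1 where "\<forall>l. l \<in> cells (Suc n) \<longrightarrow> z1 l \<in> V \<and> z l - \<phi> (z1 l) \<in> W'" by metis
  then have z1: "z1 \<in> bar_chains (Suc n) V" "z - (\<phi> \<circ> z1) \<in> bar_chains (Suc n) W'"
    by (auto simp: bar_chains_def)
  have c1: "coinv_d act z1 \<in> bar_chains n V" by (rule coinv_d_chains[OF sub(1) z1(1)])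
  have "\<phi> \<circ> coinv_d act z1 = coinv_d act' z - (coinv_d act' (z - (\<phi> \<circ> z1))) - (coinv_d act' (\<phi> \<circ> z1) - (\<phi> \<circ> coinv_d act z1))"
    by (simp add: coinv_d_diff act)
  also have "\<dots> \<in> bar_chains n W'"
    by (intro subgrp_diff sg nat z1 z coinv_d_chains[OF sub(3)])
  finally have "coinv_d act z1 \<in> bar_chains n W" using ker' c1 by blast
  then obtain y1 where y1: "y1 \<in> bar_chains (Suc (Suc n)) V" "nmul k z1 - coinv_d act y1 \<in> bar_chains (Suc n) W"
    using homology_killedE[OF h z1(1)] by blast
  have c: "nmul k z1 \<in> bar_chains (Suc n) V" "coinv_d act y1 \<in> bar_chains (Suc n) V"
    using z1 y1 sg by (auto intro: subgrp_nmul coinv_d_chains[OF sub(1)])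
  have "\<phi> \<circ> (nmul k z1 - coinv_d act y1) \<in> bar_chains (Suc n) W'"
    using y1(2) subgrp_diff[OF sg(1) c] ker by (auto simp: bar_chains_def)
  moreover have "nmul k z - coinv_d act' (\<phi> \<circ> y1) = nmul k (z - (\<phi> \<circ> z1)) -
      ((\<phi> \<circ> nmul k z1) - nmul k (\<phi> \<circ> z1)) - (coinv_d act' (\<phi> \<circ> y1) - (\<phi> \<circ> coinv_d act y1)) -
      ((\<phi> \<circ> (nmul k z1 - coinv_d act y1)) - ((\<phi> \<circ> nmul k z1) - (\<phi> \<circ> coinv_d act y1))) + (\<phi> \<circ> (nmul k z1 - coinv_d act y1))"
    by (simp add: nmul_diff)
  ultimately have "nmul k z - coinv_d act' (\<phi> \<circ> y1) \<in> bar_chains (Suc n) W'"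
    by (auto simp only: intro!: subgrp_diff subgrp_add subgrp_nmul sg add c nm z1 nat y1)
  then show "\<exists>y\<in>bar_chains (Suc (Suc n)) V'. nmul k z - coinv_d act' y \<in> bar_chains (Suc n) W'"
    using im[OF y1(1)] by blast
qed

text \<open>
  The map \<open>\<phi>\<close> factors through \<open>V / W \<rightarrow> V / Z\<close>, and followed by the projection back to \<open>V / W\<close> it is
  multiplication by \<open>k\<close>. So \<open>V / W\<close> is a retract of \<open>V / Z\<close> up to the factor \<open>k\<close>.
\<close>

lemma homology_killed_endomorphism:
  assumes act: "action act" and sub: "msubmodule act V" "msubmodule act W" "msubmodule act Z"
    and "Z \<subseteq> W" "W \<subseteq> V"
    and \<phi>: "equivariant_on act act V \<phi>" "\<And>v. v \<in> V \<Longrightarrow> \<phi> v \<in> V" "\<And>v. v \<in> W \<Longrightarrow> \<phi> v \<in> Z"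
    and k: "\<And>v. v \<in> V \<Longrightarrow> nmul k v - \<phi> v \<in> W"
    and h: "homology_killed act n a V Z"
  shows "homology_killed act n (a * k) V W"
proof (rule homology_killedI)
  fix z assume z: "z \<in> bar_chains (Suc n) V" "coinv_d act z \<in> bar_chains n W"
  note sg = msubmodule_subgrp(1)[OF sub(1)] msubmodule_subgrp(1)[OF sub(2)] msubmodule_subgrp(1)[OF sub(3)]
  have "coinv_d act (\<phi> \<circ> z) - (\<phi> \<circ> coinv_d act z) \<in> bar_chains n {0}"
    by (rule coinv_d_natural[OF sub(1) _ _ z(1)]) (use \<phi> in \<open>auto simp: equivariant_on_def\<close>)
  then have "coinv_d act (\<phi> \<circ> z) - (\<phi> \<circ> coinv_d act z) \<in> bar_chains n Z"
    using msubmodule_subgrp(2)[OF sub(3), THEN subgrp_0] by (auto simp: bar_chains_def)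
  moreover have "\<phi> \<circ> coinv_d act z \<in> bar_chains n Z"
    using z(2) \<phi>(3) by (auto simp: bar_chains_def)
  ultimately have "coinv_d act (\<phi> \<circ> z) \<in> bar_chains n Z"
    using subgrp_add[OF sg(3)] by fastforce
  moreover have "\<phi> \<circ> z \<in> bar_chains (Suc n) V"
    using z(1) \<phi>(2) by (auto simp: bar_chains_def)
  ultimately obtain y where y: "y \<in> bar_chains (Suc (Suc n)) V"
      "nmul a (\<phi> \<circ> z) - coinv_d act y \<in> bar_chains (Suc n) Z"
    using homology_killedE[OF h] by blast
  have "nmul k z - (\<phi> \<circ> z) \<in> bar_chains (Suc n) W"
    using z(1) k by (auto simp: bar_chains_def nmul_fun)
  then have "nmul a (nmul k z - (\<phi> \<circ> z)) + (nmul a (\<phi> \<circ> z) - coinv_d act y) \<in> bar_chains (Suc n) W"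
    using y(2) sg chains_mono[OF \<open>Z \<subseteq> W\<close>] by (auto intro!: subgrp_add subgrp_nmul)
  then show "\<exists>y\<in>bar_chains (Suc (Suc n)) V. nmul (a * k) z - coinv_d act y \<in> bar_chains (Suc n) W"
    using y(1) by (auto simp: nmul_mult nmul_diff)
qed

lemma homology_killed_retract:
  assumes act: "action act" and sub: "msubmodule act V" "msubmodule act W" and "W \<subseteq> V"
    and r: "equivariant_on act act V r" "\<And>v. v \<in> V \<Longrightarrow> r v \<in> W" "\<And>v. v \<in> W \<Longrightarrow> r v = v"
    and h: "homology_killed act n k V {0}"
  shows "homology_killed act n k W {0}"
proof (rule homology_killedI)
  fix z assume z: "z \<in> bar_chains (Suc n) W" "coinv_d act z \<in> bar_chains n {0}"
  note sg = msubmodule_subgrp(1)[OF sub(1)] msubmodule_subgrp(1)[OF sub(2)]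
  obtain y where y: "y \<in> bar_chains (Suc (Suc n)) V" "nmul k z - coinv_d act y \<in> bar_chains (Suc n) {0}"
    using homology_killedE[OF h chains_mono[OF \<open>W \<subseteq> V\<close> z(1)] z(2)] by blast
  have nat: "coinv_d act (r \<circ> y) - (r \<circ> coinv_d act y) \<in> bar_chains (Suc n) {0}"
    by (rule coinv_d_natural[OF sub(1) _ _ y(1)]) (use r in \<open>auto simp: equivariant_on_def\<close>)
  have "nmul k z \<in> bar_chains (Suc n) W" by (intro subgrp_nmul sg z)
  then have "nmul k z - coinv_d act (r \<circ> y) \<in> bar_chains (Suc n) {0}"
    using nat y(2) r(3) by (auto simp: bar_chains_def)
  then show "\<exists>y\<in>bar_chains (Suc (Suc n)) W. nmul k z - coinv_d act y \<in> bar_chains (Suc n) {0}"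
    using y(1) r(2) by (intro bexI[of _ "r \<circ> y"]) (auto simp: bar_chains_def)
qed


section \<open>Modules spanned by left ideals\<close>

text \<open>
  Left multiplication on \<open>\<int>M \<otimes> W\<close>, whose elements are functions from \<open>M\<close> to \<open>W\<close>.
\<close>

definition translate :: "'a \<Rightarrow> ('a \<Rightarrow> 'v::ab_group_add) \<Rightarrow> 'a \<Rightarrow> 'v" where
  "translate x f l = (\<Sum>l'\<in>{l'\<in>carrier M. x \<otimes> l' = l}. f l')"

definition sections :: "('a \<Rightarrow> 'v set) \<Rightarrow> ('a \<Rightarrow> 'v) set" where
  "sections A = {f. \<forall>l. f l \<in> A l}"

text \<open>
  The condition under which the functions \<open>f\<close> with \<open>f l \<in> A l\<close> form a submodule: translation by \<open>x\<close> moves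
  the value at \<open>l\<close> to \<open>x \<otimes> l\<close>.
\<close>

definition stable_family :: "('a \<Rightarrow> 'v::ab_group_add set) \<Rightarrow> bool" where
  "stable_family A \<longleftrightarrow> (\<forall>l. subgrp (A l)) \<and> (\<forall>x\<in>carrier M. \<forall>l\<in>carrier M. A l \<subseteq> A (x \<otimes> l))"

lemma action_translate: "action translate"
  unfolding action_def
proof (intro conjI ballI allI)
  fix x y :: 'a and v assume xy: "x \<in> carrier M" "y \<in> carrier M"
  show "translate (x \<otimes> y) v = translate x (translate y v)"
    by (rule ext) (simp add: translate_def sum_fibres_comp xy)
qed (auto simp: additive_on_def translate_def subgrp_def sum_subtractf)

lemma msubmodule_sections:
  assumes "stable_family A"
  shows "msubmodule translate (sections A)"
  unfolding msubmodule_def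
proof (intro conjI ballI)
  show "subgrp (sections A)"
    using assms by (auto simp: stable_family_def sections_def subgrp_def)
  fix x f assume x: "x \<in> carrier M" "f \<in> sections A"
  show "translate x f \<in> sections A"
    unfolding sections_def translate_def
  proof (intro CollectI allI)
    fix l
    show "(\<Sum>l'\<in>{l'\<in>carrier M. x \<otimes> l' = l}. f l') \<in> A l"
      by (rule subgrp_sum) (use assms x in \<open>auto simp: stable_family_def sections_def, blast\<close>)
  qed
qed

text \<open>
  A quotient of modules of sections depends only on the quotient groups \<open>A l / B l\<close>. The hypotheses say
  that \<open>A1 l / B1 l \<rightarrow> A2 l / B2 l\<close> is bijective for every \<open>l\<close>.
\<close>

lemma homology_killed_excision:
  assumes st: "stable_family A1" "stable_family A2" "stable_family B2"
    and "\<And>l. A1 l \<subseteq> A2 l" "\<And>l. B2 l \<subseteq> A2 l" "\<And>l. B1 l = A1 l \<inter> B2 l"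
    and "\<And>l v. v \<in> A2 l \<Longrightarrow> \<exists>u\<in>A1 l. v - u \<in> B2 l"
    and h: "homology_killed translate n k (sections A1) (sections B1)"
  shows "homology_killed translate n k (sections A2) (sections B2)"
proof (rule homology_killed_transfer[OF action_translate action_translate _ _ _ _ _ _ _ _ h])
  show "equivariant_on translate translate (sections A1) (\<lambda>v. v)"
    using msubmodule_sections[OF st(1)] by (simp add: equivariant_on_def additive_on_def msubmodule_def)
  fix v' assume v': "v' \<in> sections A2"
  then have "\<forall>l. \<exists>u. u \<in> A1 l \<and> v' l - u \<in> B2 l"
    using assms(7) unfolding sections_def by blast
  then obtain u where "\<And>l. u l \<in> A1 l \<and> v' l - u l \<in> B2 l" by metis
  then show "\<exists>v\<in>sections A1. v' - v \<in> sections B2"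
    by (intro bexI[of _ u]) (auto simp: sections_def)
next
  show "v \<in> sections B2 \<longleftrightarrow> v \<in> sections B1" if "v \<in> sections A1" for v
    using that assms(6) by (auto simp: sections_def)
  show "sections B2 \<subseteq> sections A2" using assms(5) unfolding sections_def by blast
  show "v \<in> sections A2" if "v \<in> sections A1" for v
    using that assms(4) unfolding sections_def by blast
qed (use st in \<open>simp_all add: msubmodule_sections\<close>)

definition single :: "'a \<Rightarrow> 'v \<Rightarrow> 'a \<Rightarrow> 'v::ab_group_add" where
  "single e v = (\<lambda>y. if y = e then v else 0)"

lemma single_sum: "single e (\<Sum>i\<in>A. f i) = (\<Sum>i\<in>A. single e (f i))"
  by (rule ext) (simp add: single_def sum_fun_apply)

lemma single_diff: "single e (u - v) = single e u - single e v"
  by (rule ext) (simp add: single_def)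

lemma translate_single:
  assumes "e \<in> carrier M"
  shows "translate m (single e v) = single (m \<otimes> e) v"
proof
  fix y
  show "translate m (single e v) y = single (m \<otimes> e) v y"
    unfolding translate_def single_def using assms finite_carrier by (auto simp: sum.delta)
qed

text \<open>
  For \<open>e\<close> idempotent, the map \<open>l \<otimes> v \<mapsto> l \<otimes> (e \<otimes> v)\<close> from \<open>\<int>Me \<otimes> W\<close> to \<open>B\<^sub>1 = \<int>M \<otimes> (\<int>Me \<otimes> W)\<close> is
  linear and, as \<open>l e = l\<close>, splits \<open>B\<^sub>1 \<rightarrow> B\<^sub>0\<close>. It is applied behind the first \<open>n\<close> tensor factors, with
  sign \<open>(-1)\<^sup>n\<close>.
\<close>

fun contraction :: "'a \<Rightarrow> 'a list \<Rightarrow> ('a list \<Rightarrow> 'a \<Rightarrow> 'v::ab_group_add) \<Rightarrow> 'a \<Rightarrow> 'v" where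
  "contraction e [] f = 0"
| "contraction e (m # l) f = (if l = [] then single e (f [] m) else 0) - contraction e l (\<lambda>l'. f (m # l'))"

lemma contraction_Nil: "contraction e [] f = 0"
  by (rule ext) simp

lemma contraction_Cons:
  "contraction e (m # l) f = (if l = [] then single e (f [] m) else 0) - contraction e l (\<lambda>l'. f (m # l'))"
  by (rule ext) simp

declare contraction.simps [simp del]
declare contraction_Nil [simp] contraction_Cons [simp]

lemma contraction_diff: "contraction e l (\<lambda>l. f l - g l) = contraction e l f - contraction e l g"
  by (induction l arbitrary: f g) (simp_all add: single_diff)

lemma contraction_sum: "contraction e l (\<lambda>l. \<Sum>i\<in>A. f i l) = (\<Sum>i\<in>A. contraction e l (f i))"
  by (induction l arbitrary: f) (simp_all add: single_sum sum_subtractf sum_fun_apply)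

text \<open>
  The contraction is \<open>M\<close>-linear, so it contracts the coinvariants as well.
\<close>

lemma contraction_bar_action:
  assumes "x \<in> carrier M"
  shows "contraction e l (bar_action translate x f) = bar_action translate x (\<lambda>l. contraction e l f) l"
proof (cases l)
  case Nil
  then show ?thesis using action_0[OF action_translate assms] by (simp add: bar_action_def)
next
  case (Cons m l')
  have "contraction e l' (\<lambda>l. bar_action translate x f (m # l)) =
      (\<Sum>m'\<in>{m'\<in>carrier M. x \<otimes> m' = m}. contraction e l' (\<lambda>l. f (m' # l)))"
    by (simp add: bar_action_def contraction_sum)
  moreover have "single e (bar_action translate x f [] m) = (\<Sum>m'\<in>{m'\<in>carrier M. x \<otimes> m' = m}. single e (f [] m'))"
    by (simp add: bar_action_def translate_def single_sum)
  ultimately show ?thesis using Cons by (simp add: bar_action_def sum_subtractf)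
qed

lemma bar_d_eq_0:
  assumes "action act" "set l \<subseteq> carrier M" "\<And>l'. l' \<in> cells (Suc (length l)) \<Longrightarrow> f l' = 0"
  shows "bar_d act l f = 0"
proof -
  have "(bar_d act l f, bar_d act l (\<lambda>l. f l - f l)) \<in> {0} \<times> {0}"
    by (rule bar_d_rel[where act = act and act' = act])
      (use assms in \<open>auto simp: subgrp_def zero_prod_def action_0\<close>)
  then show ?thesis by simp
qed

text \<open>
  The left ideal \<open>Me\<close>, for idempotent \<open>e\<close>.
\<close>

definition principal :: "'a \<Rightarrow> 'a set" where
  "principal e = {x\<in>carrier M. x \<otimes> e = x}"

text \<open>
  The contraction \<open>h\<close> satisfies \<open>d h + h d = id\<close>. In the induction step, linearity of \<open>h\<close> gives
  \<open>\<partial> h = - h \<partial>\<close> for \<open>\<partial> = first_product\<close>, since \<open>h\<close> changes sign behind one more factor. What is left is the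
  induction hypothesis behind the first factor.
\<close>

lemma contraction_homotopy:
  fixes f :: "'a list \<Rightarrow> 'a \<Rightarrow> 'v::ab_group_add"
  assumes e: "e \<in> carrier M"
    and "set l \<subseteq> carrier M" "\<And>l' m. l' \<in> cells (length l) \<Longrightarrow> m \<notin> principal e \<Longrightarrow> f l' m = 0"
  shows "bar_d translate l (\<lambda>l. contraction e l f) + contraction e l (\<lambda>l. bar_d translate l f) = f l"
  using assms(2,3)
proof (induction l arbitrary: f)
  case Nil
  have "(\<Sum>m\<in>carrier M. single (m \<otimes> e) (f [] m)) y = f [] y" for y
  proof -
    have "(\<Sum>m\<in>carrier M. single (m \<otimes> e) (f [] m)) y = (\<Sum>m\<in>carrier M. if y = m then f [] m else 0)"
      unfolding sum_fun_apply
    proof (rule sum.cong[OF refl])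
      fix m assume "m \<in> carrier M"
      then show "single (m \<otimes> e) (f [] m) y = (if y = m then f [] m else 0)"
        using Nil(2)[of "[]" m] by (cases "m \<otimes> e = m") (auto simp: single_def principal_def)
    qed
    also have "\<dots> = f [] y"
      using finite_carrier Nil(2)[of "[]" y] by (auto simp: principal_def)
    finally show ?thesis .
  qed
  then show ?case
    by (auto simp: first_product_def bar_action_def translate_single e)
next
  case (Cons m l)
  have m: "m \<in> carrier M" "set l \<subseteq> carrier M" using Cons.prems by auto
  let ?g = "\<lambda>l'. f (m # l')"
  have IH: "bar_d translate l (\<lambda>l. contraction e l ?g) + contraction e l (\<lambda>l. bar_d translate l ?g) = ?g l"
    by (rule Cons.IH) (use Cons.prems m in auto)
  have 1: "bar_d translate l (\<lambda>l'. contraction e (m # l') f) = - bar_d translate l (\<lambda>l. contraction e l ?g)"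
  proof -
    have "bar_d translate l (\<lambda>l'. contraction e (m # l') f) =
        bar_d translate l (\<lambda>l'. if l' = [] then single e (f [] m) else 0) - bar_d translate l (\<lambda>l. contraction e l ?g)"
      unfolding contraction_Cons by (rule bar_d_diff[OF action_translate])
    moreover have "bar_d translate l (\<lambda>l'. if l' = [] then single e (f [] m) else 0) = 0"
      by (rule bar_d_eq_0[OF action_translate m(2)]) auto
    ultimately show ?thesis by (simp only: diff_0)
  qed
  have 2: "first_product translate (\<lambda>l. contraction e l f) (m # l) = - contraction e (m # l) (first_product translate f)"
  proof -
    have "first_product translate (\<lambda>l. contraction e l f) (m # l) =
        (\<Sum>x\<in>carrier M. - bar_action translate x (\<lambda>l. contraction e l (\<lambda>l'. f (x # l'))) (m # l))"
      unfolding first_product_def by (intro sum.cong refl) (simp add: bar_action_def sum_negf[symmetric])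
    also have "\<dots> = - (\<Sum>x\<in>carrier M. contraction e (m # l) (bar_action translate x (\<lambda>l'. f (x # l'))))"
      unfolding sum_negf by (intro arg_cong[where f = uminus] sum.cong refl contraction_bar_action[symmetric])
    also have "\<dots> = - contraction e (m # l) (first_product translate f)"
      unfolding contraction_sum[symmetric] first_product_def[abs_def] ..
    finally show ?thesis .
  qed
  have 3: "contraction e (m # l) (\<lambda>l. bar_d translate l f) = contraction e (m # l) (first_product translate f) + contraction e l (\<lambda>l. bar_d translate l ?g)"
    by (simp add: contraction_diff)
  have "bar_d translate (m # l) (\<lambda>l. contraction e l f) =
      - contraction e (m # l) (first_product translate f) - - bar_d translate l (\<lambda>l. contraction e l ?g)"
    by (simp only: bar_d.simps 1 2)
  moreover have "- a - - b + (a + c) = b + c" for a b c :: "'a \<Rightarrow> 'v"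
    by (simp only: diff_minus_eq_add add.assoc minus_add_cancel) (simp add: fun_eq_iff)
  ultimately show ?case unfolding 3 IH[symmetric] by (simp only:)
qed

lemma contraction_sections:
  assumes W: "subgrp W" and e: "e \<in> principal e"
    and "set l \<subseteq> carrier M" "length l = Suc n"
    and "f \<in> bar_chains n (sections (\<lambda>l. if l \<in> principal e then W else {0}))"
  shows "contraction e l f \<in> sections (\<lambda>l. if l \<in> principal e then W else {0})"
  using assms(3-)
proof (induction l arbitrary: f n)
  case (Cons m l)
  let ?S = "sections (\<lambda>l. if l \<in> principal e then W else {0})"
  have S: "subgrp ?S" using W by (auto simp: sections_def subgrp_def)
  show ?case
  proof (cases l)
    case Nil
    then have "f [] m \<in> W" "m \<notin> principal e \<Longrightarrow> f [] m = 0"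
      using Cons.prems subgrp_0[OF W] by (auto simp: bar_chains_def sections_def split: if_splits)
    then show ?thesis using Nil e W by (auto simp: single_def sections_def subgrp_0)
  next
    case (Cons m' l')
    then obtain n' where n: "n = Suc n'" using Cons.prems by auto
    have "contraction e l (\<lambda>l'. f (m # l')) \<in> ?S"
      by (rule Cons.IH[of n']) (use Cons.prems n in \<open>auto simp: bar_chains_def\<close>)
    moreover have "contraction e (m # l) f = - contraction e l (\<lambda>l'. f (m # l'))"
      using Cons by (simp only: contraction_Cons list.distinct if_False diff_0)
    ultimately show ?thesis using subgrp_minus[OF S] by (simp only:)
  qed
qed simp

lemma stable_const:
  assumes "subgrp W" "D \<subseteq> carrier M" "\<And>x y. x \<in> carrier M \<Longrightarrow> y \<in> D \<Longrightarrow> x \<otimes> y \<in> D"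
  shows "stable_family (\<lambda>l. if l \<in> D then W else {0})"
  using assms by (auto simp: stable_family_def subgrp_0)

lemma principal_closed: "e \<in> carrier M \<Longrightarrow> x \<in> carrier M \<Longrightarrow> y \<in> principal e \<Longrightarrow> x \<otimes> y \<in> principal e"
  by (auto simp: principal_def m_assoc)

text \<open>
  On the coinvariants the homotopy is \<open>- h\<close>: the terms with \<open>drop_first\<close> cancel because \<open>h\<close> commutes up to
  sign with dropping the first of at least two factors. This leaves degree zero out.
\<close>

lemma homology_killed_principal:
  assumes W: "subgrp W" "subgrp W'" and e: "e \<in> principal e"
  shows "homology_killed translate n 1 (sections (\<lambda>l. if l \<in> principal e then W else {0}))
     (sections (\<lambda>l. if l \<in> principal e then W' else {0}))"
proof (rule homology_killedI)
  let ?V = "sections (\<lambda>l. if l \<in> principal e then W else {0})"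
  let ?V' = "sections (\<lambda>l. if l \<in> principal e then W' else {0})"
  have eM: "e \<in> carrier M" using e by (simp add: principal_def)
  have sub: "msubmodule translate ?V'" "msubmodule translate ?V"
    using W by (auto intro!: msubmodule_sections stable_const principal_closed eM) (auto simp: principal_def)
  fix z assume z: "z \<in> bar_chains (Suc n) ?V" "coinv_d translate z \<in> bar_chains n ?V'"
  have z0: "z l m = 0" if "l \<in> cells (Suc n)" "m \<notin> principal e" for l m
  proof -
    have "z l \<in> ?V" using z(1) that by (auto simp: bar_chains_def)
    then have "z l m \<in> (if m \<in> principal e then W else {0})" unfolding sections_def by blast
    then show ?thesis using that by simp
  qed
  let ?y = "\<lambda>l. - contraction e l z"
  have "z l - coinv_d translate ?y l = - contraction e l (coinv_d translate z)" if l: "l \<in> cells (Suc n)" for l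
  proof -
    from l have l': "set l \<subseteq> carrier M" "l \<noteq> []" by auto
    have y: "?y = 0 - (\<lambda>l. contraction e l z)"
      by (rule ext) simp
    have "coinv_d translate ?y l = - coinv_d translate (\<lambda>l. contraction e l z) l"
      unfolding y coinv_d_diff[OF action_translate] additive_on_0[OF coinv_d_additive[OF action_translate]]
      by (simp only: fun_diff_def[of _ "coinv_d _ _"] zero_fun_apply diff_0)
    then have "coinv_d translate ?y l = bar_d translate l (\<lambda>l. contraction e l z) - drop_first (\<lambda>l. contraction e l z) l"
      by (simp only: coinv_d_def minus_diff_eq)
    moreover have "bar_d translate l (\<lambda>l. contraction e l z) = z l - contraction e l (\<lambda>l. bar_d translate l z)"
      unfolding eq_diff_eq
      by (rule contraction_homotopy) (use eM l z0 in auto)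
    moreover have "drop_first (\<lambda>l. contraction e l z) l = - contraction e l (drop_first z)"
      using l'(2) by (simp add: drop_first_def[abs_def] contraction_sum sum_negf)
    moreover have "contraction e l (coinv_d translate z) = contraction e l (drop_first z) - contraction e l (\<lambda>l. bar_d translate l z)"
      unfolding coinv_d_def[abs_def] by (rule contraction_diff)
    ultimately show ?thesis by simp
  qed
  moreover have "contraction e l (coinv_d translate z) \<in> ?V'" if "l \<in> cells (Suc n)" for l
    by (rule contraction_sections[OF W(2) e]) (use that z in auto)
  ultimately have "nmul 1 z - coinv_d translate ?y \<in> bar_chains (Suc n) ?V'"
    using subgrp_minus[OF msubmodule_subgrp(2)[OF sub(1)]] by (auto simp: bar_chains_def)
  moreover have "?y \<in> bar_chains (Suc (Suc n)) ?V"
    using contraction_sections[OF W(1) e _ _ z(1)] subgrp_minus[OF msubmodule_subgrp(2)[OF sub(2)]]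
    by (auto simp: bar_chains_def[of "Suc (Suc n)"])
  ultimately show "\<exists>y\<in>bar_chains (Suc (Suc n)) ?V. nmul 1 z - coinv_d translate y \<in> bar_chains (Suc n) ?V'"
    by blast
qed


definition const_on :: "'a set \<Rightarrow> 'v::ab_group_add set \<Rightarrow> 'a \<Rightarrow> 'v set" where
  "const_on D W = (\<lambda>l. if l \<in> D then W else {0})"

definition left_ideal :: "'a set \<Rightarrow> bool" where
  "left_ideal D \<longleftrightarrow> D \<subseteq> carrier M \<and> (\<forall>x\<in>carrier M. \<forall>y\<in>D. x \<otimes> y \<in> D)"

lemma stable_two_step:
  assumes "subgrp W" "subgrp W'" "W' \<subseteq> W" "left_ideal D" "left_ideal D'"
  shows "stable_family (\<lambda>l. if l \<in> D' then W else if l \<in> D then W' else {0})"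
  using assms by (auto simp: stable_family_def left_ideal_def subgrp_0)

lemma stable_const_on: "subgrp W \<Longrightarrow> left_ideal D \<Longrightarrow> stable_family (const_on D W)"
  unfolding const_on_def by (rule stable_const) (auto simp: left_ideal_def)

lemma sections_mono: "(\<And>l. A l \<subseteq> B l) \<Longrightarrow> sections A \<subseteq> sections B"
  unfolding sections_def by blast

text \<open>
  Let \<open>x \<in> D\<close> generate a maximal principal left ideal and let \<open>D'\<close> be \<open>D\<close> without the generators of
  \<open>Mx\<close>, which is again a left ideal. By regularity \<open>Mx = Me\<close> with \<open>e\<close> idempotent. The quotient of \<open>\<int>D\<close> by
  \<open>\<int>D'\<close> is also that of \<open>\<int>Me\<close> by \<open>\<int>(Me \<inter> D')\<close>, and both \<open>D'\<close> and \<open>Me \<inter> D'\<close> are smaller than \<open>D\<close>.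
\<close>

theorem homology_killed_left_ideal:
  assumes reg: "regular_monoid M" and W: "subgrp W" "subgrp W'" "W' \<subseteq> W"
    and "left_ideal D" "n \<ge> card D"
  shows "homology_killed translate n 1 (sections (const_on D W)) (sections (const_on D W'))"
  using assms(5,6)
proof (induction "card D" arbitrary: D n rule: less_induct)
  case less
  have D: "D \<subseteq> carrier M" "\<And>x y. x \<in> carrier M \<Longrightarrow> y \<in> D \<Longrightarrow> x \<otimes> y \<in> D"
    using less.prems by (auto simp: left_ideal_def)
  have finD: "finite D" using D finite_carrier finite_subset by blast
  note W0 = subgrp_0[OF W(1)] subgrp_0[OF W(2)]
  show ?case
  proof (cases "D = {}")
    case True
    then show ?thesis
      by (auto intro!: homology_killed_refl action_translate msubmodule_sections stable_const_on
        simp: const_on_def left_ideal_def stable_family_def)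
  next
    case False
    define P where "P y = (\<lambda>m. m \<otimes> y) ` carrier M" for y
    have finP: "finite (P y)" for y using finite_carrier by (simp add: P_def)
    have P_mono: "P x \<subseteq> P y" if "x \<in> P y" "y \<in> carrier M" for x y
      using that by (auto simp: P_def m_assoc[symmetric])
    have P_self: "y \<in> P y" if "y \<in> carrier M" for y
      unfolding P_def using that by (intro image_eqI[of _ _ \<one>]) auto
    have "Max ((\<lambda>y. card (P y)) ` D) \<in> (\<lambda>y. card (P y)) ` D"
      by (rule Max_in) (use False finD in auto)
    then obtain x where x': "x \<in> D" "card (P x) = Max ((\<lambda>y. card (P y)) ` D)" by auto
    then have x: "x \<in> D" "\<And>y. y \<in> D \<Longrightarrow> card (P y) \<le> card (P x)"
      using finD by auto
    have xM: "x \<in> carrier M" using x D by auto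
    obtain t where t: "t \<in> carrier M" "x \<otimes> t \<otimes> x = x"
      using reg xM by (auto simp: regular_monoid_def)
    define e where "e = t \<otimes> x"
    have eM: "e \<in> carrier M" using t xM by (simp add: e_def)
    have xe: "x \<otimes> e = x" using t xM by (simp add: e_def m_assoc)
    then have "e \<otimes> e = e" unfolding e_def using t xM by (simp add: m_assoc)
    then have e: "e \<in> principal e" using eM by (simp add: principal_def)
    have principal: "principal e = P x"
    proof
      show "principal e \<subseteq> P x"
      proof
        fix y assume "y \<in> principal e"
        then have "y = (y \<otimes> t) \<otimes> x" "y \<in> carrier M" using t xM by (auto simp: principal_def e_def m_assoc)
        then show "y \<in> P x" using t unfolding P_def by blast
      qed
      show "P x \<subseteq> principal e"
        using xe xM eM by (auto simp: principal_def P_def m_assoc)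
    qed
    have lidD: "principal e \<subseteq> D" unfolding principal P_def using D x by auto
    have left_principal: "left_ideal (principal e)"
      using principal_closed[OF eM] by (auto simp: left_ideal_def) (auto simp: principal_def)
    define D' where "D' = {y\<in>D. x \<notin> P y}"
    have left_D': "left_ideal D'"
      unfolding left_ideal_def D'_def
    proof (intro conjI ballI)
      fix m y assume *: "m \<in> carrier M" "y \<in> {y \<in> D. x \<notin> P y}"
      then have "m \<otimes> y \<in> P y" by (auto simp: P_def)
      then have "P (m \<otimes> y) \<subseteq> P y" using P_mono * D by blast
      then show "m \<otimes> y \<in> {y \<in> D. x \<notin> P y}" using * D by blast
    qed (use D in auto)
    have top: "y \<in> principal e" if "y \<in> D" "y \<notin> D'" for y
    proof -
      have "x \<in> P y" "y \<in> carrier M" using that D by (auto simp: D'_def)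
      then have "P x = P y" using P_mono x(2)[OF that(1)] finP by (meson card_seteq)
      then show ?thesis using P_self \<open>y \<in> carrier M\<close> principal by blast
    qed
    \<comment> \<open>Any element of \<open>D\<close> outside \<open>D'\<close> generates \<open>Mx\<close>, so \<open>D - D'\<close> equals \<open>Me - D''\<close>.\<close>
    define D'' where "D'' = principal e \<inter> D'"
    have left_D'': "left_ideal D''"
      using left_D' left_principal by (auto simp: D''_def left_ideal_def)
    have "D' \<subset> D" using x(1) P_self[OF xM] by (auto simp: D'_def)
    then have cD': "card D' < card D" by (rule psubset_card_mono[OF finD])
    have "card D'' \<le> card D'"
      by (rule card_mono) (use finD in \<open>auto simp: D''_def D'_def\<close>)
    then have cD'': "card D'' < card D" using cD' by simp
    define m where "m = n - 1"
    have n: "n = Suc m" "m \<ge> card D''" "n \<ge> card D'"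
      unfolding m_def using less.prems(2) cD' cD'' by linarith+
    \<comment> \<open>\<open>Y\<close> lies between the two modules of the claim, and \<open>Y'\<close> is its counterpart in \<open>Me\<close>.\<close>
    define Y where "Y = (\<lambda>l. if l \<in> D' then W else if l \<in> D then W' else {0})"
    define Y' where "Y' = (\<lambda>l. if l \<in> D'' then W else if l \<in> principal e then W' else {0})"
    have st: "stable_family Y" "stable_family Y'"
      unfolding Y_def Y'_def
      by (rule stable_two_step[OF W], (fact left_principal left_D' left_D'' less.prems)+)+
    note stc = stable_const_on[OF W(1)] stable_const_on[OF W(2)]
    have D'D: "D' \<subseteq> D" by (auto simp: D'_def)
    have 1: "homology_killed translate n 1 (sections Y) (sections (const_on D W'))"
    proof (rule homology_killed_excision[OF stc(1)[OF left_D'] st(1) stc(2)[OF less.prems(1)]])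
      show "homology_killed translate n 1 (sections (const_on D' W)) (sections (const_on D' W'))"
        by (rule less.hyps[OF cD' left_D']) (use n in auto)
      show "\<exists>u\<in>const_on D' W l. v - u \<in> const_on D W' l" if "v \<in> Y l" for l v
        using that W0 by (cases "l \<in> D'") (auto simp: Y_def const_on_def intro: bexI[of _ v])
    qed (use D'D W W0 in \<open>auto simp: Y_def const_on_def split: if_splits\<close>)
    have "homology_killed translate m 1 (sections Y') (sections (const_on (principal e) W'))"
    proof (rule homology_killed_excision[OF stc(1)[OF left_D''] st(2) stc(2)[OF left_principal]])
      show "homology_killed translate m 1 (sections (const_on D'' W)) (sections (const_on D'' W'))"
        by (rule less.hyps[OF cD'' left_D'']) (use n in auto)
      show "\<exists>u\<in>const_on D'' W l. v - u \<in> const_on (principal e) W' l" if "v \<in> Y' l" for l v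
        using that W0 by (cases "l \<in> D''") (auto simp: Y'_def const_on_def D''_def intro: bexI[of _ v])
    qed (use W W0 in \<open>auto simp: Y'_def const_on_def D''_def split: if_splits\<close>)
    moreover have "homology_killed translate (Suc m) 1 (sections (const_on (principal e) W)) (sections (const_on (principal e) W'))"
      unfolding const_on_def by (rule homology_killed_principal[OF W(1,2) e])
    ultimately have "homology_killed translate (Suc m) (1 * 1) (sections (const_on (principal e) W)) (sections Y')"
      by (intro homology_killed_quotient[where Z = "sections (const_on (principal e) W')"]
          action_translate msubmodule_sections stc st left_principal sections_mono)
        (use W W0 in \<open>auto simp: Y'_def const_on_def D''_def\<close>)
    then have lidY: "homology_killed translate n 1 (sections (const_on (principal e) W)) (sections Y')"
      using n by simp
    have 2: "homology_killed translate n 1 (sections (const_on D W)) (sections Y)"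
    proof (rule homology_killed_excision[OF stc(1)[OF left_principal] stc(1)[OF less.prems(1)] st(1) _ _ _ _ lidY])
      show "\<exists>u\<in>const_on (principal e) W l. v - u \<in> Y l" if "v \<in> const_on D W l" for l v
        using that W0 top[of l] by (cases "l \<in> principal e") (auto simp: Y_def const_on_def intro: bexI[of _ v])
    qed (use W W0 lidD D'D in
        \<open>auto simp: Y_def Y'_def const_on_def D''_def split: if_splits\<close>)
    have "homology_killed translate n (1 * 1) (sections (const_on D W)) (sections (const_on D W'))"
      by (rule homology_killed_extension[OF action_translate _ _ _ _ _ 1 2];
          (intro msubmodule_sections stc st left_D' less.prems sections_mono)?)
        (use W W0 D'D in \<open>auto simp: Y_def const_on_def\<close>)
    then show ?thesis by simp
  qed
qed

end

context finite_monoid begin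

section \<open>Idempotents above an ideal\<close>

definition two_sided_ideal :: "'a set \<Rightarrow> bool" where
  "two_sided_ideal I \<longleftrightarrow> I \<subseteq> carrier M \<and> (\<forall>x\<in>carrier M. \<forall>y\<in>I. x \<otimes> y \<in> I \<and> y \<otimes> x \<in> I)"

text \<open>
  Multiplication by \<open>v\<close> is injective on the finite monoid \<open>eMe\<close>, hence surjective.
\<close>

lemma finite_corner_inverse:
  assumes e: "e \<in> carrier M" "e \<otimes> e = e"
    and u: "u \<in> carrier M" "e \<otimes> u = u" "u \<otimes> e = u"
    and v: "v \<in> carrier M" "e \<otimes> v = v" "v \<otimes> e = v" and uv: "u \<otimes> v = e"
  shows "v \<otimes> u = e"
proof -
  define T where "T = {z\<in>carrier M. e \<otimes> z = z \<and> z \<otimes> e = z}"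
  have "inj_on (\<lambda>z. v \<otimes> z) T"
  proof (rule inj_on_inverseI)
    fix z assume "z \<in> T"
    then show "u \<otimes> (v \<otimes> z) = z" using u v uv by (simp add: T_def m_assoc[symmetric])
  qed
  moreover have "(\<lambda>z. v \<otimes> z) ` T \<subseteq> T"
    using v e by (auto simp: T_def m_assoc) (auto simp: m_assoc[symmetric])
  moreover have "finite T" using finite_carrier by (simp add: T_def)
  ultimately have "(\<lambda>z. v \<otimes> z) ` T = T" by (simp add: endo_inj_surj)
  moreover have "e \<in> T" using e by (simp add: T_def)
  ultimately obtain z where z: "z \<in> T" "v \<otimes> z = e" by (metis imageE)
  have "z = u \<otimes> v \<otimes> z" using z u v uv by (simp add: T_def)
  also have "\<dots> = u" using z u v by (simp add: T_def m_assoc)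
  finally show ?thesis using z by simp
qed

text \<open>
  Among the elements \<open>x \<notin> I\<close> take one for which \<open>MxM\<close> has the fewest elements; regularity turns it into
  an idempotent \<open>e\<close>. If \<open>g \<in> eMe - I\<close>, then \<open>MgM \<subseteq> MeM\<close> and minimality gives \<open>e \<in> MgM\<close>, from which one-sided
  and hence two-sided inverses of \<open>g\<close> in \<open>eMe\<close> arise.
\<close>

lemma minimal_idempotent:
  assumes reg: "regular_monoid M" and I: "two_sided_ideal I" "I \<noteq> carrier M"
  obtains e where "e \<in> carrier M" "e \<notin> I" "e \<otimes> e = e"
    "\<And>g. g \<in> carrier M \<Longrightarrow> g \<notin> I \<Longrightarrow> e \<otimes> g = g \<Longrightarrow> g \<otimes> e = g \<Longrightarrow>
       \<exists>h\<in>carrier M. e \<otimes> h = h \<and> h \<otimes> e = h \<and> g \<otimes> h = e \<and> h \<otimes> g = e"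
proof -
  define S where "S y = (\<lambda>(p, q). p \<otimes> y \<otimes> q) ` (carrier M \<times> carrier M)" for y
  have S_iff: "z \<in> S y \<longleftrightarrow> (\<exists>p\<in>carrier M. \<exists>q\<in>carrier M. z = p \<otimes> y \<otimes> q)" for z y
    by (auto simp: S_def)
  have finS: "finite (S y)" for y using finite_carrier by (simp add: S_def)
  have S_mono: "S z \<subseteq> S y" if zy: "z \<in> S y" "y \<in> carrier M" for y z
  proof
    fix w assume "w \<in> S z"
    then obtain p q where p: "p \<in> carrier M" "q \<in> carrier M" "w = p \<otimes> z \<otimes> q" by (auto simp: S_iff)
    moreover obtain r s where "r \<in> carrier M" "s \<in> carrier M" "z = r \<otimes> y \<otimes> s"
      using zy by (auto simp: S_iff)
    ultimately have *: "p \<in> carrier M" "q \<in> carrier M" "r \<in> carrier M" "s \<in> carrier M"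
      "w = p \<otimes> (r \<otimes> y \<otimes> s) \<otimes> q" by auto
    then have "w = (p \<otimes> r) \<otimes> y \<otimes> (s \<otimes> q)" using zy by (simp add: m_assoc)
    then show "w \<in> S y" using * by (auto simp: S_iff)
  qed
  have ne: "carrier M - I \<noteq> {}" using I by (auto simp: two_sided_ideal_def)
  have "Min ((\<lambda>y. card (S y)) ` (carrier M - I)) \<in> (\<lambda>y. card (S y)) ` (carrier M - I)"
    by (rule Min_in) (use ne finite_carrier in auto)
  then obtain x where x': "x \<in> carrier M - I" "card (S x) = Min ((\<lambda>y. card (S y)) ` (carrier M - I))"
    by auto
  then have x: "x \<in> carrier M" "x \<notin> I" "\<And>y. y \<in> carrier M \<Longrightarrow> y \<notin> I \<Longrightarrow> card (S x) \<le> card (S y)"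
    using finite_carrier by auto
  obtain t where t: "t \<in> carrier M" "x \<otimes> t \<otimes> x = x"
    using reg x by (auto simp: regular_monoid_def)
  define e where "e = x \<otimes> t"
  have e: "e \<in> carrier M" "e \<otimes> x = x" using x t by (auto simp: e_def)
  have ee: "e \<otimes> e = e" using e x t by (simp add: e_def m_assoc[symmetric])
  have eI: "e \<notin> I" using I(1) e x by (metis two_sided_ideal_def)
  have eS: "e \<in> S x" unfolding S_iff using x t by (intro bexI[of _ \<one>] bexI[of _ t]) (auto simp: e_def)
  have "\<exists>h\<in>carrier M. e \<otimes> h = h \<and> h \<otimes> e = h \<and> g \<otimes> h = e \<and> h \<otimes> g = e"
    if g: "g \<in> carrier M" "g \<notin> I" "e \<otimes> g = g" "g \<otimes> e = g" for g
  proof -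
    have "g \<in> S e" unfolding S_iff using g e by (intro bexI[of _ \<one>] bexI[of _ g]) auto
    then have "S g \<subseteq> S x" using S_mono[OF eS] S_mono[of g e] e x by blast
    then have "S g = S x" using x(3)[OF g(1,2)] finS by (simp add: card_seteq)
    with eS have "e \<in> S g" by simp
    then obtain p q where pq: "p \<in> carrier M" "q \<in> carrier M" "e = p \<otimes> g \<otimes> q"
      unfolding S_iff by blast
    define a where "a = e \<otimes> p \<otimes> e"
    define b where "b = e \<otimes> q \<otimes> e"
    have a: "a \<in> carrier M" "e \<otimes> a = a" "a \<otimes> e = a"
      using pq e ee unfolding a_def by (auto simp: m_assoc) (auto simp: m_assoc[symmetric])
    have b: "b \<in> carrier M" "e \<otimes> b = b" "b \<otimes> e = b"
      using pq e ee unfolding b_def by (auto simp: m_assoc) (auto simp: m_assoc[symmetric])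
    have "a \<otimes> g \<otimes> b = e \<otimes> p \<otimes> (e \<otimes> g) \<otimes> (e \<otimes> q \<otimes> e)"
      using pq(1,2) g(1) e by (simp add: a_def b_def m_assoc)
    also have "\<dots> = e \<otimes> p \<otimes> g \<otimes> (e \<otimes> q \<otimes> e)" by (simp only: g(3))
    also have "\<dots> = e \<otimes> p \<otimes> (g \<otimes> e) \<otimes> (q \<otimes> e)" using pq(1,2) g(1) e by (simp add: m_assoc)
    also have "\<dots> = e \<otimes> p \<otimes> g \<otimes> (q \<otimes> e)" by (simp only: g(4))
    also have "\<dots> = e \<otimes> (p \<otimes> g \<otimes> q) \<otimes> e" using pq(1,2) g(1) e by (simp add: m_assoc)
    finally have agb: "a \<otimes> g \<otimes> b = e" using pq(3) ee by simp
    have "(g \<otimes> b) \<otimes> a = e"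
      by (rule finite_corner_inverse[OF e(1) ee a])
        (use g b a e agb in \<open>auto simp: m_assoc[symmetric]\<close>, auto simp: m_assoc)
    moreover have "b \<otimes> (a \<otimes> g) = e"
      by (rule finite_corner_inverse[OF e(1) ee _ _ _ b])
        (use g b a e agb in \<open>auto simp: m_assoc[symmetric]\<close>, auto simp: m_assoc)
    ultimately show ?thesis using a b g e
      by (intro bexI[of _ "b \<otimes> a"]) (auto simp: m_assoc, auto simp: m_assoc[symmetric])
  qed
  then show ?thesis using that e(1) eI ee by blast
qed

end

section \<open>One layer of the filtration by ideals\<close>

locale ideal_layer = finite_monoid M for M (structure) +
  fixes I :: "'a set" and e :: 'a
    and act :: "'a \<Rightarrow> 'v::ab_group_add \<Rightarrow> 'v" and V W :: "'v set"
  assumes regular: "regular_monoid M"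
    and I: "two_sided_ideal I"
    and e: "e \<in> carrier M" "e \<notin> I" "e \<otimes> e = e"
    and units: "\<And>g. g \<in> carrier M \<Longrightarrow> g \<notin> I \<Longrightarrow> e \<otimes> g = g \<Longrightarrow> g \<otimes> e = g \<Longrightarrow>
       \<exists>h\<in>carrier M. e \<otimes> h = h \<and> h \<otimes> e = h \<and> g \<otimes> h = e \<and> h \<otimes> g = e"
    and act: "action act" and V: "msubmodule act V" and W: "msubmodule act W" and WV: "W \<subseteq> V"
    and kill: "\<And>x v. x \<in> I \<Longrightarrow> v \<in> V \<Longrightarrow> act x v \<in> W"
begin

text \<open>
  \<open>ind_V / ind_W\<close> is \<open>(\<int>Me / \<int>(Me \<inter> I)) \<otimes> eV / eW\<close>. The set \<open>Me - I\<close> is a free right \<open>G\<close>-set, so the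
  elements of the kernel of \<open>ind_V \<rightarrow> (\<int>Me / \<int>(Me \<inter> I)) \<otimes>\<^sub>G (eV / eW)\<close> are those whose sums \<open>norm_map f l\<close> over the
  orbits vanish modulo \<open>W\<close>. These sums replace the choice of orbit representatives in the definition of
  \<open>ker_norm\<close>, so that \<open>ind_V / ker_norm\<close> is the tensor product over \<open>G\<close>. The submodule \<open>ker_mu\<close> is the kernel of the
  multiplication map from \<open>ind_V\<close> to \<open>V / W\<close>, and \<open>im_mu\<close> its image together with \<open>W\<close>.
\<close>

definition G where "G = {g\<in>carrier M. g \<notin> I \<and> e \<otimes> g = g \<and> g \<otimes> e = g}"
definition eV where "eV = {v\<in>V. act e v = v}"
definition eW where "eW = {v\<in>W. act e v = v}"
definition ind_V where "ind_V = sections (const_on (principal e) eV)"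
definition ind_W where "ind_W = sections (\<lambda>l. if l \<in> principal e \<inter> I then eV else if l \<in> principal e then eW else {0})"
definition mu where "mu f = (\<Sum>l\<in>carrier M. act l (f l))"
definition norm_map where "norm_map f l = (if l \<in> principal e then \<Sum>g\<in>G. act g (f (l \<otimes> g)) else 0)"
definition ker_mu where "ker_mu = {f\<in>ind_V. mu f \<in> W}"
definition ker_norm where "ker_norm = {f\<in>ind_V. mu f \<in> W \<and> (\<forall>l\<in>principal e - I. norm_map f l \<in> W)}"
definition im_mu where "im_mu = {w + mu f | w f. w \<in> W \<and> f \<in> ind_V}"
definition I' where "I' = I \<union> {p \<otimes> e \<otimes> q | p q. p \<in> carrier M \<and> q \<in> carrier M}"

lemma I_mult: "y \<in> I \<Longrightarrow> y \<in> carrier M" "x \<in> carrier M \<Longrightarrow> y \<in> I \<Longrightarrow> x \<otimes> y \<in> I"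
    "x \<in> carrier M \<Longrightarrow> y \<in> I \<Longrightarrow> y \<otimes> x \<in> I"
  using I by (auto simp: two_sided_ideal_def)

lemma G_closed: "g \<in> G \<Longrightarrow> g \<in> carrier M" and G_e: "g \<in> G \<Longrightarrow> e \<otimes> g = g" "g \<in> G \<Longrightarrow> g \<otimes> e = g"
  by (auto simp: G_def)

lemma G_inverse: 
  assumes "g \<in> G" obtains h where "h \<in> G" "g \<otimes> h = e" "h \<otimes> g = e"
proof -
  obtain h where h: "h \<in> carrier M" "e \<otimes> h = h" "h \<otimes> e = h" "g \<otimes> h = e" "h \<otimes> g = e"
    using units[of g] assms by (auto simp: G_def)
  moreover have "h \<notin> I" using I_mult(2)[of g h] h e G_closed[OF assms] by auto
  ultimately show ?thesis using that by (auto simp: G_def)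
qed

lemma G_mult: 
  assumes "g \<in> G" "h \<in> G" shows "g \<otimes> h \<in> G"
proof -
  obtain g' where g': "g' \<in> G" "g' \<otimes> g = e" using G_inverse[OF assms(1)] by blast
  note c = G_closed[OF assms(1)] G_closed[OF assms(2)] G_closed[OF g'(1)]
  have "g' \<otimes> (g \<otimes> h) = h"
    using c g' G_e[OF assms(2)] by (simp add: m_assoc[symmetric])
  then have "g \<otimes> h \<notin> I" using I_mult(2)[of g' "g \<otimes> h"] c assms(2) by (auto simp: G_def)
  moreover have "e \<otimes> (g \<otimes> h) = g \<otimes> h" using c G_e[OF assms(1)] e by (simp add: m_assoc[symmetric])
  moreover have "(g \<otimes> h) \<otimes> e = g \<otimes> h" using c G_e[OF assms(2)] e by (simp add: m_assoc)
  ultimately show ?thesis using c by (simp add: G_def)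
qed

lemma e_G: "e \<in> G" using e by (simp add: G_def)

lemma finite_G: "finite G" using finite_carrier by (simp add: G_def)

lemma principal_e: "e \<in> principal e" using e by (simp add: principal_def)

lemma principal_mult_G: "l \<in> principal e \<Longrightarrow> g \<in> G \<Longrightarrow> l \<otimes> g \<in> principal e"
  by (auto simp: principal_def G_def m_assoc e)

lemma principal_M: "l \<in> principal e \<Longrightarrow> l \<in> carrier M" "l \<in> principal e \<Longrightarrow> l \<otimes> e = l" by (auto simp: principal_def)

lemma principal_G_cancel:
  assumes "l \<in> principal e" "g \<in> G" "h \<in> G" "g \<otimes> h = e"
  shows "l \<otimes> g \<otimes> h = l"
  using assms principal_M by (simp add: m_assoc G_closed)

lemma principal_G_notin_I:
  assumes "l \<in> principal e" "g \<in> G" "l \<notin> I" shows "l \<otimes> g \<notin> I"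
proof
  assume *: "l \<otimes> g \<in> I"
  obtain h where h: "h \<in> G" "g \<otimes> h = e" using G_inverse[OF assms(2)] by blast
  then have "l \<otimes> g \<otimes> h \<in> I" using * I_mult(3) G_closed by blast
  then show False using principal_G_cancel[OF assms(1,2) h] assms(3) by simp
qed

lemma left_principal: "left_ideal (principal e)" "left_ideal (principal e \<inter> I)"
  using principal_closed[OF e(1)] I_mult by (auto simp: left_ideal_def principal_M)

lemma subgrp_V: "subgrp V" "subgrp W" "subgrp eV" "subgrp eW" "eW \<subseteq> eV"
  using V W WV e by (auto simp: msubmodule_def subgrp_def eV_def eW_def action_diff[OF act] action_0[OF act])

lemma act_V: "x \<in> carrier M \<Longrightarrow> v \<in> V \<Longrightarrow> act x v \<in> V" "x \<in> carrier M \<Longrightarrow> v \<in> W \<Longrightarrow> act x v \<in> W"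
  using V W by (auto simp: msubmodule_def)

lemma stable_ind: "stable_family (const_on (principal e) eV)"
  "stable_family (\<lambda>l. if l \<in> principal e \<inter> I then eV else if l \<in> principal e then eW else {0})"
  by (intro stable_const_on stable_two_step subgrp_V left_principal)+

lemma sub_ind_V: "msubmodule translate ind_V" and sub_ind_W: "msubmodule translate ind_W"
  unfolding ind_V_def ind_W_def by (intro msubmodule_sections stable_ind)+

lemma subgrp_ind_V: "subgrp ind_V" using sub_ind_V by (simp add: msubmodule_def)

lemma ind_V_D: "f \<in> ind_V \<Longrightarrow> l \<notin> principal e \<Longrightarrow> f l = 0" "f \<in> ind_V \<Longrightarrow> l \<in> principal e \<Longrightarrow> f l \<in> eV" "f \<in> ind_V \<Longrightarrow> f l \<in> V"
proof -
  assume "f \<in> ind_V"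
  then have *: "f l \<in> const_on (principal e) eV l" for l by (auto simp: ind_V_def sections_def)
  show "f l = 0" if "l \<notin> principal e" using *[of l] that by (simp add: const_on_def)
  show "f l \<in> eV" if "l \<in> principal e" using *[of l] that by (simp add: const_on_def)
  show "f l \<in> V" using *[of l] subgrp_0[OF subgrp_V(1)] by (auto simp: const_on_def eV_def split: if_splits)
qed

lemma ind_V_I: "(\<And>l. l \<notin> principal e \<Longrightarrow> f l = 0) \<Longrightarrow> (\<And>l. l \<in> principal e \<Longrightarrow> f l \<in> eV) \<Longrightarrow> f \<in> ind_V"
  by (simp add: ind_V_def sections_def const_on_def)

text \<open>
  The module is presented by the left ideals \<open>Me\<close> and \<open>Me \<inter> I\<close>, whose homology vanishes in high degrees.
\<close>

lemma homology_killed_ind_V_ind_W: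
  assumes "n \<ge> Suc (card (carrier M))"
  shows "homology_killed translate n 1 ind_V ind_W"
proof -
  let ?Z = "sections (const_on (principal e) eW)"
  obtain m where n: "n = Suc m" using assms by (cases n) auto
  have "principal e \<subseteq> carrier M" "principal e \<inter> I \<subseteq> carrier M" using principal_M(1) by blast+
  then have "card (principal e) \<le> card (carrier M)" "card (principal e \<inter> I) \<le> card (carrier M)"
    using finite_carrier by (simp_all add: card_mono)
  then have c: "card (principal e) \<le> n" "card (principal e \<inter> I) \<le> m" using assms n by simp_all
  note st = stable_const_on[OF subgrp_V(3) left_principal(2)] stable_ind(2)
    stable_const_on[OF subgrp_V(4) left_principal(1)]
  note z = subgrp_0[OF subgrp_V(3)] subgrp_0[OF subgrp_V(4)]
  have "homology_killed translate n 1 ind_V ?Z"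
    unfolding ind_V_def by (rule homology_killed_left_ideal[OF regular subgrp_V(3,4,5) left_principal(1) c(1)])
  moreover have "homology_killed translate m 1 ind_W ?Z"
    unfolding ind_W_def
  proof (rule homology_killed_excision[OF st])
    show "homology_killed translate m 1 (sections (const_on (principal e \<inter> I) eV)) (sections (const_on (principal e \<inter> I) eW))"
      by (rule homology_killed_left_ideal[OF regular subgrp_V(3,4,5) left_principal(2) c(2)])
    show "\<exists>u\<in>const_on (principal e \<inter> I) eV l. v - u \<in> const_on (principal e) eW l"
      if "v \<in> (if l \<in> principal e \<inter> I then eV else if l \<in> principal e then eW else {0})" for l v
      using that z by (cases "l \<in> principal e \<inter> I") (auto simp: const_on_def intro: bexI[of _ v])
  qed (use subgrp_V(5) z in \<open>auto simp: const_on_def split: if_splits\<close>)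
  moreover have "?Z \<subseteq> ind_W"
    unfolding ind_W_def by (rule sections_mono) (use subgrp_V(5) z in \<open>simp add: const_on_def\<close>)
  moreover have "ind_W \<subseteq> ind_V"
    unfolding ind_V_def ind_W_def by (rule sections_mono) (use subgrp_V(5) z in \<open>simp add: const_on_def\<close>)
  ultimately have "homology_killed translate (Suc m) (1 * 1) ind_V ind_W"
    unfolding n by (intro homology_killed_quotient[OF action_translate sub_ind_V sub_ind_W msubmodule_sections[OF st(3)]])
  then show ?thesis using n by simp
qed

lemma mu_additive: "additive_on ind_V mu"
  unfolding additive_on_def mu_def
  by (simp add: subgrp_ind_V action_diff[OF act] sum_subtractf)

lemma mu_equivariant: "x \<in> carrier M \<Longrightarrow> mu (translate x f) = act x (mu f)"
proof -
  assume x: "x \<in> carrier M"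
  have "mu (translate x f) = (\<Sum>l\<in>carrier M. \<Sum>l'\<in>{l'\<in>carrier M. x \<otimes> l' = l}. act l (f l'))"
    by (simp add: mu_def translate_def action_sum act)
  also have "\<dots> = act x (mu f)"
    by (simp add: sum_fibres x mu_def action_sum act action_mult)
  finally show ?thesis .
qed

lemma mu_V: "f \<in> ind_V \<Longrightarrow> mu f \<in> V"
  unfolding mu_def by (intro subgrp_sum subgrp_V act_V ind_V_D)

lemma norm_map_ind_V: "f \<in> ind_V \<Longrightarrow> norm_map f \<in> ind_V"
proof (rule ind_V_I)
  fix l assume f: "f \<in> ind_V" and l: "l \<in> principal e"
  have "act e (act g (f (l \<otimes> g))) = act g (f (l \<otimes> g))" if "g \<in> G" for g
    using action_mult[OF act e(1) G_closed[OF that]] G_e(1)[OF that] by metis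
  then have "act g (f (l \<otimes> g)) \<in> eV" if "g \<in> G" for g
    using that act_V(1)[OF G_closed[OF that] ind_V_D(3)[OF f]] by (simp add: eV_def)
  then show "norm_map f l \<in> eV" unfolding norm_map_def using l by (auto intro!: subgrp_sum subgrp_V)
qed (simp add: norm_map_def)

lemma norm_map_additive: "additive_on ind_V norm_map"
  unfolding additive_on_def
  by (auto simp: subgrp_ind_V norm_map_def fun_eq_iff action_diff[OF act] G_closed sum_subtractf)

lemma translate_eq_principal:
  assumes "f \<in> ind_V"
  shows "translate x f l = (\<Sum>l'\<in>{l'\<in>principal e. x \<otimes> l' = l}. f l')"
  unfolding translate_def
  by (rule sum.mono_neutral_right) (use finite_carrier assms ind_V_D in \<open>auto simp: principal_M\<close>)

text \<open>
  Right multiplication by \<open>g \<in> G\<close> is a bijection of \<open>Me\<close> that commutes with left multiplication by \<open>x\<close>.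
\<close>

lemma norm_map_equivariant:
  assumes f: "f \<in> ind_V" and x: "x \<in> carrier M"
  shows "norm_map (translate x f) = translate x (norm_map f)"
proof
  fix l
  show "norm_map (translate x f) l = translate x (norm_map f) l"
  proof (cases "l \<in> principal e")
    case False
    then have "{l'\<in>principal e. x \<otimes> l' = l} = {}" using principal_closed[OF e(1) x] by auto
    then have "translate x (norm_map f) l = 0" unfolding translate_eq_principal[OF norm_map_ind_V[OF f]] by (simp only: sum.empty)
    then show ?thesis using False by (simp add: norm_map_def)
  next
    case True
    have "(\<Sum>l'\<in>{l'\<in>principal e. x \<otimes> l' = l \<otimes> g}. f l') = (\<Sum>l'\<in>{l'\<in>principal e. x \<otimes> l' = l}. f (l' \<otimes> g))"
      if g: "g \<in> G" for g
    proof -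
      obtain h where h: "h \<in> G" "g \<otimes> h = e" "h \<otimes> g = e" using G_inverse[OF g] by blast
      show ?thesis
        by (rule sum.reindex_bij_witness[of _ "\<lambda>l'. l' \<otimes> g" "\<lambda>l'. l' \<otimes> h"])
          (use g h x True in \<open>auto simp: principal_G_cancel principal_mult_G m_assoc[symmetric] G_closed principal_M\<close>)
    qed
    then have "norm_map (translate x f) l = (\<Sum>g\<in>G. \<Sum>l'\<in>{l'\<in>principal e. x \<otimes> l' = l}. act g (f (l' \<otimes> g)))"
      using True by (simp add: norm_map_def translate_eq_principal[OF f] action_sum[OF act] G_closed)
    also have "\<dots> = (\<Sum>l'\<in>{l'\<in>principal e. x \<otimes> l' = l}. norm_map f l')"
      by (subst sum.swap) (auto simp: norm_map_def intro!: sum.cong)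
    also have "\<dots> = translate x (norm_map f) l" by (rule translate_eq_principal[OF norm_map_ind_V[OF f], symmetric])
    finally show ?thesis .
  qed
qed

lemma mu_principal:
  assumes f: "f \<in> ind_V" shows "mu f = (\<Sum>l\<in>principal e. act l (f l))"
  unfolding mu_def
proof (rule sum.mono_neutral_right[OF finite_carrier])
  show "\<forall>l\<in>carrier M - principal e. act l (f l) = 0"
    using ind_V_D(1)[OF f] action_0[OF act] by simp
qed (use principal_M(1) in blast)

lemma mu_norm_map: 
  assumes f: "f \<in> ind_V" shows "mu (norm_map f) = nmul (card G) (mu f)"
proof -
  have "mu (norm_map f) = (\<Sum>l\<in>principal e. \<Sum>g\<in>G. act (l \<otimes> g) (f (l \<otimes> g)))"
    by (simp add: mu_principal norm_map_ind_V f norm_map_def action_sum[OF act] principal_M action_mult[OF act] G_closed)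
  also have "\<dots> = (\<Sum>g\<in>G. \<Sum>l\<in>principal e. act (l \<otimes> g) (f (l \<otimes> g)))" by (rule sum.swap)
  also have "\<dots> = (\<Sum>g\<in>G. mu f)"
  proof (rule sum.cong[OF refl])
    fix g assume g: "g \<in> G"
    obtain h where h: "h \<in> G" "g \<otimes> h = e" "h \<otimes> g = e" using G_inverse[OF g] by blast
    show "(\<Sum>l\<in>principal e. act (l \<otimes> g) (f (l \<otimes> g))) = mu f"
      unfolding mu_principal[OF f]
      by (rule sum.reindex_bij_witness[of _ "\<lambda>l. l \<otimes> h" "\<lambda>l. l \<otimes> g"])
        (use g h in \<open>auto simp: principal_G_cancel principal_mult_G\<close>)
  qed
  finally show ?thesis by (simp add: sum_const_nmul finite_G)
qed


lemma norm_map_norm_map: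
  assumes f: "f \<in> ind_V" shows "norm_map (norm_map f) = nmul (card G) (norm_map f)"
proof
  fix l
  show "norm_map (norm_map f) l = nmul (card G) (norm_map f) l"
  proof (cases "l \<in> principal e")
    case True
    have "norm_map (norm_map f) l = (\<Sum>g\<in>G. \<Sum>h\<in>G. act (g \<otimes> h) (f (l \<otimes> (g \<otimes> h))))"
      using True by (simp add: norm_map_def principal_mult_G action_sum[OF act] G_closed action_mult[OF act] principal_M m_assoc)
    also have "\<dots> = (\<Sum>g\<in>G. norm_map f l)"
    proof (rule sum.cong[OF refl])
      fix g assume g: "g \<in> G"
      obtain h where h: "h \<in> G" "g \<otimes> h = e" "h \<otimes> g = e" using G_inverse[OF g] by blast
      have "(\<Sum>k\<in>G. act (g \<otimes> k) (f (l \<otimes> (g \<otimes> k)))) = (\<Sum>k\<in>G. act k (f (l \<otimes> k)))"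
        by (rule sum.reindex_bij_witness[of _ "\<lambda>k. h \<otimes> k" "\<lambda>k. g \<otimes> k"])
          (use g h in \<open>auto simp: G_mult m_assoc[symmetric] G_closed G_e\<close>)
      then show "(\<Sum>k\<in>G. act (g \<otimes> k) (f (l \<otimes> (g \<otimes> k)))) = norm_map f l" using True by (simp add: norm_map_def)
    qed
    finally show ?thesis by (simp add: sum_const_nmul finite_G nmul_fun)
  qed (simp add: norm_map_def nmul_fun, simp add: nmul_def)
qed

lemma act_I_W: "x \<in> I \<Longrightarrow> f \<in> ind_V \<Longrightarrow> act x (f l) \<in> W"
  by (rule kill) (auto intro: ind_V_D)

lemma ind_W_subset_ker_norm: "ind_W \<subseteq> ker_norm"
proof
  fix f assume f: "f \<in> ind_W"
  then have fl: "f l \<in> (if l \<in> principal e \<inter> I then eV else if l \<in> principal e then eW else {0})" for l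
    by (auto simp: ind_W_def sections_def)
  have fA: "f \<in> ind_V"
  proof (rule ind_V_I)
    show "f l = 0" if "l \<notin> principal e" for l using fl[of l] that by simp
    show "f l \<in> eV" if "l \<in> principal e" for l
      using fl[of l] that subgrp_V(5) by (cases "l \<in> I") auto
  qed
  have W: "f l \<in> W" if "l \<notin> I" for l
    using fl[of l] that subgrp_0[OF subgrp_V(2)] by (auto simp: eW_def split: if_splits)
  have "mu f \<in> W"
    unfolding mu_def
  proof (rule subgrp_sum[OF subgrp_V(2)])
    fix l assume "l \<in> carrier M"
    then show "act l (f l) \<in> W" using act_V(2) W act_I_W[OF _ fA] by (cases "l \<in> I") simp_all
  qed
  moreover have "norm_map f l \<in> W" if "l \<in> principal e - I" for l
  proof -
    have "act g (f (l \<otimes> g)) \<in> W" if "g \<in> G" for g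
      using W[OF principal_G_notin_I] \<open>l \<in> principal e - I\<close> act_V(2)[OF G_closed[OF that]] that by simp
    then show ?thesis unfolding norm_map_def using that by (simp add: subgrp_sum[OF subgrp_V(2)])
  qed
  ultimately show "f \<in> ker_norm" using fA by (simp add: ker_norm_def)
qed

lemma ker_norm_subset_ker_mu: "ker_norm \<subseteq> ker_mu" and ker_mu_subset_ind_V: "ker_mu \<subseteq> ind_V"
  by (auto simp: ker_norm_def ker_mu_def)

lemma sub_ker_mu: "msubmodule translate ker_mu"
proof -
  have "subgrp ker_mu"
    using subgrp_ind_V subgrp_V(2) additive_on_0[OF mu_additive] additive_on_diff[OF mu_additive]
    by (simp add: ker_mu_def subgrp_def)
  then show ?thesis
    using sub_ind_V act_V(2) by (simp add: ker_mu_def msubmodule_def mu_equivariant)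
qed

lemma norm_map_translate_W:
  assumes f: "f \<in> ind_V" "\<And>l. l \<in> principal e - I \<Longrightarrow> norm_map f l \<in> W" and x: "x \<in> carrier M" and l: "l \<in> principal e - I"
  shows "norm_map (translate x f) l \<in> W"
  unfolding norm_map_equivariant[OF f(1) x] translate_eq_principal[OF norm_map_ind_V[OF f(1)]]
  by (rule subgrp_sum[OF subgrp_V(2)], rule f(2)) (use l x I_mult(2) in auto)

lemma sub_ker_norm: "msubmodule translate ker_norm"
proof -
  have "translate x f \<in> ker_norm" if "x \<in> carrier M" "f \<in> ker_norm" for x f
    using that sub_ind_V norm_map_translate_W[of f x] act_V(2)[of x "mu f"]
    by (simp add: ker_norm_def msubmodule_def mu_equivariant)
  moreover have "subgrp ker_norm"
    using subgrp_ind_V subgrp_V(2) additive_on_0[OF mu_additive] additive_on_diff[OF mu_additive]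
      additive_on_0[OF norm_map_additive] additive_on_diff[OF norm_map_additive]
    by (simp add: ker_norm_def subgrp_def)
  ultimately show ?thesis by (simp add: msubmodule_def)
qed

text \<open>
  The norm map descends to the tensor product over \<open>G\<close>, and followed by the projection it is
  multiplication by the order of \<open>G\<close>, because both \<open>mu\<close> and \<open>norm_map\<close> take the norm of \<open>f\<close> to \<open>card G\<close>
  times their value at \<open>f\<close>.
\<close>

lemma homology_killed_ind_V_ker_norm:
  assumes "n \<ge> Suc (card (carrier M))"
  shows "homology_killed translate n (1 * card G) ind_V ker_norm"
proof (rule homology_killed_endomorphism[OF action_translate sub_ind_V sub_ker_norm sub_ind_W ind_W_subset_ker_norm])
  show "ker_norm \<subseteq> ind_V" by (auto simp: ker_norm_def)
  show "equivariant_on translate translate ind_V norm_map"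
    using norm_map_additive norm_map_equivariant by (auto simp: equivariant_on_def)
  show "norm_map f \<in> ind_W" if "f \<in> ker_norm" for f
  proof -
    have f: "f \<in> ind_V" "\<And>l. l \<in> principal e - I \<Longrightarrow> norm_map f l \<in> W" using that by (auto simp: ker_norm_def)
    show ?thesis
      using ind_V_D[OF norm_map_ind_V[OF f(1)]] f(2) by (auto simp: ind_W_def sections_def eW_def eV_def)
  qed
  show "nmul (card G) f - norm_map f \<in> ker_norm" if f: "f \<in> ind_V" for f
  proof -
    have k: "nmul (card G) f \<in> ind_V" by (rule subgrp_nmul[OF subgrp_ind_V f])
    then have "nmul (card G) f - norm_map f \<in> ind_V" by (intro subgrp_diff subgrp_ind_V norm_map_ind_V f)
    moreover have "mu (nmul (card G) f - norm_map f) = 0"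
      by (simp add: additive_on_diff[OF mu_additive k norm_map_ind_V[OF f]] additive_on_nmul[OF mu_additive f] mu_norm_map f)
    moreover have "norm_map (nmul (card G) f - norm_map f) = 0"
      by (simp add: additive_on_diff[OF norm_map_additive k norm_map_ind_V[OF f]] additive_on_nmul[OF norm_map_additive f] norm_map_norm_map f)
    ultimately show ?thesis using subgrp_0[OF subgrp_V(2)] by (simp add: ker_norm_def)
  qed
qed (use norm_map_ind_V homology_killed_ind_V_ind_W[OF assms] in auto)

lemma single_ind_V: "l \<in> principal e \<Longrightarrow> v \<in> eV \<Longrightarrow> single l v \<in> ind_V"
  by (rule ind_V_I) (auto simp: single_def subgrp_0[OF subgrp_V(3)])

lemma mu_single: "l \<in> carrier M \<Longrightarrow> mu (single l v) = act l v"
proof -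
  assume l: "l \<in> carrier M"
  have "mu (single l v) = (\<Sum>k\<in>carrier M. if k = l then act l v else 0)"
    unfolding mu_def by (rule sum.cong) (auto simp: single_def action_0[OF act])
  then show ?thesis using l finite_carrier by simp
qed

text \<open>
  The function \<open>e f\<close> lives on \<open>eMe\<close>, which up to \<open>I\<close> is
  \<open>G\<close>. On \<open>G\<close>, a single orbit, the sum that defines the norm is \<open>\<mu>(e f)\<close> up to a translation and up to
  terms from \<open>I\<close>, hence it lies in \<open>W\<close>. So \<open>e\<close> annihilates the kernel of \<open>\<mu>\<close>.
\<close>

lemma translate_e_ker_norm:
  assumes f: "f \<in> ker_mu" shows "translate e f \<in> ker_norm"
proof -
  define h where "h = translate e f"
  have hK: "h \<in> ker_mu" using sub_ker_mu f e by (simp add: h_def msubmodule_def)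
  then have hA: "h \<in> ind_V" and hW: "mu h \<in> W" by (auto simp: ker_mu_def)
  have supp: "e \<otimes> l = l" if "h l \<noteq> 0" for l
  proof (rule ccontr)
    assume *: "e \<otimes> l \<noteq> l"
    have "{l'\<in>carrier M. e \<otimes> l' = l} = {}"
      using * e by (auto simp: m_assoc[symmetric])
    then have "h l = 0" unfolding h_def translate_def by (simp only: sum.empty)
    then show False using that by simp
  qed
  have sumG: "(\<Sum>g\<in>G. act g (h g)) \<in> W"
  proof -
    have "G \<subseteq> carrier M" by (auto simp: G_def)
    then have "mu h = (\<Sum>l\<in>carrier M - G. act l (h l)) + (\<Sum>g\<in>G. act g (h g))"
      unfolding mu_def by (rule sum.subset_diff[OF _ finite_carrier])
    moreover have "(\<Sum>l\<in>carrier M - G. act l (h l)) \<in> W"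
    proof (rule subgrp_sum[OF subgrp_V(2)])
      fix l assume l: "l \<in> carrier M - G"
      show "act l (h l) \<in> W"
      proof (cases "h l = 0")
        case True
        then show ?thesis using l action_0[OF act] subgrp_0[OF subgrp_V(2)] by simp
      next
        case False
        then have "l \<in> principal e" using ind_V_D(1)[OF hA] by blast
        then have "l \<in> I" using l supp[OF False] by (auto simp: G_def principal_M)
        then show ?thesis by (rule act_I_W[OF _ hA])
      qed
    qed
    ultimately show ?thesis using subgrp_diff[OF subgrp_V(2) hW] by (metis add_diff_cancel_left')
  qed
  have "norm_map h l \<in> W" if l: "l \<in> principal e - I" for l
  proof (cases "l \<in> G")
    case True
    obtain l' where l': "l' \<in> G" "l' \<otimes> l = e" "l \<otimes> l' = e" using G_inverse[OF True] by blast
    have "act g v = act l' (act (l \<otimes> g) v)" if "g \<in> G" for g v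
      using action_mult[OF act, of l' "l \<otimes> g" v] that l' True
      by (simp add: G_closed m_assoc[symmetric] G_e)
    then have "norm_map h l = (\<Sum>g\<in>G. act l' (act (l \<otimes> g) (h (l \<otimes> g))))"
      using l by (simp add: norm_map_def)
    also have "\<dots> = act l' (\<Sum>g\<in>G. act (l \<otimes> g) (h (l \<otimes> g)))"
      using l' by (simp add: action_sum[OF act] G_closed)
    also have "(\<Sum>g\<in>G. act (l \<otimes> g) (h (l \<otimes> g))) = (\<Sum>g\<in>G. act g (h g))"
      by (rule sum.reindex_bij_witness[of _ "\<lambda>k. l' \<otimes> k" "\<lambda>k. l \<otimes> k"])
        (use True l' in \<open>auto simp: G_mult m_assoc[symmetric] G_closed G_e\<close>)
    finally show ?thesis using sumG act_V(2) l' G_closed by simp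
  next
    case False
    have "h (l \<otimes> g) = 0" if g: "g \<in> G" for g
    proof (rule ccontr)
      assume "h (l \<otimes> g) \<noteq> 0"
      then have eq: "e \<otimes> (l \<otimes> g) = l \<otimes> g" by (rule supp)
      obtain k where k: "k \<in> G" "g \<otimes> k = e" using G_inverse[OF g] by blast
      have "e \<otimes> l = e \<otimes> (l \<otimes> g \<otimes> k)" using l g k by (simp add: principal_G_cancel)
      also have "\<dots> = l \<otimes> g \<otimes> k" using eq l g k e by (simp add: m_assoc[symmetric] principal_M G_closed)
      also have "\<dots> = l" using l g k by (simp add: principal_G_cancel)
      finally show False using False l by (auto simp: G_def principal_M)
    qed
    then show ?thesis using subgrp_0[OF subgrp_V(2)] action_0[OF act] by (simp add: norm_map_def G_closed)
  qed
  then show ?thesis using hA hW by (auto simp: ker_norm_def h_def)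
qed

lemma kill_ker_mu: "x \<in> I' \<Longrightarrow> f \<in> ker_mu \<Longrightarrow> translate x f \<in> ker_norm"
proof -
  assume x: "x \<in> I'" and f: "f \<in> ker_mu"
  then have fA: "f \<in> ind_V" by (simp add: ker_mu_def)
  from x consider "x \<in> I" | p q where "p \<in> carrier M" "q \<in> carrier M" "x = p \<otimes> e \<otimes> q"
    by (auto simp: I'_def)
  then show ?thesis
  proof cases
    case 1
    have "norm_map (translate x f) l = 0" if l: "l \<in> principal e - I" for l
    proof -
      have "x \<otimes> l' \<noteq> l" if "l' \<in> principal e" for l'
        using I_mult(3)[OF principal_M(1)[OF that] 1] l by auto
      then have "{l'\<in>principal e. x \<otimes> l' = l} = {}" by simp
      then show ?thesis unfolding norm_map_equivariant[OF fA I_mult(1)[OF 1]] translate_eq_principal[OF norm_map_ind_V[OF fA]]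
        by (simp only: sum.empty)
    qed
    moreover have "translate x f \<in> ker_mu" using sub_ker_mu f I_mult(1)[OF 1] by (simp add: msubmodule_def)
    ultimately show ?thesis
      using subgrp_0[OF subgrp_V(2)] by (simp add: ker_norm_def ker_mu_def)
  next
    case 2
    have "translate x f = translate p (translate e (translate q f))"
      unfolding 2(3) using 2(1,2) e(1) by (simp only: action_mult[OF action_translate] m_closed)
    moreover have "translate q f \<in> ker_mu" using sub_ker_mu f 2 by (simp add: msubmodule_def)
    ultimately show ?thesis using translate_e_ker_norm sub_ker_norm 2 by (simp add: msubmodule_def)
  qed
qed

lemma sub_im_mu: "msubmodule act im_mu" and W_subset_im_mu: "W \<subseteq> im_mu" and im_mu_subset_V: "im_mu \<subseteq> V"
proof -
  have "act x (w + mu f) = act x w + mu (translate x f)" if "x \<in> carrier M" for x w f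
    using additive_on_add[of UNIV "act x"] act that by (auto simp: mu_equivariant action_def)
  then have "act x u \<in> im_mu" if "x \<in> carrier M" "u \<in> im_mu" for x u
    using that sub_ind_V act_V(2) unfolding im_mu_def msubmodule_def by blast
  moreover have "subgrp im_mu"
    unfolding subgrp_def
  proof (intro conjI ballI)
    show "0 \<in> im_mu"
      using subgrp_0[OF subgrp_V(2)] subgrp_0[OF subgrp_ind_V] additive_on_0[OF mu_additive]
      unfolding im_mu_def by force
    fix u v assume "u \<in> im_mu" "v \<in> im_mu"
    then obtain w f w' f' where *: "u = w + mu f" "v = w' + mu f'" "w \<in> W" "w' \<in> W" "f \<in> ind_V" "f' \<in> ind_V"
      by (auto simp: im_mu_def)
    then have "u - v = (w - w') + mu (f - f')" by (simp add: additive_on_diff[OF mu_additive])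
    then show "u - v \<in> im_mu" using * subgrp_diff[OF subgrp_V(2)] subgrp_diff[OF subgrp_ind_V] unfolding im_mu_def by blast
  qed
  ultimately show "msubmodule act im_mu" by (simp add: msubmodule_def)
  show "W \<subseteq> im_mu"
    using subgrp_0[OF subgrp_ind_V] additive_on_0[OF mu_additive] unfolding im_mu_def by force
  show "im_mu \<subseteq> V"
    using WV mu_V subgrp_add[OF subgrp_V(1)] unfolding im_mu_def by blast
qed

text \<open>
  For \<open>x = p e q\<close>, the vector \<open>x v = (p e) (e q v)\<close> is the image under \<open>mu\<close> of \<open>p e \<otimes> e q v\<close>.
\<close>

lemma kill_coker_mu: "x \<in> I' \<Longrightarrow> v \<in> V \<Longrightarrow> act x v \<in> im_mu"
proof -
  assume x: "x \<in> I'" and v: "v \<in> V"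
  from x consider "x \<in> I" | p q where "p \<in> carrier M" "q \<in> carrier M" "x = p \<otimes> e \<otimes> q"
    by (auto simp: I'_def)
  then show ?thesis
  proof cases
    case 1
    then show ?thesis using kill v W_subset_im_mu by blast
  next
    case 2
    define u where "u = act e (act q v)"
    have u: "u \<in> eV"
    proof -
      have "act e u = u" unfolding u_def using action_mult[OF act e(1) e(1)] e(3) by metis
      then show ?thesis using act_V(1) 2 v e(1) by (simp add: u_def eV_def)
    qed
    have p: "p \<otimes> e \<in> principal e" using principal_closed[OF e(1) 2(1) principal_e] .
    have "act x v = act (p \<otimes> e) u"
    proof -
      have "act (p \<otimes> e) u = act (p \<otimes> (e \<otimes> e) \<otimes> q) v"
        using 2(1,2) e(1) by (simp add: u_def action_mult[OF act] m_closed del: e(3))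
      then show ?thesis using 2(3) e(3) by simp
    qed
    then have "act x v = 0 + mu (single (p \<otimes> e) u)" using mu_single p principal_M by simp
    then show ?thesis using subgrp_0[OF subgrp_V(2)] single_ind_V[OF p u] unfolding im_mu_def by blast
  qed
qed

lemma ideal_I': "two_sided_ideal I'" and I_I': "I \<subset> I'"
proof -
  have 1: "x \<otimes> (p \<otimes> e \<otimes> q) = (x \<otimes> p) \<otimes> e \<otimes> q" "p \<otimes> e \<otimes> q \<otimes> x = p \<otimes> e \<otimes> (q \<otimes> x)"
    if "p \<in> carrier M" "q \<in> carrier M" "x \<in> carrier M" for p q x
    using that e by (simp_all add: m_assoc)
  show "two_sided_ideal I'"
    unfolding two_sided_ideal_def
  proof (intro conjI ballI)
    show "I' \<subseteq> carrier M" using I_mult(1) e by (auto simp: I'_def)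
    fix x y assume "x \<in> carrier M" "y \<in> I'"
    then consider "y \<in> I" "x \<in> carrier M" |
        p q where "p \<in> carrier M" "q \<in> carrier M" "y = p \<otimes> e \<otimes> q" "x \<in> carrier M"
      by (auto simp: I'_def)
    then have "x \<otimes> y \<in> I' \<and> y \<otimes> x \<in> I'"
    proof cases
      case 1
      then show ?thesis using I_mult by (simp add: I'_def)
    next
      case 2
      then have "x \<otimes> p \<in> carrier M" "q \<otimes> x \<in> carrier M" by simp_all
      then show ?thesis unfolding I'_def using 1[OF 2(1,2,4)] 2 by blast
    qed
    then show "x \<otimes> y \<in> I'" "y \<otimes> x \<in> I'" by simp_all
  qed
  have "e \<in> {p \<otimes> e \<otimes> q | p q. p \<in> carrier M \<and> q \<in> carrier M}"
    using e by (intro CollectI exI[of _ \<one>]) simp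
  then show "I \<subset> I'" using e by (auto simp: I'_def)
qed

text \<open>
  The submodules \<open>ker_norm \<subseteq> ker_mu \<subseteq> ind_V\<close> give the homology of \<open>im_mu / W\<close>, which is \<open>ind_V / ker_mu\<close>.
  The extension by \<open>V / im_mu\<close>, the cokernel of \<open>mu\<close>, then gives \<open>V / W\<close>.
\<close>

lemma homology_killed_V_W:
  assumes n: "n \<ge> Suc (card (carrier M))" and k: "homology_killed translate n a ker_mu ker_norm" and c: "homology_killed act (Suc n) b V im_mu"
  shows "homology_killed act (Suc n) (card G * a * b) V W"
proof -
  have "homology_killed translate (Suc n) (card G * a) ind_V ker_mu"
    using homology_killed_ind_V_ker_norm[of "Suc n"] n
    by (intro homology_killed_quotient[OF action_translate sub_ind_V sub_ker_mu sub_ker_norm ker_norm_subset_ker_mu ker_mu_subset_ind_V _ k]) simp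
  then have "homology_killed act (Suc n) (card G * a) im_mu W"
  proof (rule homology_killed_transfer[OF action_translate act sub_ind_V sub_im_mu W, rotated -1])
    show "equivariant_on translate act ind_V mu"
      using mu_additive mu_equivariant by (auto simp: equivariant_on_def)
    show "mu f \<in> im_mu" if "f \<in> ind_V" for f
      using that subgrp_0[OF subgrp_V(2)] unfolding im_mu_def by force
    show "\<exists>f\<in>ind_V. c - mu f \<in> W" if "c \<in> im_mu" for c
    proof -
      obtain w f where "c = w + mu f" "w \<in> W" "f \<in> ind_V" using \<open>c \<in> im_mu\<close> by (auto simp: im_mu_def)
      then show ?thesis by (intro bexI[of _ f]) simp_all
    qed
  qed (auto simp: ker_mu_def W_subset_im_mu)
  then show ?thesis
    by (rule homology_killed_extension[OF act V sub_im_mu W W_subset_im_mu im_mu_subset_V _ c])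
qed

end

section \<open>Descent through the ideals and the trivial module\<close>

text \<open>
  The kernel of \<open>\<mu>\<close> consists of functions from \<open>M\<close> to the ambient group of \<open>V\<close>. For the induction over the
  ideals, the functions on lists of monoid elements form an ambient group that contains such functions
  with values in itself.
\<close>

definition cons_encode :: "('a \<Rightarrow> 'a list \<Rightarrow> int) \<Rightarrow> 'a list \<Rightarrow> int" where
  "cons_encode f l = (case l of [] \<Rightarrow> 0 | m # l' \<Rightarrow> f m l')"

definition cons_decode :: "('a list \<Rightarrow> int) \<Rightarrow> 'a \<Rightarrow> 'a list \<Rightarrow> int" where
  "cons_decode u = (\<lambda>m l. u (m # l))"

lemma cons_decode_encode [simp]: "cons_decode (cons_encode f) = f"
  by (rule ext)+ (simp add: cons_decode_def cons_encode_def)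

lemma cons_encode_diff: "cons_encode (f - g) = cons_encode f - cons_encode g"
  by (rule ext) (simp add: cons_encode_def split: list.split)

lemma cons_decode_diff: "cons_decode (u - v) = cons_decode u - cons_decode v"
  by (rule ext)+ (simp add: cons_decode_def)

lemma cons_encode_0: "cons_encode 0 = 0"
  by (rule ext) (simp add: cons_encode_def split: list.split)

lemma finite_representatives:
  assumes "finite (r ` Z)" "\<And>z1 z2. z1 \<in> Z \<Longrightarrow> z2 \<in> Z \<Longrightarrow> r z1 = r z2 \<Longrightarrow> P z1 z2"
  shows "\<exists>S. finite S \<and> S \<subseteq> Z \<and> (\<forall>z\<in>Z. \<exists>s\<in>S. P z s)"
proof (intro exI conjI ballI)
  let ?S = "inv_into Z r ` r ` Z"
  show "finite ?S" using assms(1) by blast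
  show "?S \<subseteq> Z" by (auto simp: inv_into_into)
  fix z assume z: "z \<in> Z"
  then have "r z \<in> r ` Z" by (rule imageI)
  then have "P z (inv_into Z r (r z))"
    by (rule assms(2)[OF z inv_into_into]) (simp add: f_inv_into_f z)
  then show "\<exists>s\<in>?S. P z s" using z by blast
qed

context finite_monoid begin

lemma translate_one:
  assumes "\<And>l. l \<notin> carrier M \<Longrightarrow> f l = 0"
  shows "translate \<one> f = f"
proof
  fix l
  have eq: "{l'\<in>carrier M. \<one> \<otimes> l' = l} = {l'\<in>carrier M. l' = l}"
    by (rule Collect_cong) (simp cong: conj_cong)
  show "translate \<one> f l = f l"
  proof (cases "l \<in> carrier M")
    case True
    then have "{l'\<in>carrier M. l' = l} = {l}" by blast
    then show ?thesis unfolding translate_def eq by simp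
  next
    case False
    then have "{l'\<in>carrier M. l' = l} = {}" by blast
    then show ?thesis unfolding translate_def eq using assms[OF False] by simp
  qed
qed

text \<open>
  Each step enlarges \<open>I\<close> at the expense of passing to the kernel and the cokernel of
  \<open>\<mu>\<close>. For \<open>I = carrier M\<close> the unit law leaves only \<open>V = W\<close>.
\<close>

theorem homology_killed_of_ideal_killing:
  fixes act :: "'a \<Rightarrow> ('a list \<Rightarrow> int) \<Rightarrow> 'a list \<Rightarrow> int"
  assumes reg: "regular_monoid M" and "two_sided_ideal I" and "action act"
    and "msubmodule act V" "msubmodule act W" "W \<subseteq> V"
    and "\<And>v. v \<in> V \<Longrightarrow> act \<one> v = v"
    and "\<And>x v. x \<in> I \<Longrightarrow> v \<in> V \<Longrightarrow> act x v \<in> W"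
  shows "\<exists>N k. 0 < k \<and> (\<forall>n\<ge>N. homology_killed act n k V W)"
  using assms(2-)
proof (induction "card (carrier M - I)" arbitrary: I act V W rule: less_induct)
  case less
  note act = less.prems(2) and sub = less.prems(3,4) and WV = less.prems(5)
  show ?case
  proof (cases "I = carrier M")
    case True
    have "v \<in> W" if "v \<in> V" for v
      using less.prems(6)[OF that] less.prems(7)[OF _ that, of \<one>] True by simp
    then have "V = W" using WV by blast
    then show ?thesis using homology_killed_refl[OF sub(1) act] by blast
  next
    case False
    obtain e where e: "e \<in> carrier M" "e \<notin> I" "e \<otimes> e = e"
      "\<And>g. g \<in> carrier M \<Longrightarrow> g \<notin> I \<Longrightarrow> e \<otimes> g = g \<Longrightarrow> g \<otimes> e = g \<Longrightarrow>
         \<exists>h\<in>carrier M. e \<otimes> h = h \<and> h \<otimes> e = h \<and> g \<otimes> h = e \<and> h \<otimes> g = e"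
      by (rule minimal_idempotent[OF reg less.prems(1) False], rule that)
    interpret L: ideal_layer M I e act V W
      by unfold_locales (use reg less.prems e in auto)
    have "carrier M - L.I' \<subset> carrier M - I"
      using L.I_I' L.ideal_I' unfolding two_sided_ideal_def by blast
    then have smaller: "card (carrier M - L.I') < card (carrier M - I)"
      using finite_carrier by (simp add: psubset_card_mono)
    have "\<exists>N k. 0 < k \<and> (\<forall>n\<ge>N. homology_killed act n k V L.im_mu)"
      by (rule less.hyps[OF smaller L.ideal_I' act sub(1) L.sub_im_mu L.im_mu_subset_V])
        (use less.prems(6) L.kill_coker_mu in auto)
    then obtain N1 b where b: "0 < b" "\<And>n. n \<ge> N1 \<Longrightarrow> homology_killed act n b V L.im_mu" by blast
    \<comment> \<open>The kernel of \<open>\<mu>\<close> is moved into the ambient group on lists, where the induction hypothesis applies.\<close>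
    define act' where "act' x u = cons_encode (translate x (cons_decode u))" for x and u :: "'a list \<Rightarrow> int"
    have act': "action act'"
      by (simp add: action_def additive_on_def subgrp_def act'_def cons_encode_diff cons_decode_diff
          action_diff[OF action_translate] action_mult[OF action_translate])
    have encode_submodule: "msubmodule act' (cons_encode ` S)" if S: "msubmodule translate S" for S
      unfolding msubmodule_def subgrp_def
    proof (intro conjI ballI)
      show "0 \<in> cons_encode ` S"
        using imageI[OF subgrp_0[OF msubmodule_subgrp(2)[OF S]], of cons_encode] by (simp add: cons_encode_0)
      show "u - v \<in> cons_encode ` S" if "u \<in> cons_encode ` S" "v \<in> cons_encode ` S" for u v
      proof -
        obtain f g where "u = cons_encode f" "v = cons_encode g" "f \<in> S" "g \<in> S"
          using \<open>u \<in> cons_encode ` S\<close> \<open>v \<in> cons_encode ` S\<close> by blast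
        then show ?thesis
          using imageI[OF subgrp_diff[OF msubmodule_subgrp(2)[OF S]], of f g cons_encode] by (simp add: cons_encode_diff)
      qed
      show "act' x u \<in> cons_encode ` S" if "x \<in> carrier M" "u \<in> cons_encode ` S" for x u
      proof -
        obtain f where "u = cons_encode f" "f \<in> S" using \<open>u \<in> cons_encode ` S\<close> by blast
        then show ?thesis using S \<open>x \<in> carrier M\<close> by (simp add: act'_def msubmodule_def)
      qed
    qed
    have "\<exists>N k. 0 < k \<and> (\<forall>n\<ge>N. homology_killed act' n k (cons_encode ` L.ker_mu) (cons_encode ` L.ker_norm))"
    proof (rule less.hyps[OF smaller L.ideal_I' act' encode_submodule[OF L.sub_ker_mu] encode_submodule[OF L.sub_ker_norm]])
      show "cons_encode ` L.ker_norm \<subseteq> cons_encode ` L.ker_mu" using L.ker_norm_subset_ker_mu by blast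
      show "act' x u \<in> cons_encode ` L.ker_norm" if "x \<in> L.I'" "u \<in> cons_encode ` L.ker_mu" for x u
      proof -
        obtain f where "u = cons_encode f" "f \<in> L.ker_mu" using \<open>u \<in> cons_encode ` L.ker_mu\<close> by blast
        then show ?thesis using L.kill_ker_mu[OF \<open>x \<in> L.I'\<close>] by (simp add: act'_def)
      qed
      show "act' \<one> u = u" if "u \<in> cons_encode ` L.ker_mu" for u
      proof -
        obtain f where f: "u = cons_encode f" "f \<in> L.ind_V" using \<open>u \<in> cons_encode ` L.ker_mu\<close> L.ker_mu_subset_ind_V by blast
        then have "translate \<one> f = f" using L.ind_V_D(1) L.principal_M(1) by (intro translate_one) blast
        then show ?thesis using f by (simp add: act'_def)
      qed
    qed
    then obtain N2 a where a: "0 < a" "\<And>n. n \<ge> N2 \<Longrightarrow> homology_killed act' n a (cons_encode ` L.ker_mu) (cons_encode ` L.ker_norm)" by blast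
    have K: "homology_killed translate n a L.ker_mu L.ker_norm" if "n \<ge> N2" for n
    proof (rule homology_killed_transfer[OF act' action_translate encode_submodule[OF L.sub_ker_mu] L.sub_ker_mu L.sub_ker_norm _ _ L.ker_norm_subset_ker_mu _ _ a(2)[OF that]])
      show "equivariant_on act' translate (cons_encode ` L.ker_mu) cons_decode"
        using encode_submodule[OF L.sub_ker_mu]
        by (simp add: equivariant_on_def additive_on_def msubmodule_def cons_decode_diff act'_def)
      show "cons_decode v \<in> L.ker_norm \<longleftrightarrow> v \<in> cons_encode ` L.ker_norm" if "v \<in> cons_encode ` L.ker_mu" for v
      proof -
        obtain f where f: "v = cons_encode f" using \<open>v \<in> cons_encode ` L.ker_mu\<close> by blast
        have "f = g" if "cons_encode f = cons_encode g" for g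
          using arg_cong[OF that, of cons_decode] by simp
        then have "cons_encode f \<in> cons_encode ` L.ker_norm \<longleftrightarrow> f \<in> L.ker_norm" by blast
        then show ?thesis using f by simp
      qed
      show "\<exists>v\<in>cons_encode ` L.ker_mu. f - cons_decode v \<in> L.ker_norm" if "f \<in> L.ker_mu" for f
        using that subgrp_0[OF msubmodule_subgrp(2)[OF L.sub_ker_norm]] by (intro bexI[of _ "cons_encode f"]) simp_all
    qed auto
    define N where "N = Suc (N1 + N2 + Suc (card (carrier M)))"
    have "homology_killed act n (card L.G * a * b) V W" if "n \<ge> N" for n
    proof -
      define m where "m = n - 1"
      have "n = Suc m" "m \<ge> N2" "Suc m \<ge> N1" "m \<ge> Suc (card (carrier M))"
        using that by (auto simp: m_def N_def)
      then show ?thesis using L.homology_killed_V_W[OF _ K b(2)] by simp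
    qed
    moreover have "0 < card L.G" using L.e_G L.finite_G by (auto simp: card_gt_0_iff)
    ultimately show ?thesis using a(1) b(1)
      by (intro exI[of _ N] exI[of _ "card L.G * a * b"]) simp
  qed
qed

lemma homology_killed_trivial:
  assumes reg: "regular_monoid M"
  shows "\<exists>N k. 0 < k \<and> (\<forall>n\<ge>N. homology_killed (\<lambda>x v. v) n k (UNIV :: int set) {0})"
proof -
  define V where "V = {u :: 'a list \<Rightarrow> int. \<forall>l. l \<noteq> [] \<longrightarrow> u l = 0}"
  have act: "action (\<lambda>x v::'w::ab_group_add. v)"
    by (simp add: action_def additive_on_def subgrp_def)
  have sub: "msubmodule (\<lambda>x v. v) V" "msubmodule (\<lambda>x v. v) {0 :: 'a list \<Rightarrow> int}"
    by (auto simp: V_def msubmodule_def subgrp_def)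
  have "\<exists>N k. 0 < k \<and> (\<forall>n\<ge>N. homology_killed (\<lambda>x v. v) n k V {0})"
    by (rule homology_killed_of_ideal_killing[OF reg, of "{}"])
      (use act sub in \<open>auto simp: two_sided_ideal_def V_def\<close>)
  moreover have "homology_killed (\<lambda>x v. v) n k (UNIV :: int set) {0}" if "homology_killed (\<lambda>x v. v) n k V {0}" for n k
  proof (rule homology_killed_transfer[OF act act sub(1) _ _ _ _ _ _ _ that])
    show "equivariant_on (\<lambda>x v. v) (\<lambda>x v. v) V (\<lambda>u. u [])"
      using sub by (simp add: equivariant_on_def additive_on_def msubmodule_def)
    show "(u [] \<in> {0}) = (u \<in> {0})" if "u \<in> V" for u
      using that by (auto simp: V_def fun_eq_iff) metis
    show "\<exists>v\<in>V. v' - v [] \<in> {0}" for v'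
      by (rule bexI[of _ "\<lambda>l. if l = [] then v' else 0"]) (auto simp: V_def)
  qed (auto simp: msubmodule_def subgrp_def)
  ultimately show ?thesis by blast
qed

definition homology_finite :: "('a \<Rightarrow> 'v::ab_group_add \<Rightarrow> 'v) \<Rightarrow> nat \<Rightarrow> 'v set \<Rightarrow> bool" where
  "homology_finite act n V \<longleftrightarrow> (\<exists>S. finite S \<and> (\<forall>z\<in>bar_chains (Suc n) V. coinv_d act z \<in> bar_chains n {0} \<longrightarrow>
     (\<exists>s\<in>S. \<exists>y\<in>bar_chains (Suc (Suc n)) V. z - s - coinv_d act y \<in> bar_chains (Suc n) {0})))"

lemma nmul_int: "nmul k (i::int) = int k * i"
  by (simp add: nmul_def)

lemma msubmodule_0: "action act \<Longrightarrow> msubmodule act {0}"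
  by (simp add: msubmodule_def action_0)

text \<open>
  There are finitely many cycles modulo \<open>k\<close>. Two cycles that agree modulo \<open>k\<close> differ by \<open>k\<close> times a chain \<open>w\<close>,
  which is a cycle because the chain groups are torsion-free. So the difference is a boundary.
\<close>

lemma homology_finite_int:
  assumes act: "action act" and h: "homology_killed act n k (UNIV :: int set) {0}" and k: "0 < k"
  shows "homology_finite act n (UNIV :: int set)"
proof -
  let ?C = "cells (Suc n)"
  define Z where "Z = {z :: 'a list \<Rightarrow> int. coinv_d act z \<in> bar_chains n {0}}"
  define r where "r z = (\<lambda>l. if l \<in> ?C then z l mod int k else 0)" for z :: "'a list \<Rightarrow> int"
  define P where "P z s \<longleftrightarrow> (\<exists>y. z - s - coinv_d act y \<in> bar_chains (Suc n) {0})" for z s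
  have "r z l \<in> {0..<int k}" for z l
    using k by (simp add: r_def)
  moreover have "r z l = 0" if "l \<notin> ?C" for z l
    unfolding r_def using that by (rule if_not_P)
  ultimately have "r ` Z \<subseteq> {f. \<forall>l. (l \<in> ?C \<longrightarrow> f l \<in> {0..<int k}) \<and> (l \<notin> ?C \<longrightarrow> f l = 0)}"
    by (simp add: image_subset_iff)
  then have "finite (r ` Z)"
    by (rule finite_subset) (rule finite_set_of_finite_funs[OF finite_cells]; simp)
  moreover have "P z s" if z: "z \<in> Z" "s \<in> Z" and eq: "r z = r s" for z s
  proof -
    define w where "w l = (z l - s l) div int k" for l
    have "nmul k w l = z l - s l" if "l \<in> ?C" for l
    proof -
      have "z l mod int k = s l mod int k" using fun_cong[OF eq, of l] that by (simp add: r_def)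
      then have "int k dvd z l - s l" by (rule mod_eq_dvd_iff[THEN iffD1])
      then show ?thesis by (simp add: nmul_fun nmul_int w_def)
    qed
    then have w: "nmul k w - (z - s) \<in> bar_chains (Suc n) {0}" by (auto simp: bar_chains_def)
    then have "coinv_d act (nmul k w - (z - s)) \<in> bar_chains n {0}"
      by (rule coinv_d_chains[OF msubmodule_0[OF act]])
    then have "nmul k (coinv_d act w) - (coinv_d act z - coinv_d act s) \<in> bar_chains n {0}"
      by (simp add: coinv_d_diff coinv_d_nmul act)
    then have "coinv_d act w \<in> bar_chains n {0}"
      using z k by (auto simp: Z_def bar_chains_def nmul_fun nmul_int)
    moreover have "w \<in> bar_chains (Suc n) UNIV" by (simp add: bar_chains_def)
    ultimately obtain y where "nmul k w - coinv_d act y \<in> bar_chains (Suc n) {0}"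
      using h unfolding homology_killed_def by blast
    then have "z - s - coinv_d act y \<in> bar_chains (Suc n) {0}"
      using w by (auto simp: bar_chains_def)
    then show ?thesis by (auto simp: P_def)
  qed
  ultimately obtain S where "finite S" "\<forall>z\<in>Z. \<exists>s\<in>S. P z s"
    using finite_representatives[of r Z P] by blast
  then show ?thesis
    unfolding homology_finite_def P_def Z_def bar_chains_def[of _ UNIV] by auto
qed

theorem trivial_homology_finite:
  assumes "regular_monoid M"
  shows "\<exists>N. \<forall>n\<ge>N. homology_finite (\<lambda>x v. v) n (UNIV :: int set)"
proof -
  have "action (\<lambda>x v::int. v)"
    by (simp add: action_def additive_on_def subgrp_def)
  then show ?thesis using homology_killed_trivial[OF assms] homology_finite_int by blast
qed


section \<open>Dimension shifting along a resolution\<close>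

text \<open>
  The kernel of the map \<open>H\<^sub>n(K) \<rightarrow> H\<^sub>n(P)\<close> is finite. Unlike in \<open>homology_finite\<close>, the degree is \<open>n\<close>
  itself and may be zero.
\<close>

definition bounding_finite :: "('a \<Rightarrow> 'v::ab_group_add \<Rightarrow> 'v) \<Rightarrow> nat \<Rightarrow> 'v set \<Rightarrow> 'v set \<Rightarrow> bool" where
  "bounding_finite act n K P \<longleftrightarrow> (\<exists>S. finite S \<and> S \<subseteq> bar_chains n K \<and>
     (\<forall>z\<in>bar_chains n K. (\<exists>y\<in>bar_chains (Suc n) P. z - coinv_d act y \<in> bar_chains n {0}) \<longrightarrow>
       (\<exists>s\<in>S. \<exists>y\<in>bar_chains (Suc n) K. z - s - coinv_d act y \<in> bar_chains n {0})))"

lemma equivariant_coinv_d: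
  assumes "msubmodule act P" "equivariant_on act act' P \<phi>" "f \<in> bar_chains (Suc n) P" "l \<in> cells n"
  shows "coinv_d act' (\<phi> \<circ> f) l = \<phi> (coinv_d act f l)"
proof -
  have "coinv_d act' (\<phi> \<circ> f) - (\<phi> \<circ> coinv_d act f) \<in> bar_chains n {0}"
    by (rule coinv_d_natural[OF assms(1) _ _ assms(3)]) (use assms(2) in \<open>auto simp: equivariant_on_def\<close>)
  then show ?thesis using assms(4) by (auto simp: bar_chains_def)
qed

text \<open>
  For the exact sequence \<open>0 \<rightarrow> K \<rightarrow> P \<rightarrow> V \<rightarrow> 0\<close>, the kernel of \<open>H\<^sub>n(K) \<rightarrow> H\<^sub>n(P)\<close> is the image of the connecting
  homomorphism from \<open>H\<^sub>n\<^sub>+\<^sub>1(V)\<close>.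
\<close>

lemma homology_finite_shift:
  assumes act: "action act" "action act'" and sub: "msubmodule act P" "msubmodule act' V"
    and \<phi>: "equivariant_on act act' P \<phi>" "\<And>p. p \<in> P \<Longrightarrow> \<phi> p \<in> V" "\<And>v. v \<in> V \<Longrightarrow> \<exists>p\<in>P. \<phi> p = v"
    and K: "K = {p\<in>P. \<phi> p = 0}"
    and fin: "homology_finite act' n V"
  shows "bounding_finite act n K P"
proof -
  obtain S0 where S0: "finite S0" "\<And>z. z \<in> bar_chains (Suc n) V \<Longrightarrow> coinv_d act' z \<in> bar_chains n {0} \<Longrightarrow>
     \<exists>s\<in>S0. \<exists>y\<in>bar_chains (Suc (Suc n)) V. z - s - coinv_d act' y \<in> bar_chains (Suc n) {0}"
    using fin by (auto simp: homology_finite_def)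
  have \<phi>add: "additive_on P \<phi>" using \<phi>(1) by (simp add: equivariant_on_def)
  define Z where "Z = {z\<in>bar_chains n K. \<exists>y\<in>bar_chains (Suc n) P. z - coinv_d act y \<in> bar_chains n {0}}"
  \<comment> \<open>The class of \<open>z\<close> is determined by a representative \<open>s\<close> of the cycle of \<open>V\<close> that a bounding chain \<open>y\<close> of \<open>z\<close> gives.
    The chain \<open>u\<close> corrects \<open>y\<close> by a boundary so that \<open>\<phi>\<close> maps it to \<open>s\<close> exactly.\<close>
  define rel where "rel z s \<longleftrightarrow> (\<exists>y\<in>bar_chains (Suc n) P. \<exists>u\<in>bar_chains (Suc (Suc n)) P.
      z - coinv_d act y \<in> bar_chains n {0} \<and> (\<phi> \<circ> (y - coinv_d act u)) - s \<in> bar_chains (Suc n) {0})" for z s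
  have "\<exists>s\<in>S0. rel z s" if z: "z \<in> Z" for z
  proof -
    obtain y where y: "y \<in> bar_chains (Suc n) P" "z - coinv_d act y \<in> bar_chains n {0}"
      using z by (auto simp: Z_def)
    have "coinv_d act' (\<phi> \<circ> y) l = 0" if l: "l \<in> cells n" for l
    proof -
      have "coinv_d act y l = z l" using y(2) l by (auto simp: bar_chains_def)
      moreover have "\<phi> (z l) = 0" using z l by (auto simp: Z_def K bar_chains_def)
      ultimately show ?thesis using equivariant_coinv_d[OF sub(1) \<phi>(1) y(1) l] by simp
    qed
    then have "coinv_d act' (\<phi> \<circ> y) \<in> bar_chains n {0}" by (auto simp: bar_chains_def)
    moreover have "\<phi> \<circ> y \<in> bar_chains (Suc n) V" using y(1) \<phi>(2) by (auto simp: bar_chains_def)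
    ultimately obtain s w where s: "s \<in> S0" "w \<in> bar_chains (Suc (Suc n)) V"
        "(\<phi> \<circ> y) - s - coinv_d act' w \<in> bar_chains (Suc n) {0}"
      using S0(2) by blast
    have "\<forall>l. \<exists>p. l \<in> cells (Suc (Suc n)) \<longrightarrow> p \<in> P \<and> \<phi> p = w l"
      using s(2) \<phi>(3) by (fastforce simp: bar_chains_def)
    then obtain u where u': "\<forall>l. l \<in> cells (Suc (Suc n)) \<longrightarrow> u l \<in> P \<and> \<phi> (u l) = w l" by metis
    then have u: "u \<in> bar_chains (Suc (Suc n)) P" by (auto simp: bar_chains_def)
    have "(\<phi> \<circ> u) - w \<in> bar_chains (Suc (Suc n)) {0}" using u' by (auto simp: bar_chains_def)
    then have "coinv_d act' ((\<phi> \<circ> u) - w) \<in> bar_chains (Suc n) {0}"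
      by (rule coinv_d_chains[OF msubmodule_0[OF act(2)]])
    then have uw: "coinv_d act' (\<phi> \<circ> u) l = coinv_d act' w l" if "l \<in> cells (Suc n)" for l
      using that by (auto simp: coinv_d_diff act bar_chains_def)
    have "(\<phi> \<circ> (y - coinv_d act u)) l - s l = 0" if l: "l \<in> cells (Suc n)" for l
    proof -
      have "y l \<in> P" using y l by (auto simp: bar_chains_def)
      moreover have "coinv_d act u l \<in> P" using coinv_d_chains[OF sub(1) u] l by (auto simp: bar_chains_def)
      ultimately have "\<phi> (y l - coinv_d act u l) = \<phi> (y l) - coinv_d act' w l"
        using additive_on_diff[OF \<phi>add] equivariant_coinv_d[OF sub(1) \<phi>(1) u l] uw[OF l] by simp
      moreover have "\<phi> (y l) - s l - coinv_d act' w l = 0" using s(3) l by (auto simp: bar_chains_def)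
      ultimately show ?thesis by (simp add: algebra_simps)
    qed
    then have "(\<phi> \<circ> (y - coinv_d act u)) - s \<in> bar_chains (Suc n) {0}" by (auto simp: bar_chains_def)
    then have "rel z s" unfolding rel_def using y u by blast
    then show ?thesis using s(1) by blast
  qed
  then obtain r where r: "\<And>z. z \<in> Z \<Longrightarrow> r z \<in> S0" "\<And>z. z \<in> Z \<Longrightarrow> rel z (r z)" by metis
  have "finite (r ` Z)" using S0(1) r(1) by (meson finite_subset image_subsetI)
  moreover have "\<exists>y\<in>bar_chains (Suc n) K. z1 - z2 - coinv_d act y \<in> bar_chains n {0}"
    if z: "z1 \<in> Z" "z2 \<in> Z" and eq: "r z1 = r z2" for z1 z2
  proof -
    obtain y1 u1 where 1: "y1 \<in> bar_chains (Suc n) P" "u1 \<in> bar_chains (Suc (Suc n)) P"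
      "z1 - coinv_d act y1 \<in> bar_chains n {0}" "(\<phi> \<circ> (y1 - coinv_d act u1)) - r z1 \<in> bar_chains (Suc n) {0}"
      using r(2)[OF z(1)] unfolding rel_def by blast
    obtain y2 u2 where 2: "y2 \<in> bar_chains (Suc n) P" "u2 \<in> bar_chains (Suc (Suc n)) P"
      "z2 - coinv_d act y2 \<in> bar_chains n {0}" "(\<phi> \<circ> (y2 - coinv_d act u2)) - r z1 \<in> bar_chains (Suc n) {0}"
      using r(2)[OF z(2)] unfolding rel_def eq by blast
    let ?a = "y1 - coinv_d act u1" and ?b = "y2 - coinv_d act u2"
    have ab: "?a \<in> bar_chains (Suc n) P" "?b \<in> bar_chains (Suc n) P"
      using 1 2 by (auto intro!: subgrp_diff msubmodule_subgrp(1)[OF sub(1)] coinv_d_chains[OF sub(1)])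
    have "(?a - ?b) l \<in> K" if l: "l \<in> cells (Suc n)" for l
    proof -
      have "?a l \<in> P" "?b l \<in> P" using ab l by (auto simp: bar_chains_def)
      moreover have "\<phi> (?a l) = r z1 l" "\<phi> (?b l) = r z1 l"
        using 1(4) 2(4) l by (auto simp: bar_chains_def)
      ultimately show ?thesis
        using additive_on_diff[OF \<phi>add] subgrp_diff[OF msubmodule_subgrp(2)[OF sub(1)]] by (simp add: K)
    qed
    then have "?a - ?b \<in> bar_chains (Suc n) K" by (auto simp: bar_chains_def)
    moreover have "z1 - z2 - coinv_d act (?a - ?b) = (z1 - coinv_d act y1) - (z2 - coinv_d act y2)"
      by (simp add: coinv_d_diff act coinv_d_coinv_d)
    then have "z1 - z2 - coinv_d act (?a - ?b) \<in> bar_chains n {0}"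
      using subgrp_diff[OF subgrp_chains[OF subgrp_zero_set] 1(3) 2(3)] by (simp only:)
    ultimately show ?thesis by blast
  qed
  ultimately obtain S where "finite S" "S \<subseteq> Z"
      "\<And>z. z \<in> Z \<Longrightarrow> \<exists>s\<in>S. \<exists>y\<in>bar_chains (Suc n) K. z - s - coinv_d act y \<in> bar_chains n {0}"
    using finite_representatives[of r Z "\<lambda>z s. \<exists>y\<in>bar_chains (Suc n) K. z - s - coinv_d act y \<in> bar_chains n {0}"]
    by metis
  then show ?thesis unfolding bounding_finite_def by (intro exI[of _ S]) (auto simp: Z_def)
qed

lemma bounding_finite_acyclic:
  assumes "bounding_finite act (Suc n) K P" "homology_killed act n 1 P {0}" "K \<subseteq> P"
  shows "homology_finite act n K"
proof -
  obtain S where S: "finite S" "\<And>z. z \<in> bar_chains (Suc n) K \<Longrightarrow>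
      \<exists>y\<in>bar_chains (Suc (Suc n)) P. z - coinv_d act y \<in> bar_chains (Suc n) {0} \<Longrightarrow>
      \<exists>s\<in>S. \<exists>y\<in>bar_chains (Suc (Suc n)) K. z - s - coinv_d act y \<in> bar_chains (Suc n) {0}"
    using assms(1) unfolding bounding_finite_def by blast
  have "\<exists>y\<in>bar_chains (Suc (Suc n)) P. z - coinv_d act y \<in> bar_chains (Suc n) {0}"
    if "z \<in> bar_chains (Suc n) K" "coinv_d act z \<in> bar_chains n {0}" for z
    using assms(2) that chains_mono[OF assms(3) that(1)] by (auto simp: homology_killed_def)
  then show ?thesis unfolding homology_finite_def using S by blast
qed

text \<open>
  The subgroup generated by the elements \<open>v - m v\<close>, by which the coinvariants are the quotient.
\<close>

definition augmentation :: "('a \<Rightarrow> 'v::ab_group_add \<Rightarrow> 'v) \<Rightarrow> 'v set \<Rightarrow> 'v set" where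
  "augmentation act V = {\<Sum>m\<in>carrier M. f m - act m (f m) | f. \<forall>m\<in>carrier M. f m \<in> V}"

lemma coinv_d_Nil: "coinv_d act y [] = (\<Sum>m\<in>carrier M. y [m] - act m (y [m]))"
  by (simp add: coinv_d_def drop_first_def first_product_def bar_action_def sum_subtractf)

lemma augmentation_coinv_d:
  fixes act :: "'a \<Rightarrow> 'v::ab_group_add \<Rightarrow> 'v"
  shows "augmentation act V = (\<lambda>y. coinv_d act y []) ` bar_chains 1 V"
proof
  show "augmentation act V \<subseteq> (\<lambda>y. coinv_d act y []) ` bar_chains 1 V"
  proof
    fix v assume "v \<in> augmentation act V"
    then obtain f where f: "v = (\<Sum>m\<in>carrier M. f m - act m (f m))" "\<forall>m\<in>carrier M. f m \<in> V"
      by (auto simp: augmentation_def)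
    have "(\<lambda>l. f (hd l)) \<in> bar_chains 1 V" using f(2)
      by (auto simp: bar_chains_def length_Suc_conv)
    then show "v \<in> (\<lambda>y. coinv_d act y []) ` bar_chains 1 V"
      using f(1) by (intro image_eqI[of _ _ "\<lambda>l. f (hd l)"]) (simp add: coinv_d_Nil)
  qed
  show "(\<lambda>y. coinv_d act y []) ` bar_chains 1 V \<subseteq> augmentation act V"
  proof clarify
    fix y :: "'a list \<Rightarrow> 'v" assume "y \<in> bar_chains 1 V"
    then have "\<forall>m\<in>carrier M. y [m] \<in> V" by (auto simp: bar_chains_def)
    then show "coinv_d act y [] \<in> augmentation act V"
      unfolding augmentation_def coinv_d_Nil by (intro CollectI exI[of _ "\<lambda>m. y [m]"]) simp
  qed
qed

text \<open>
  Let \<open>K j\<close> be the image of \<open>D j\<close> in \<open>V j\<close>. The sequences \<open>0 \<rightarrow> K (j + 1) \<rightarrow> V (j + 1) \<rightarrow> K j \<rightarrow> 0\<close>, together with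
  \<open>0 \<rightarrow> K 0 \<rightarrow> V 0 \<rightarrow> \<int> \<rightarrow> 0\<close>, shift finiteness from degree \<open>n + 1\<close> for \<open>\<int>\<close> to degree \<open>n - j\<close> for
  \<open>K j\<close>. At \<open>j = n\<close> the degree is zero, and the finite group is that of the elements of \<open>K n\<close> which vanish in the
  coinvariants of \<open>V n\<close>, modulo those which vanish in the coinvariants of \<open>K n\<close>. It is isomorphic to the
  homology of the coinvariants of the resolution in degree \<open>n + 1\<close>.
\<close>

theorem resolution_homology_finite:
  fixes act :: "'a \<Rightarrow> 'w::ab_group_add \<Rightarrow> 'w" and V :: "nat \<Rightarrow> 'w set"
  assumes act: "action act" and sub: "\<And>j. msubmodule act (V j)"
    and acyclic: "\<And>j n. homology_killed act n 1 (V j) {0}"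
    and D: "\<And>j. equivariant_on act act (V (Suc j)) (D j)"
    and e: "equivariant_on act (\<lambda>x v. v) (V 0) (\<epsilon> :: 'w \<Rightarrow> int)" "\<epsilon> ` V 0 = UNIV"
    and exact: "D 0 ` V 1 = {p\<in>V 0. \<epsilon> p = 0}"
      "\<And>j. D (Suc j) ` V (Suc (Suc j)) = {p\<in>V (Suc j). D j p = 0}"
    and fin: "homology_finite (\<lambda>x v. v) n (UNIV :: int set)"
  shows "\<exists>S. finite S \<and> S \<subseteq> V (Suc n) \<and> (\<forall>p\<in>V (Suc n). D n p \<in> augmentation act (V n) \<longrightarrow>
     (\<exists>s\<in>S. \<exists>u\<in>augmentation act (V (Suc n)). \<exists>q\<in>V (Suc (Suc n)). p = s + u + D (Suc n) q))"
proof -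
  define K where "K j = D j ` V (Suc j)" for j
  have Dadd: "additive_on (V (Suc j)) (D j)" for j using D[of j] by (simp add: equivariant_on_def)
  have DV: "D j p \<in> V j" if "p \<in> V (Suc j)" for j p
    using that exact by (cases j) fastforce+
  have K_ker: "K 0 = {p\<in>V 0. \<epsilon> p = 0}" "K (Suc j) = {p\<in>V (Suc j). D j p = 0}" for j
    using exact by (simp_all add: K_def)
  have KV: "K j \<subseteq> V j" for j using DV by (auto simp: K_def)
  have D_act: "act x (D j p) = D j (act x p)" if "x \<in> carrier M" "p \<in> V (Suc j)" for j x p
    using D[of j] that by (simp add: equivariant_on_def)
  have sub_ker_mu: "msubmodule act (K j)" for j
  proof -
    have "subgrp (K j)"
      unfolding subgrp_def
    proof (intro conjI ballI)
      show "0 \<in> K j" using imageI[OF subgrp_0[OF msubmodule_subgrp(2)[OF sub]], of "D j" "Suc j"]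
        by (simp add: K_def additive_on_0[OF Dadd])
      fix u v assume "u \<in> K j" "v \<in> K j"
      then obtain p q where "u = D j p" "v = D j q" "p \<in> V (Suc j)" "q \<in> V (Suc j)" by (auto simp: K_def)
      then show "u - v \<in> K j"
        using imageI[OF subgrp_diff[OF msubmodule_subgrp(2)[OF sub]], of p "Suc j" q "D j"]
        by (simp add: K_def additive_on_diff[OF Dadd])
    qed
    moreover have "act x u \<in> K j" if x: "x \<in> carrier M" and u: "u \<in> K j" for x u
    proof -
      obtain p where p: "u = D j p" "p \<in> V (Suc j)" using u by (auto simp: K_def)
      moreover have "act x p \<in> V (Suc j)" using sub[of "Suc j"] x p by (simp add: msubmodule_def)
      ultimately show ?thesis using D_act[OF x] by (simp add: K_def)
    qed
    ultimately show ?thesis by (simp add: msubmodule_def)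
  qed
  have triv: "action (\<lambda>x v::int. v)" "msubmodule (\<lambda>x v::int. v) UNIV"
    by (auto simp: action_def additive_on_def subgrp_def msubmodule_def)
  have "j \<le> n \<Longrightarrow> bounding_finite act (n - j) (K j) (V j)" for j
  proof (induction j)
    case 0
    have "bounding_finite act n (K 0) (V 0)"
      by (rule homology_finite_shift[OF act triv(1) sub triv(2) e(1) _ _ K_ker(1) fin])
        (use e(2) in \<open>auto simp: image_iff set_eq_iff, metis\<close>)
    then show ?case by simp
  next
    case (Suc j)
    then have "bounding_finite act (Suc (n - Suc j)) (K j) (V j)" by (simp add: Suc_diff_Suc)
    then have "homology_finite act (n - Suc j) (K j)"
      by (rule bounding_finite_acyclic[OF _ acyclic KV])
    then show ?case
      by (intro homology_finite_shift[OF act act sub sub_ker_mu D _ _ K_ker(2)]) (auto simp: K_def)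
  qed
  from this[of n] have "bounding_finite act 0 (K n) (V n)" by simp
  then obtain S where S: "finite S" "S \<subseteq> bar_chains 0 (K n)"
     "\<And>z. z \<in> bar_chains 0 (K n) \<Longrightarrow> \<exists>y\<in>bar_chains (Suc 0) (V n). z - coinv_d act y \<in> bar_chains 0 {0} \<Longrightarrow>
       \<exists>s\<in>S. \<exists>y\<in>bar_chains (Suc 0) (K n). z - s - coinv_d act y \<in> bar_chains 0 {0}"
    unfolding bounding_finite_def by auto
  have "\<forall>s\<in>S. \<exists>q\<in>V (Suc n). D n q = s []"
  proof
    fix s assume "s \<in> S"
    then have "s [] \<in> K n" using S(2) by (auto simp: bar_chains_def)
    then show "\<exists>q\<in>V (Suc n). D n q = s []" by (auto simp: K_def)
  qed
  then obtain t where t: "\<And>s. s \<in> S \<Longrightarrow> t s \<in> V (Suc n) \<and> D n (t s) = s []" by metis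
  have sg: "subgrp (V j)" for j using sub by (simp add: msubmodule_def)
  have "\<exists>s\<in>t ` S. \<exists>u\<in>augmentation act (V (Suc n)). \<exists>q\<in>V (Suc (Suc n)). p = s + u + D (Suc n) q"
    if p: "p \<in> V (Suc n)" "D n p \<in> augmentation act (V n)" for p
  proof -
    define z where "z = (\<lambda>l::'a list. D n p)"
    have "z \<in> bar_chains 0 (K n)" using p(1) by (auto simp: z_def bar_chains_def K_def)
    moreover obtain y where "y \<in> bar_chains 1 (V n)" "D n p = coinv_d act y []"
      using p(2) unfolding augmentation_coinv_d by blast
    then have "\<exists>y\<in>bar_chains (Suc 0) (V n). z - coinv_d act y \<in> bar_chains 0 {0}"
      by (intro bexI[of _ y]) (auto simp: z_def bar_chains_def)
    ultimately obtain s y' where s: "s \<in> S" "y' \<in> bar_chains 1 (K n)" "z - s - coinv_d act y' \<in> bar_chains 0 {0}"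
      using S(3) by (metis One_nat_def)
    have "\<forall>m\<in>carrier M. \<exists>q\<in>V (Suc n). y' [m] = D n q"
    proof
      fix m assume "m \<in> carrier M"
      then have "y' [m] \<in> K n" using s(2) by (simp add: bar_chains_def)
      then show "\<exists>q\<in>V (Suc n). y' [m] = D n q" by (auto simp: K_def)
    qed
    then obtain f where f: "\<And>m. m \<in> carrier M \<Longrightarrow> f m \<in> V (Suc n) \<and> y' [m] = D n (f m)" by metis
    define u where "u = (\<Sum>m\<in>carrier M. f m - act m (f m))"
    have af: "act m (f m) \<in> V (Suc n)" if "m \<in> carrier M" for m
      using f[OF that] sub[of "Suc n"] that by (simp add: msubmodule_def)
    have u: "u \<in> augmentation act (V (Suc n))" using f unfolding u_def augmentation_def by blast
    have uV: "u \<in> V (Suc n)" unfolding u_def using f af by (auto intro!: subgrp_sum subgrp_diff sg)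
    have "D n u = (\<Sum>m\<in>carrier M. D n (f m - act m (f m)))"
      unfolding u_def by (rule additive_on_sum[OF Dadd]) (use f af in \<open>auto intro!: subgrp_diff sg\<close>)
    also have "\<dots> = coinv_d act y' []"
      unfolding coinv_d_Nil using f af by (intro sum.cong refl) (simp add: additive_on_diff[OF Dadd] D_act)
    finally have Du: "D n u = coinv_d act y' []" .
    have "D n p - s [] - coinv_d act y' [] = 0" using s(3) by (auto simp: z_def bar_chains_def)
    then have "D n (p - t s - u) = 0"
      using t[OF s(1)] p(1) uV Du by (simp add: additive_on_diff[OF Dadd] subgrp_diff[OF sg])
    then have "p - t s - u \<in> D (Suc n) ` V (Suc (Suc n))"
      unfolding exact(2) using p(1) t[OF s(1)] uV by (simp add: subgrp_diff[OF sg])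
    then obtain q where "q \<in> V (Suc (Suc n))" "p - t s - u = D (Suc n) q" by blast
    then have "p = t s + u + D (Suc n) q" by (simp add: algebra_simps)
    then show ?thesis using s(1) u \<open>q \<in> V (Suc (Suc n))\<close> by blast
  qed
  then show ?thesis using S(1) t by (intro exI[of _ "t ` S"]) auto
qed

end

section \<open>Projective modules as retracts of function modules\<close>

lemma left_module_homD:
  assumes "f \<in> left_module_hom R P Q"
  shows "x \<in> carrier P \<Longrightarrow> f x \<in> carrier Q"
    "x \<in> carrier P \<Longrightarrow> y \<in> carrier P \<Longrightarrow> f (x \<oplus>\<^bsub>P\<^esub> y) = f x \<oplus>\<^bsub>Q\<^esub> f y"
    "r \<in> carrier R \<Longrightarrow> x \<in> carrier P \<Longrightarrow> f (r \<odot>\<^bsub>P\<^esub> x) = r \<odot>\<^bsub>Q\<^esub> f x"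
  using assms by (auto simp: left_module_hom_def hom_def)

lemma left_moduleD:
  assumes "left_module R P"
  shows "abelian_group P" "ring R" "r \<in> carrier R \<Longrightarrow> x \<in> carrier P \<Longrightarrow> r \<odot>\<^bsub>P\<^esub> x \<in> carrier P"
    "x \<in> carrier P \<Longrightarrow> \<one>\<^bsub>R\<^esub> \<odot>\<^bsub>P\<^esub> x = x"
  using assms by (auto simp: left_module_def)

lemma additive_onI:
  assumes "subgrp V" "\<And>u v. u \<in> V \<Longrightarrow> v \<in> V \<Longrightarrow> \<phi> (u + v) = \<phi> u + \<phi> v"
  shows "additive_on V \<phi>"
  unfolding additive_on_def
proof (intro conjI ballI)
  fix u v assume uv: "u \<in> V" "v \<in> V"
  have "\<phi> u = \<phi> (u - v) + \<phi> v"
    using assms(2)[OF subgrp_diff[OF assms(1) uv] uv(2)] by simp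
  then show "\<phi> (u - v) = \<phi> u - \<phi> v" by simp
qed (fact assms(1))

definition zmul :: "int \<Rightarrow> ('a \<Rightarrow> 'p \<Rightarrow> int) \<Rightarrow> 'a \<Rightarrow> 'p \<Rightarrow> int" where
  "zmul i u = (\<lambda>l p. i * u l p)"

lemma subgrp_zmul:
  assumes "subgrp V" "u \<in> V"
  shows "zmul i u \<in> V"
proof -
  have pos: "zmul (int k) u = nmul k u" for k
    by (rule ext)+ (simp add: zmul_def nmul_def sum_fun_apply)
  obtain a b where i: "i = int a - int b" by (metis int_diff_cases)
  have "zmul i u = nmul a u - nmul b u"
    unfolding pos[symmetric] by (rule ext)+ (simp add: zmul_def i algebra_simps)
  then show ?thesis using assms by (simp add: subgrp_diff subgrp_nmul)
qed

definition transpose :: "('x \<Rightarrow> 'y \<Rightarrow> 'z) \<Rightarrow> 'y \<Rightarrow> 'x \<Rightarrow> 'z" where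
  "transpose f = (\<lambda>y x. f x y)"

lemma transpose_transpose [simp]: "transpose (transpose f) = f"
  by (simp add: transpose_def)

context finite_monoid begin

definition delta :: "'a \<Rightarrow> 'a \<Rightarrow> int" where
  "delta m = (\<lambda>z. if z = m then 1 else 0)"

lemma delta_closed: "m \<in> carrier M \<Longrightarrow> delta m \<in> carrier (monoid_ring M)"
  by (rule monoid_ring_carrierI[of "{m}"]) (auto simp: delta_def)

lemma monoid_ring_mult:
  assumes "a \<in> carrier (monoid_ring M)" "b \<in> carrier (monoid_ring M)"
  shows "(a \<otimes>\<^bsub>monoid_ring M\<^esub> b) z = (\<Sum>x\<in>carrier M. a x * translate x b z)"
proof -
  have "(a \<otimes>\<^bsub>monoid_ring M\<^esub> b) z = (\<Sum>x\<in>carrier M. \<Sum>y\<in>carrier M. if x \<otimes> y = z then a x * b y else 0)"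
    by (rule monoid_ring_mult_eq) (use assms finite_carrier monoid_ring_carrierD(2) in auto)
  also have "\<dots> = (\<Sum>x\<in>carrier M. a x * translate x b z)"
    unfolding translate_def sum_distrib_left
    by (rule sum.cong[OF refl]) (simp add: sum.inter_filter finite_carrier)
  finally show ?thesis .
qed

lemma sum_delta_mult:
  "m \<in> carrier M \<Longrightarrow> (\<Sum>x\<in>carrier M. delta m x * g x) = (g m :: int)"
  unfolding delta_def using finite_carrier by (simp add: if_distrib[of "\<lambda>c. c * _"] cong: if_cong)

lemma translate_apply: "translate x u l p = translate x (\<lambda>l. u l p) l"
  by (simp add: translate_def sum_fun_apply)

text \<open>
  A module over the monoid ring, whose operations come with a record, is identified by \<open>\<sigma>\<close> with a
  submodule for \<open>translate\<close> of a group of functions. The last clause extends the action of \<open>M\<close> linearly.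
\<close>

definition embedding :: "('a \<Rightarrow> int, 'p) module \<Rightarrow> ('p \<Rightarrow> 'a \<Rightarrow> 'p \<Rightarrow> int) \<Rightarrow> bool" where
  "embedding P \<sigma> \<longleftrightarrow> left_module (monoid_ring M) P \<and> inj_on \<sigma> (carrier P) \<and>
     (\<forall>x\<in>carrier P. \<forall>y\<in>carrier P. \<sigma> (x \<oplus>\<^bsub>P\<^esub> y) = \<sigma> x + \<sigma> y) \<and>
     (\<forall>r\<in>carrier (monoid_ring M). \<forall>x\<in>carrier P.
        \<sigma> (r \<odot>\<^bsub>P\<^esub> x) = (\<Sum>m\<in>carrier M. zmul (r m) (translate m (\<sigma> x))))"

lemma embeddingD:
  assumes "embedding P \<sigma>"
  shows "left_module (monoid_ring M) P" "inj_on \<sigma> (carrier P)"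
    "x \<in> carrier P \<Longrightarrow> y \<in> carrier P \<Longrightarrow> \<sigma> (x \<oplus>\<^bsub>P\<^esub> y) = \<sigma> x + \<sigma> y"
    "r \<in> carrier (monoid_ring M) \<Longrightarrow> x \<in> carrier P \<Longrightarrow>
        \<sigma> (r \<odot>\<^bsub>P\<^esub> x) = (\<Sum>m\<in>carrier M. zmul (r m) (translate m (\<sigma> x)))"
  using assms by (auto simp: embedding_def)

lemma embedding_delta:
  assumes \<sigma>: "embedding P \<sigma>" and "m \<in> carrier M" "x \<in> carrier P"
  shows "\<sigma> (delta m \<odot>\<^bsub>P\<^esub> x) = translate m (\<sigma> x)"
  unfolding embeddingD(4)[OF \<sigma> delta_closed[OF assms(2)] assms(3)]
  by (rule ext)+ (simp add: sum_fun_apply zmul_def sum_delta_mult assms)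

lemma embedding_diff:
  assumes \<sigma>: "embedding P \<sigma>" and x: "x \<in> carrier P" "y \<in> carrier P"
  shows "\<sigma> (x \<ominus>\<^bsub>P\<^esub> y) = \<sigma> x - \<sigma> y"
proof -
  interpret abelian_group P using left_moduleD(1)[OF embeddingD(1)[OF \<sigma>]] .
  have "(x \<ominus>\<^bsub>P\<^esub> y) \<oplus>\<^bsub>P\<^esub> y = x" using x by (simp add: minus_eq a_assoc l_neg)
  then have "\<sigma> x = \<sigma> (x \<ominus>\<^bsub>P\<^esub> y) + \<sigma> y" using embeddingD(3)[OF \<sigma>, of "x \<ominus>\<^bsub>P\<^esub> y" y] x by simp
  then show ?thesis by simp
qed

lemma embedding_zero: 
  assumes \<sigma>: "embedding P \<sigma>" shows "\<sigma> \<zero>\<^bsub>P\<^esub> = 0"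
proof -
  interpret abelian_group P using left_moduleD(1)[OF embeddingD(1)[OF \<sigma>]] .
  show ?thesis using embeddingD(3)[OF \<sigma>, of "\<zero>\<^bsub>P\<^esub>" "\<zero>\<^bsub>P\<^esub>"] by simp
qed

lemma embedding_submodule:
  assumes \<sigma>: "embedding P \<sigma>"
  shows "msubmodule translate (\<sigma> ` carrier P)"
proof -
  interpret abelian_group P using left_moduleD(1)[OF embeddingD(1)[OF \<sigma>]] .
  show ?thesis
    unfolding msubmodule_def subgrp_def
  proof (intro conjI ballI)
    show "0 \<in> \<sigma> ` carrier P" using imageI[of "\<zero>\<^bsub>P\<^esub>" "carrier P" \<sigma>] by (simp add: embedding_zero[OF \<sigma>])
    show "u - v \<in> \<sigma> ` carrier P" if u: "u \<in> \<sigma> ` carrier P" and v: "v \<in> \<sigma> ` carrier P" for u v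
    proof -
      obtain x y where "u = \<sigma> x" "x \<in> carrier P" "v = \<sigma> y" "y \<in> carrier P" using u v by blast
      then show ?thesis using imageI[of "x \<ominus>\<^bsub>P\<^esub> y" "carrier P" \<sigma>] by (simp add: embedding_diff[OF \<sigma>])
    qed
    show "translate m u \<in> \<sigma> ` carrier P" if m: "m \<in> carrier M" and u: "u \<in> \<sigma> ` carrier P" for m u
    proof -
      obtain x where "u = \<sigma> x" "x \<in> carrier P" using u by blast
      then show ?thesis
        using imageI[OF left_moduleD(3)[OF embeddingD(1)[OF \<sigma>] delta_closed[OF m]], of x \<sigma>]
        by (simp add: embedding_delta[OF \<sigma> m])
    qed
  qed
qed

definition fin_supp :: "'p set \<Rightarrow> ('p \<Rightarrow> int) set" where
  "fin_supp S = {g. finite {p. g p \<noteq> 0} \<and> {p. g p \<noteq> 0} \<subseteq> S}"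

lemma subgrp_fin_supp: "subgrp (fin_supp S)"
  unfolding subgrp_def
proof (intro conjI ballI)
  fix u v assume *: "u \<in> fin_supp S" "v \<in> fin_supp S"
  have sub: "{p. (u - v) p \<noteq> 0} \<subseteq> {p. u p \<noteq> 0} \<union> {p. v p \<noteq> 0}" by auto
  moreover have "finite ({p. u p \<noteq> 0} \<union> {p. v p \<noteq> 0})" using * by (simp add: fin_supp_def)
  ultimately have "finite {p. (u - v) p \<noteq> 0}" by (rule finite_subset)
  moreover have "{p. (u - v) p \<noteq> 0} \<subseteq> S" using sub * by (auto simp: fin_supp_def)
  ultimately show "u - v \<in> fin_supp S" unfolding fin_supp_def by simp
qed (simp add: fin_supp_def)

text \<open>
  The free module on \<open>S\<close> is \<open>\<int>M \<otimes> \<int>S\<close>, once the coefficients are indexed by \<open>M\<close> first.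
\<close>

lemma transpose_free_module:
  "transpose \<phi> \<in> sections (const_on (carrier M) (fin_supp S)) \<longleftrightarrow> \<phi> \<in> carrier (free_left_module (monoid_ring M) S)"
    (is "?l \<longleftrightarrow> ?r")
proof
  have z: "\<zero>\<^bsub>monoid_ring M\<^esub> = (\<lambda>z. 0)" by (simp add: monoid_ring_def)
  { assume ?r
    then have \<phi>: "finite {x. \<phi> x \<noteq> (\<lambda>z. 0)}" "{x. \<phi> x \<noteq> (\<lambda>z. 0)} \<subseteq> S" "\<And>x. \<phi> x \<in> carrier (monoid_ring M)"
      by (auto simp: free_left_module_def z)
    have "transpose \<phi> m \<in> const_on (carrier M) (fin_supp S) m" for m
    proof (cases "m \<in> carrier M")
      case True
      have sub: "{p. transpose \<phi> m p \<noteq> 0} \<subseteq> {x. \<phi> x \<noteq> (\<lambda>z. 0)}" by (auto simp: transpose_def)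
      then have "finite {p. transpose \<phi> m p \<noteq> 0}" using \<phi>(1) by (rule finite_subset)
      then show ?thesis using True sub \<phi>(2) by (auto simp: const_on_def fin_supp_def)
    next
      case False
      then have "\<phi> p m = 0" for p using monoid_ring_carrierD(2)[OF \<phi>(3)[of p]] by blast
      then show ?thesis using False by (simp add: const_on_def transpose_def fun_eq_iff)
    qed
    then show ?l by (simp add: sections_def) }
  assume ?l
  then have t: "transpose \<phi> m \<in> const_on (carrier M) (fin_supp S) m" for m by (simp add: sections_def)
  have 1: "finite {p. \<phi> p m \<noteq> 0}" "{p. \<phi> p m \<noteq> 0} \<subseteq> S" if "m \<in> carrier M" for m
    using t[of m] that by (auto simp: const_on_def fin_supp_def transpose_def)
  have 2: "\<phi> p m = 0" if "m \<notin> carrier M" for p m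
    using t[of m] that by (simp add: const_on_def transpose_def fun_eq_iff)
  have "{x. \<phi> x \<noteq> (\<lambda>z. 0)} \<subseteq> (\<Union>m\<in>carrier M. {p. \<phi> p m \<noteq> 0})"
    using 2 by (auto simp: fun_eq_iff)
  moreover have "finite (\<Union>m\<in>carrier M. {p. \<phi> p m \<noteq> 0})" using finite_carrier 1 by blast
  moreover have "(\<Union>m\<in>carrier M. {p. \<phi> p m \<noteq> 0}) \<subseteq> S" using 1 by blast
  moreover have "\<phi> p \<in> carrier (monoid_ring M)" for p
    by (rule monoid_ring_carrierI[OF finite_carrier order_refl]) (use 2 in auto)
  ultimately show ?r
    unfolding free_left_module_def z by (auto dest: finite_subset)
qed

text \<open>
  This is the case \<open>e = \<one>\<close> of a principal left ideal.
\<close>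

lemma homology_killed_free:
  fixes S :: "'p set"
  shows "homology_killed translate n 1 (sections (const_on (carrier M) (fin_supp S))) {0}"
proof -
  have lid1: "principal \<one> = carrier M" by (auto simp: principal_def)
  have 0: "sections (\<lambda>l. if l \<in> principal \<one> then {0} else {0}) = ({0} :: ('a \<Rightarrow> 'p \<Rightarrow> int) set)"
    by (auto simp: sections_def)
  have "homology_killed translate n 1 (sections (\<lambda>l. if l \<in> principal \<one> then fin_supp S else {0}))
     (sections (\<lambda>l. if l \<in> principal \<one> then {0} else {0}))"
    by (rule homology_killed_principal[OF subgrp_fin_supp subgrp_zero_set]) (simp add: lid1)
  then show ?thesis unfolding 0 by (simp only: lid1 const_on_def)
qed

text \<open>
  Lifting the identity along the surjection from the free module on \<open>carrier P\<close> makes \<open>P\<close> a retract of that free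
  module. The section of the surjection is the embedding.
\<close>

theorem projective_module_embedding:
  fixes P :: "('a \<Rightarrow> int, 'p) module"
  assumes proj: "projective_module (monoid_ring M) P"
  obtains \<sigma> where "embedding P \<sigma>" "\<And>n. homology_killed translate n 1 (\<sigma> ` carrier P) {0}"
proof -
  let ?R = "monoid_ring M" and ?F = "free_left_module (monoid_ring M) (carrier P)"
  have lP: "left_module ?R P" using proj by (simp add: projective_module_def)
  interpret R: ring ?R by (rule left_moduleD(2)[OF lP])
  interpret P: abelian_group P by (rule left_moduleD(1)[OF lP])
  have lF: "left_module ?R ?F" by (rule left_module_free) unfold_locales
  let ?\<pi> = "free_extend ?R P (\<lambda>x. x)"
  have pi: "?\<pi> \<in> left_module_hom ?R ?F P" by (rule free_extend_hom[OF lP]) simp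
  have pi_surj: "?\<pi> ` carrier ?F = carrier P"
  proof
    show "?\<pi> ` carrier ?F \<subseteq> carrier P" using left_module_homD(1)[OF pi] by blast
    show "carrier P \<subseteq> ?\<pi> ` carrier ?F"
    proof
      fix p assume p: "p \<in> carrier P"
      let ?\<delta> = "\<lambda>x. if x = p then \<one>\<^bsub>?R\<^esub> else \<zero>\<^bsub>?R\<^esub>"
      have s: "{x. ?\<delta> x \<noteq> \<zero>\<^bsub>?R\<^esub>} \<subseteq> {p}" by auto
      have d: "?\<delta> \<in> carrier ?F" using p finite_subset[OF s] by (auto simp: free_left_module_def)
      have "?\<pi> ?\<delta> = finsum P (\<lambda>x. ?\<delta> x \<odot>\<^bsub>P\<^esub> x) {p}"
        by (rule free_extend_eq[OF lP _ d _ _ s]) (use p in auto)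
      also have "\<dots> = p" using p lP by (simp add: left_module_def)
      finally show "p \<in> ?\<pi> ` carrier ?F" using d by force
    qed
  qed
  have "(\<lambda>x. x) \<in> left_module_hom ?R P P" by (simp add: left_module_hom_def hom_def)
  then obtain s where s: "s \<in> left_module_hom ?R P ?F" "\<And>x. x \<in> carrier P \<Longrightarrow> ?\<pi> (s x) = x"
    using projective_module_lift[OF proj lF lP pi pi_surj] by blast
  define \<sigma> where "\<sigma> x = transpose (s x)" for x
  have add: "\<phi> \<oplus>\<^bsub>?F\<^esub> \<psi> = \<phi> + \<psi>" for \<phi> \<psi>
    by (rule ext)+ (simp add: free_left_module_def monoid_ring_def)
  have smult: "transpose (r \<odot>\<^bsub>?F\<^esub> \<phi>) = (\<Sum>m\<in>carrier M. zmul (r m) (translate m (transpose \<phi>)))"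
    if "r \<in> carrier ?R" "\<phi> \<in> carrier ?F" for r \<phi>
  proof (rule ext)+
    fix l p
    have "\<phi> p \<in> carrier ?R" using that(2) by (auto simp: free_left_module_def)
    then show "transpose (r \<odot>\<^bsub>?F\<^esub> \<phi>) l p = (\<Sum>m\<in>carrier M. zmul (r m) (translate m (transpose \<phi>))) l p"
      using monoid_ring_mult[OF that(1), of "\<phi> p" l]
      by (simp add: transpose_def free_left_module_def sum_fun_apply zmul_def translate_apply)
  qed
  have inj: "inj_on \<sigma> (carrier P)"
    by (rule inj_on_inverseI[of _ "\<lambda>u. ?\<pi> (transpose u)"]) (simp add: \<sigma>_def s(2))
  have \<sigma>: "embedding P \<sigma>"
    unfolding embedding_def
  proof (intro conjI ballI lP inj)
    show "\<sigma> (x \<oplus>\<^bsub>P\<^esub> y) = \<sigma> x + \<sigma> y" if "x \<in> carrier P" "y \<in> carrier P" for x y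
      by (rule ext)+ (simp add: \<sigma>_def left_module_homD(2)[OF s(1) that] add transpose_def)
    show "\<sigma> (r \<odot>\<^bsub>P\<^esub> x) = (\<Sum>m\<in>carrier M. zmul (r m) (translate m (\<sigma> x)))"
      if "r \<in> carrier ?R" "x \<in> carrier P" for r x
      unfolding \<sigma>_def left_module_homD(3)[OF s(1) that]
      by (rule smult[OF that(1) left_module_homD(1)[OF s(1) that(2)]])
  qed
  let ?V = "sections (const_on (carrier M) (fin_supp (carrier P))) :: ('a \<Rightarrow> 'p \<Rightarrow> int) set"
  let ?r = "\<lambda>u. \<sigma> (?\<pi> (transpose u))"
  have V: "u \<in> ?V \<longleftrightarrow> transpose u \<in> carrier ?F" for u
    using transpose_free_module[of "transpose u" "carrier P"] by simp
  have sub_V: "msubmodule translate ?V"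
    by (intro msubmodule_sections stable_const_on subgrp_fin_supp) (auto simp: left_ideal_def)
  have sub_W: "msubmodule translate (\<sigma> ` carrier P)" by (rule embedding_submodule[OF \<sigma>])
  have pc: "?\<pi> (transpose u) \<in> carrier P" if "u \<in> ?V" for u
    using left_module_homD(1)[OF pi] that V by blast
  have "homology_killed translate n 1 (\<sigma> ` carrier P) {0}" for n
  proof (rule homology_killed_retract[OF action_translate sub_V sub_W, of ?r])
    show "\<sigma> ` carrier P \<subseteq> ?V"
      using left_module_homD(1)[OF s(1)] by (auto simp: V \<sigma>_def)
    have "additive_on ?V ?r"
    proof (rule additive_onI[OF msubmodule_subgrp(2)[OF sub_V]])
      fix u v assume uv: "u \<in> ?V" "v \<in> ?V"
      have "transpose (u + v) = transpose u \<oplus>\<^bsub>?F\<^esub> transpose v"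
        unfolding add by (rule ext)+ (simp add: transpose_def)
      then show "?r (u + v) = ?r u + ?r v"
        using uv V pc by (simp add: left_module_homD(2)[OF pi] embeddingD(3)[OF \<sigma>])
    qed
    moreover have "?r (translate m u) = translate m (?r u)" if m: "m \<in> carrier M" and u: "u \<in> ?V" for m u
    proof -
      have "transpose (delta m \<odot>\<^bsub>?F\<^esub> transpose u) = translate m u"
        unfolding smult[OF delta_closed[OF m] V[THEN iffD1, OF u]]
        by (rule ext)+ (simp add: sum_fun_apply zmul_def sum_delta_mult m)
      then have "transpose (translate m u) = delta m \<odot>\<^bsub>?F\<^esub> transpose u" by (metis transpose_transpose)
      then have "?r (translate m u) = \<sigma> (delta m \<odot>\<^bsub>P\<^esub> ?\<pi> (transpose u))"
        using left_module_homD(3)[OF pi delta_closed[OF m]] u V by simp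
      then show ?thesis using embedding_delta[OF \<sigma> m pc[OF u]] by simp
    qed
    ultimately show "equivariant_on translate translate ?V ?r" by (simp add: equivariant_on_def)
    show "?r u \<in> \<sigma> ` carrier P" if "u \<in> ?V" for u using pc[OF that] by blast
    show "?r u = u" if "u \<in> \<sigma> ` carrier P" for u
      using that s(2) by (auto simp: \<sigma>_def)
    show "homology_killed translate n 1 ?V {0}" by (rule homology_killed_free)
  qed
  then show ?thesis using that \<sigma> by blast
qed

end

section \<open>Tensor products, coinvariants and Tor\<close>

lemma trivial_carrier: "carrier trivial_module = UNIV"
  by (simp add: trivial_module_def)

lemma tensor_relations_diff:
  fixes P :: "('r, 'p) module"
  assumes "left_module R P" "right_module R A" "x \<in> tensor_relations R A P" "y \<in> tensor_relations R A P"
  shows "x - y \<in> tensor_relations R A P"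
proof -
  interpret subgroup "tensor_relations R A P" "free_Abelian_group (carrier A \<times> carrier P)"
    by (rule subgroup_tensor_relations[OF assms(1,2)])
  have "- y \<in> tensor_relations R A P"
    using m_inv_closed[OF assms(4)] mem_carrier[OF assms(4)] by simp
  then show ?thesis using m_closed[OF assms(3)] by fastforce
qed

lemma tensor_relations_subgrp:
  fixes P :: "('r, 'p) module"
  assumes "left_module R P" "right_module R A"
  shows "subgrp (tensor_relations R A P)"
proof -
  interpret subgroup "tensor_relations R A P" "free_Abelian_group (carrier A \<times> carrier P)"
    by (rule subgroup_tensor_relations[OF assms(1,2)])
  show ?thesis using one_closed tensor_relations_diff[OF assms] by (simp add: subgrp_def)
qed

context finite_monoid begin

text \<open>
  The map from the free abelian group on pairs \<open>(a, p)\<close> to the embedded module with \<open>(a, p) \<mapsto> a p\<close>. Modulo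
  the augmentation it is the isomorphism from \<open>\<int> \<otimes> P\<close> to the coinvariants of \<open>P\<close>.
\<close>

definition tensor_eval :: "('p \<Rightarrow> 'a \<Rightarrow> 'p \<Rightarrow> int) \<Rightarrow> (int \<times> 'p \<Rightarrow>\<^sub>0 int) \<Rightarrow> 'a \<Rightarrow> 'p \<Rightarrow> int" where
  "tensor_eval \<sigma> x = (\<Sum>k\<in>Poly_Mapping.keys x. zmul (Poly_Mapping.lookup x k * fst k) (\<sigma> (snd k)))"

lemma tensor_eval_superset:
  assumes "finite S" "Poly_Mapping.keys x \<subseteq> S"
  shows "tensor_eval \<sigma> x = (\<Sum>k\<in>S. zmul (Poly_Mapping.lookup x k * fst k) (\<sigma> (snd k)))"
  unfolding tensor_eval_def
  by (rule sum.mono_neutral_left) (use assms in \<open>auto simp: zmul_def fun_eq_iff in_keys_iff\<close>)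

lemma tensor_eval_diff: "tensor_eval \<sigma> (x - y) = tensor_eval \<sigma> x - tensor_eval \<sigma> y"
proof -
  let ?S = "Poly_Mapping.keys x \<union> Poly_Mapping.keys y"
  have "tensor_eval \<sigma> (x - y) = (\<Sum>k\<in>?S. zmul (Poly_Mapping.lookup (x - y) k * fst k) (\<sigma> (snd k)))"
    by (rule tensor_eval_superset) (use keys_diff[of x y] in auto)
  also have "\<dots> = (\<Sum>k\<in>?S. zmul (Poly_Mapping.lookup x k * fst k) (\<sigma> (snd k)) -
      zmul (Poly_Mapping.lookup y k * fst k) (\<sigma> (snd k)))"
    by (intro sum.cong refl ext) (simp add: lookup_minus zmul_def algebra_simps)
  also have "\<dots> = tensor_eval \<sigma> x - tensor_eval \<sigma> y"
    by (simp add: sum_subtractf tensor_eval_superset[of ?S x] tensor_eval_superset[of ?S y])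
  finally show ?thesis .
qed

lemma tensor_eval_frag_of: "tensor_eval \<sigma> (frag_of (a, p)) = zmul a (\<sigma> p)"
  by (simp add: tensor_eval_def)

lemma tensor_eval_0: "tensor_eval \<sigma> 0 = 0"
  by (simp add: tensor_eval_def)

lemma subgrp_augmentation:
  assumes "action act" "msubmodule act V"
  shows "subgrp (augmentation act V)"
  unfolding subgrp_def
proof (intro conjI ballI)
  have sg: "subgrp (bar_chains 1 V)" by (rule msubmodule_subgrp(1)[OF assms(2)])
  show "0 \<in> augmentation act V"
    unfolding augmentation_coinv_d using imageI[OF subgrp_0[OF sg], of "\<lambda>y. coinv_d act y []"]
    by (simp add: additive_on_0[OF coinv_d_additive[OF assms(1)]])
  fix u v assume "u \<in> augmentation act V" "v \<in> augmentation act V"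
  then obtain y z where "u = coinv_d act y []" "v = coinv_d act z []" "y \<in> bar_chains 1 V" "z \<in> bar_chains 1 V"
    unfolding augmentation_coinv_d by blast
  then show "u - v \<in> augmentation act V"
    unfolding augmentation_coinv_d using imageI[OF subgrp_diff[OF sg], of y z "\<lambda>y. coinv_d act y []"]
    by (simp add: coinv_d_diff[OF assms(1)])
qed

lemma translate_zmul: "translate m (zmul i u) = zmul i (translate m u)"
  by (rule ext)+ (simp add: translate_def zmul_def sum_fun_apply sum_distrib_left)

lemma trivial_smult:
  assumes "r \<in> carrier (monoid_ring M)"
  shows "r \<odot>\<^bsub>trivial_module\<^esub> k = (\<Sum>m\<in>carrier M. r m) * k"
proof -
  have "(\<Sum>m\<in>{m. r m \<noteq> 0}. r m) = (\<Sum>m\<in>carrier M. r m)"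
    by (rule sum.mono_neutral_left) (use finite_carrier monoid_ring_carrierD(2)[OF assms] in auto)
  then show ?thesis by (simp add: trivial_module_def)
qed

text \<open>
  The balancing relation: \<open>r\<close> acts on \<open>\<int>\<close> by its coefficient sum, and \<open>\<Sum> r\<^sub>m x - \<Sum> r\<^sub>m (m x)\<close> is in the
  augmentation.
\<close>

lemma smult_augmentation:
  assumes \<sigma>: "embedding P \<sigma>" and r: "r \<in> carrier (monoid_ring M)" and x: "x \<in> carrier P"
  shows "zmul (r \<odot>\<^bsub>trivial_module\<^esub> a) (\<sigma> x) - zmul a (\<sigma> (r \<odot>\<^bsub>P\<^esub> x)) \<in> augmentation translate (\<sigma> ` carrier P)"
proof -
  define f where "f m = zmul (r m * a) (\<sigma> x)" for m
  have "zmul (r \<odot>\<^bsub>trivial_module\<^esub> a) (\<sigma> x) - zmul a (\<sigma> (r \<odot>\<^bsub>P\<^esub> x)) = (\<Sum>m\<in>carrier M. f m - translate m (f m))"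
    unfolding f_def translate_zmul trivial_smult[OF r] embeddingD(4)[OF \<sigma> r x]
    by (rule ext)+ (simp add: zmul_def sum_fun_apply sum_distrib_left sum_distrib_right sum_subtractf mult_ac)
  moreover have "f m \<in> \<sigma> ` carrier P" for m
    unfolding f_def by (intro subgrp_zmul msubmodule_subgrp(2)[OF embedding_submodule[OF \<sigma>]] imageI x)
  ultimately show ?thesis unfolding augmentation_def by blast
qed

abbreviation T where "T P \<equiv> tensor_relations (monoid_ring M) trivial_module P"
abbreviation Fr where "Fr P \<equiv> free_Abelian_group ((UNIV :: int set) \<times> carrier P)"

lemma T_subgrp: "left_module (monoid_ring M) P \<Longrightarrow> subgrp (T P)"
  by (rule tensor_relations_subgrp[OF _ trivial_module_is_module(2)[OF monoid_axioms]])

lemma zmul_add: "zmul (a + b) u = zmul a u + zmul b u" "zmul a (u + v) = zmul a u + zmul a v"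
  by (rule ext, rule ext, simp add: zmul_def algebra_simps)+

lemma tensor_eval_relations:
  assumes \<sigma>: "embedding P \<sigma>" and x: "x \<in> T P"
  shows "tensor_eval \<sigma> x \<in> augmentation translate (\<sigma> ` carrier P)"
proof -
  let ?A = "augmentation translate (\<sigma> ` carrier P)"
  have A: "subgrp ?A" by (rule subgrp_augmentation[OF action_translate embedding_submodule[OF \<sigma>]])
  have rel: "tensor_eval \<sigma> h \<in> ?A" if "h \<in> tensor_relators (monoid_ring M) trivial_module P" for h
    using that unfolding tensor_relators_def
  proof (elim UnE CollectE exE conjE)
    fix a a' :: int and p assume h: "h = frag_of (a \<oplus>\<^bsub>trivial_module\<^esub> a', p) - frag_of (a, p) - frag_of (a', p)"
    have "tensor_eval \<sigma> h = 0" unfolding h tensor_eval_diff tensor_eval_frag_of by (simp add: trivial_module_def zmul_add)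
    then show ?thesis using subgrp_0[OF A] by simp
  next
    fix a :: int and p p' assume h: "h = frag_of (a, p \<oplus>\<^bsub>P\<^esub> p') - frag_of (a, p) - frag_of (a, p')"
      and p: "p \<in> carrier P" "p' \<in> carrier P"
    have "tensor_eval \<sigma> h = 0" unfolding h tensor_eval_diff tensor_eval_frag_of embeddingD(3)[OF \<sigma> p] by (simp add: zmul_add)
    then show ?thesis using subgrp_0[OF A] by simp
  next
    fix r and a :: int and p assume h: "h = frag_of (r \<odot>\<^bsub>trivial_module\<^esub> a, p) - frag_of (a, r \<odot>\<^bsub>P\<^esub> p)"
      and p: "r \<in> carrier (monoid_ring M)" "p \<in> carrier P"
    show ?thesis unfolding h tensor_eval_diff tensor_eval_frag_of by (rule smult_augmentation[OF \<sigma> p])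
  qed
  have rels: "tensor_relators (monoid_ring M) trivial_module P \<subseteq> carrier (Fr P)"
    using tensor_relators_closed[OF embeddingD(1)[OF \<sigma>] trivial_module_is_module(2)[OF monoid_axioms]]
    by (simp only: trivial_carrier)
  from x show ?thesis
    unfolding tensor_relations_def trivial_carrier
  proof (induction rule: generate.induct)
    case one
    have "\<one>\<^bsub>Fr P\<^esub> = 0" by simp
    then show ?case using subgrp_0[OF A] by (simp only: tensor_eval_0)
  next
    case (incl h) then show ?case by (rule rel)
  next
    case (inv h)
    have "inv\<^bsub>Fr P\<^esub> h = 0 - h" using subsetD[OF rels inv] by simp
    moreover have "tensor_eval \<sigma> (0 - h) \<in> ?A"
      unfolding tensor_eval_diff tensor_eval_0 using subgrp_diff[OF A subgrp_0[OF A] rel[OF inv]] .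
    ultimately show ?case by (simp only:)
  next
    case (eng h1 h2)
    have eq: "tensor_eval \<sigma> (h1 + h2) = tensor_eval \<sigma> h1 + tensor_eval \<sigma> h2" using tensor_eval_diff[of \<sigma> "h1 + h2" h2] by simp
    have "h1 \<otimes>\<^bsub>Fr P\<^esub> h2 = h1 + h2" by simp
    moreover have "tensor_eval \<sigma> (h1 + h2) \<in> ?A" unfolding eq by (rule subgrp_add[OF A eng.IH])
    ultimately show ?case by (simp only:)
  qed
qed

lemma relatorI:
  assumes "left_module (monoid_ring M) P"
  shows "p \<in> carrier P \<Longrightarrow> p' \<in> carrier P \<Longrightarrow>
      frag_of (a, p \<oplus>\<^bsub>P\<^esub> p') - frag_of (a, p) - frag_of (a, p') \<in> T P"
    "r \<in> carrier (monoid_ring M) \<Longrightarrow> p \<in> carrier P \<Longrightarrow>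
      frag_of (r \<odot>\<^bsub>trivial_module\<^esub> a, p) - frag_of (a, r \<odot>\<^bsub>P\<^esub> p) \<in> T P"
  unfolding tensor_relations_def
   apply (rule generate.incl)
   apply (unfold tensor_relators_def trivial_carrier)
   apply (rule UnI1, rule UnI2, rule CollectI, intro exI conjI, rule refl; simp)
  apply (rule generate.incl, rule UnI2, rule CollectI, intro exI conjI, rule refl; simp)
  done

lemma frag_diff_relation:
  assumes P: "left_module (monoid_ring M) P" and p: "p \<in> carrier P" "q \<in> carrier P"
  shows "frag_of (a, p \<ominus>\<^bsub>P\<^esub> q) - (frag_of (a, p) - frag_of (a, q)) \<in> T P"
proof -
  interpret abelian_group P by (rule left_moduleD(1)[OF P])
  have "(p \<ominus>\<^bsub>P\<^esub> q) \<oplus>\<^bsub>P\<^esub> q = p" using p by (simp add: minus_eq a_assoc l_neg)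
  then have "frag_of (a, p) - frag_of (a, p \<ominus>\<^bsub>P\<^esub> q) - frag_of (a, q) \<in> T P"
    using relatorI(1)[OF P, of "p \<ominus>\<^bsub>P\<^esub> q" q a] p by simp
  then have "- (frag_of (a, p) - frag_of (a, p \<ominus>\<^bsub>P\<^esub> q) - frag_of (a, q)) \<in> T P"
    by (rule subgrp_minus[OF T_subgrp[OF P]])
  then show ?thesis by (simp add: algebra_simps)
qed

lemma frag_zero_relation:
  assumes P: "left_module (monoid_ring M) P"
  shows "frag_of (a, \<zero>\<^bsub>P\<^esub>) \<in> T P"
proof -
  interpret abelian_group P by (rule left_moduleD(1)[OF P])
  have "- frag_of (a, \<zero>\<^bsub>P\<^esub>) \<in> T P"
    using relatorI(1)[OF P, of "\<zero>\<^bsub>P\<^esub>" "\<zero>\<^bsub>P\<^esub>" a] by simp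
  then show ?thesis using subgrp_minus[OF T_subgrp[OF P]] by fastforce
qed

text \<open>
  A pair \<open>(a, p)\<close> is equivalent to \<open>(1, a p)\<close>, by balancing with the multiple \<open>a\<close> of the unit of the ring.
\<close>

lemma tensor_representative:
  assumes P: "left_module (monoid_ring M) P" and x: "x \<in> carrier (Fr P)"
  shows "\<exists>p\<in>carrier P. x - frag_of (1, p) \<in> T P"
proof -
  interpret abelian_group P by (rule left_moduleD(1)[OF P])
  note sg = T_subgrp[OF P]
  have "Poly_Mapping.keys x \<subseteq> UNIV \<times> carrier P" using x by (simp add: trivial_carrier)
  then show ?thesis
  proof (induction rule: frag_induction)
    case zero
    show ?case
      using subgrp_minus[OF sg frag_zero_relation[OF P, of 1]] by (intro bexI[of _ "\<zero>\<^bsub>P\<^esub>"]) simp_all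
  next
    case (one x)
    then obtain a p where x: "x = (a, p)" "p \<in> carrier P" by auto
    define r where "r = (\<lambda>m. a * delta \<one> m)"
    have r: "r \<in> carrier (monoid_ring M)"
      by (rule monoid_ring_carrierI[of "{\<one>}"]) (auto simp: r_def delta_def)
    have "(\<Sum>m\<in>carrier M. r m) = a"
      using sum_delta_mult[of \<one> "\<lambda>m. a"] by (simp add: r_def mult.commute)
    then have "r \<odot>\<^bsub>trivial_module\<^esub> 1 = a" by (simp add: trivial_smult[OF r])
    then have "frag_of (a, p) - frag_of (1, r \<odot>\<^bsub>P\<^esub> p) \<in> T P"
      using relatorI(2)[OF P r x(2), of 1] by simp
    then show ?case using left_moduleD(3)[OF P r x(2)] x(1) by blast
  next
    case (diff u v)
    then obtain p q where pq: "p \<in> carrier P" "q \<in> carrier P"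
      "u - frag_of (1, p) \<in> T P" "v - frag_of (1, q) \<in> T P" by blast
    have "u - v - frag_of (1, p \<ominus>\<^bsub>P\<^esub> q) = (u - frag_of (1, p)) - (v - frag_of (1, q)) -
       (frag_of (1, p \<ominus>\<^bsub>P\<^esub> q) - (frag_of (1, p) - frag_of (1, q)))" by simp
    also have "\<dots> \<in> T P" by (intro subgrp_diff sg pq frag_diff_relation[OF P])
    finally show ?case using pq by (intro bexI[of _ "p \<ominus>\<^bsub>P\<^esub> q"]) simp_all
  qed
qed

text \<open>
  Balancing with \<open>delta m\<close>, which acts as the identity on \<open>\<int>\<close>, makes \<open>(1, x)\<close> equivalent to \<open>(1, m x)\<close>.
\<close>

lemma augmentation_relation:
  assumes \<sigma>: "embedding P \<sigma>" and p: "p \<in> carrier P" "\<sigma> p \<in> augmentation translate (\<sigma> ` carrier P)"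
  shows "frag_of (1, p) \<in> T P"
proof -
  have P: "left_module (monoid_ring M) P" by (rule embeddingD(1)[OF \<sigma>])
  interpret abelian_group P by (rule left_moduleD(1)[OF P])
  note sg = T_subgrp[OF P]
  obtain f where f: "\<sigma> p = (\<Sum>m\<in>carrier M. f m - translate m (f m))" "\<forall>m\<in>carrier M. f m \<in> \<sigma> ` carrier P"
    using p(2) unfolding augmentation_def by blast
  have "\<exists>q\<in>carrier P. \<sigma> q = (\<Sum>m\<in>S. f m - translate m (f m)) \<and> frag_of (1, q) \<in> T P"
    if "finite S" "S \<subseteq> carrier M" for S
    using that
  proof (induction S rule: finite_induct)
    case empty
    then show ?case
      using frag_zero_relation[OF P] embedding_zero[OF \<sigma>] by (intro bexI[of _ "\<zero>\<^bsub>P\<^esub>"]) simp_all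
  next
    case (insert m S)
    then obtain q where q: "q \<in> carrier P" "\<sigma> q = (\<Sum>m\<in>S. f m - translate m (f m))" "frag_of (1, q) \<in> T P" by blast
    have m: "m \<in> carrier M" using insert by simp
    then obtain x where x: "x \<in> carrier P" "f m = \<sigma> x" using f(2) by blast
    define y where "y = delta m \<odot>\<^bsub>P\<^esub> x"
    have y: "y \<in> carrier P" unfolding y_def by (rule left_moduleD(3)[OF P delta_closed[OF m] x(1)])
    have "(\<Sum>k\<in>carrier M. delta m k) = 1" using sum_delta_mult[OF m, of "\<lambda>k. 1"] by simp
    then have "frag_of (1, x) - frag_of (1, y) \<in> T P"
      using relatorI(2)[OF P delta_closed[OF m] x(1), of 1] by (simp add: trivial_smult[OF delta_closed[OF m]] y_def)
    from subgrp_add[OF sg frag_diff_relation[OF P x(1) y, of 1] this]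
    have xy: "frag_of (1, x \<ominus>\<^bsub>P\<^esub> y) \<in> T P" by simp
    have xyc: "x \<ominus>\<^bsub>P\<^esub> y \<in> carrier P" using x y by simp
    have "\<sigma> ((x \<ominus>\<^bsub>P\<^esub> y) \<oplus>\<^bsub>P\<^esub> q) = (\<Sum>m\<in>insert m S. f m - translate m (f m))"
      unfolding sum.insert[OF insert.hyps] embeddingD(3)[OF \<sigma> xyc q(1)] embedding_diff[OF \<sigma> x(1) y]
      by (simp only: y_def embedding_delta[OF \<sigma> m x(1)] x(2) q(2))
    moreover have "frag_of (1, (x \<ominus>\<^bsub>P\<^esub> y) \<oplus>\<^bsub>P\<^esub> q) \<in> T P"
      using subgrp_add[OF sg subgrp_add[OF sg relatorI(1)[OF P xyc q(1), of 1] xy] q(3)] by simp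
    moreover have "(x \<ominus>\<^bsub>P\<^esub> y) \<oplus>\<^bsub>P\<^esub> q \<in> carrier P" using xyc q(1) by simp
    ultimately show ?case by blast
  qed
  from this[OF finite_carrier order_refl] obtain q where q: "q \<in> carrier P" "\<sigma> q = \<sigma> p" "frag_of (1, q) \<in> T P"
    unfolding f(1)[symmetric] by blast
  then have "q = p" using inj_onD[OF embeddingD(2)[OF \<sigma>]] p(1) by blast
  then show ?thesis using q(3) by simp
qed


definition tensor_class :: "('a \<Rightarrow> int, 'p) module \<Rightarrow> (int \<times> 'p \<Rightarrow>\<^sub>0 int) \<Rightarrow> (int \<times> 'p \<Rightarrow>\<^sub>0 int) set" where
  "tensor_class P x = T P #>\<^bsub>Fr P\<^esub> x"

abbreviation TP where "TP P \<equiv> tensor_product (monoid_ring M) trivial_module P"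

lemma tensor_class_eq_iff:
  assumes P: "left_module (monoid_ring M) P"
  shows "tensor_class P x = tensor_class P y \<longleftrightarrow> x - y \<in> T P"
proof -
  note sg = T_subgrp[OF P]
  have tensor_class: "tensor_class P z = (\<lambda>t. t + z) ` T P" for z
    by (auto simp: tensor_class_def r_coset_def)
  show ?thesis
  proof
    assume "tensor_class P x = tensor_class P y"
    moreover have "x \<in> tensor_class P x" using imageI[OF subgrp_0[OF sg], of "\<lambda>t. t + x"] by (simp add: tensor_class)
    ultimately obtain t where "t \<in> T P" "x = t + y" unfolding tensor_class by auto
    then show "x - y \<in> T P" by simp
  next
    have *: "tensor_class P x \<subseteq> tensor_class P y" if "x - y \<in> T P" for x y
    proof
      fix z assume "z \<in> tensor_class P x"
      then obtain t where "t \<in> T P" "z = t + x" unfolding tensor_class by auto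
      then have "t + (x - y) \<in> T P" "z = (t + (x - y)) + y" using subgrp_add[OF sg] that by auto
      then show "z \<in> tensor_class P y" unfolding tensor_class by blast
    qed
    assume xy: "x - y \<in> T P"
    then have "y - x \<in> T P" using subgrp_minus[OF sg] by fastforce
    then show "tensor_class P x = tensor_class P y" using * xy by blast
  qed
qed

lemma TP_facts:
  assumes P: "left_module (monoid_ring M) P"
  shows "group (TP P)" "carrier (TP P) = tensor_class P ` carrier (Fr P)" "\<one>\<^bsub>TP P\<^esub> = tensor_class P 0"
    "x \<in> carrier (Fr P) \<Longrightarrow> y \<in> carrier (Fr P) \<Longrightarrow> tensor_class P x \<otimes>\<^bsub>TP P\<^esub> tensor_class P y = tensor_class P (x + y)"
proof -
  have sub: "subgroup (T P) (Fr P)"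
    using subgroup_tensor_relations[OF P trivial_module_is_module(2)[OF monoid_axioms]]
    by (simp only: trivial_carrier)
  interpret F: comm_group "Fr P" by (rule abelian_free_Abelian_group)
  interpret N: normal "T P" "Fr P" by (rule F.subgroup_imp_normal[OF sub])
  have TP: "TP P = Fr P Mod T P" by (simp only: tensor_product_def trivial_carrier)
  show "group (TP P)" unfolding TP by (rule N.factorgroup_is_group)
  show "carrier (TP P) = tensor_class P ` carrier (Fr P)"
    unfolding TP by (auto simp: FactGroup_def RCOSETS_def tensor_class_def)
  show "\<one>\<^bsub>TP P\<^esub> = tensor_class P 0"
    unfolding TP by (auto simp: FactGroup_def tensor_class_def r_coset_def)
  show "tensor_class P x \<otimes>\<^bsub>TP P\<^esub> tensor_class P y = tensor_class P (x + y)" if "x \<in> carrier (Fr P)" "y \<in> carrier (Fr P)"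
    unfolding TP using N.rcos_sum[OF that] by (simp add: FactGroup_def tensor_class_def)
qed

lemma tensor_map_class:
  assumes "left_module (monoid_ring M) P" "left_module (monoid_ring M) Q"
    "f \<in> left_module_hom (monoid_ring M) P Q" "x \<in> carrier (Fr P)"
  shows "tensor_map (monoid_ring M) trivial_module Q f (tensor_class P x) =
    tensor_class Q (frag_extend (\<lambda>(a, p). frag_of (a, f p)) x)"
  using tensor_map_coset[OF assms(1,2) trivial_module_is_module(2)[OF monoid_axioms] assms(3), of x] assms(4)
  by (simp only: tensor_class_def trivial_carrier)

lemma frag_of_closed: "p \<in> carrier P \<Longrightarrow> frag_of (a, p) \<in> carrier (Fr P)"
  by simp

lemma tensor_class_representative:
  assumes P: "left_module (monoid_ring M) P" and c: "c \<in> carrier (TP P)"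
  obtains p where "p \<in> carrier P" "c = tensor_class P (frag_of (1, p))"
proof -
  obtain x where x: "x \<in> carrier (Fr P)" "c = tensor_class P x" using c unfolding TP_facts(2)[OF P] by blast
  obtain p where "p \<in> carrier P" "x - frag_of (1, p) \<in> T P" using tensor_representative[OF P x(1)] by blast
  then show ?thesis using that x(2) tensor_class_eq_iff[OF P, of x "frag_of (1, p)"] by blast
qed

lemma frag_extend_closed:
  assumes "left_module (monoid_ring M) P" "left_module (monoid_ring M) Q"
    "f \<in> left_module_hom (monoid_ring M) P Q" "x \<in> carrier (Fr P)"
  shows "frag_extend (\<lambda>(a, p). frag_of (a, f p)) x \<in> carrier (Fr Q)"
proof -
  have "Poly_Mapping.keys (frag_extend (\<lambda>(a, p). frag_of (a, f p)) x) \<subseteq>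
      (\<Union>k\<in>Poly_Mapping.keys x. Poly_Mapping.keys ((\<lambda>(a, p). frag_of (a, f p)) k))"
    by (rule keys_frag_extend)
  also have "\<dots> \<subseteq> UNIV \<times> carrier Q"
    using assms(4) left_module_homD(1)[OF assms(3)] by (auto simp: split_beta)
  finally show ?thesis by simp
qed

lemma boundaries_subgroup:
  assumes P: "left_module (monoid_ring M) P" and Q: "left_module (monoid_ring M) Q"
    and f: "f \<in> left_module_hom (monoid_ring M) P Q"
  shows "subgroup (tensor_map (monoid_ring M) trivial_module Q f ` carrier (TP P)) (TP Q)"
proof -
  let ?t = "tensor_map (monoid_ring M) trivial_module Q f"
  let ?F = "frag_extend (\<lambda>(a, p). frag_of (a, f p))"
  note FP = frag_extend_closed[OF P Q f]
  have "?t \<in> hom (TP P) (TP Q)"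
  proof (rule homI)
    fix c assume "c \<in> carrier (TP P)"
    then obtain x where x: "x \<in> carrier (Fr P)" "c = tensor_class P x" unfolding TP_facts(2)[OF P] by blast
    then show "?t c \<in> carrier (TP Q)"
      unfolding TP_facts(2)[OF Q] x(2) tensor_map_class[OF P Q f x(1)] by (intro imageI FP)
    fix c' assume "c' \<in> carrier (TP P)"
    then obtain y where y: "y \<in> carrier (Fr P)" "c' = tensor_class P y" unfolding TP_facts(2)[OF P] by blast
    have xy: "x + y \<in> carrier (Fr P)"
      using group.is_monoid[OF group_free_Abelian_group] monoid.m_closed[of "Fr P" x y] x(1) y(1) by fastforce
    show "?t (c \<otimes>\<^bsub>TP P\<^esub> c') = ?t c \<otimes>\<^bsub>TP Q\<^esub> ?t c'"
      unfolding x(2) y(2) TP_facts(4)[OF P x(1) y(1)] tensor_map_class[OF P Q f x(1)]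
        tensor_map_class[OF P Q f y(1)] tensor_map_class[OF P Q f xy] TP_facts(4)[OF Q FP[OF x(1)] FP[OF y(1)]]
        frag_extend_add ..
  qed
  then have "group_hom (TP P) (TP Q) ?t"
    using TP_facts(1)[OF P] TP_facts(1)[OF Q] by (simp add: group_hom_def group_hom_axioms_def)
  then show ?thesis by (rule group_hom.img_is_subgroup)
qed

text \<open>
  The embeddings of the modules \<open>P j\<close> turn the resolution into one by function modules. Finitely many
  elements \<open>s\<close> then represent all cycles of the coinvariants up to boundaries, and the cosets of
  \<open>1 \<otimes> s\<close> exhaust \<open>Tor\<close>.
\<close>

theorem tor_finite:
  assumes fin: "homology_finite (\<lambda>x v. v) n (UNIV :: int set)"
    and res: "projective_resolution (monoid_ring M) trivial_module P d e"
  shows "finite (carrier (Tor (monoid_ring M) trivial_module P d (Suc n)))"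
proof -
  let ?R = "monoid_ring M" and ?t = "\<lambda>j. tensor_map (monoid_ring M) trivial_module (P j) (d j)"
  have proj: "projective_module ?R (P j)" and d: "d j \<in> left_module_hom ?R (P (Suc j)) (P j)" for j
    using res by (auto simp: projective_resolution_def)
  have e: "e \<in> left_module_hom ?R (P 0) trivial_module" "e ` carrier (P 0) = UNIV"
    using res by (auto simp: projective_resolution_def trivial_carrier)
  have "\<exists>\<sigma>. embedding (P j) \<sigma> \<and> (\<forall>n. homology_killed translate n 1 (\<sigma> ` carrier (P j)) {0})" for j
    using projective_module_embedding[OF proj] by metis
  then obtain \<sigma> where \<sigma>: "\<And>j. embedding (P j) (\<sigma> j)"
      "\<And>j n. homology_killed translate n 1 (\<sigma> j ` carrier (P j)) {0}" by metis
  have P: "left_module ?R (P j)" for j by (rule embeddingD(1)[OF \<sigma>(1)])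
  note inj = embeddingD(2)[OF \<sigma>(1)]
  define V where "V j = \<sigma> j ` carrier (P j)" for j
  \<comment> \<open>The resolution is moved to the images of the embeddings.\<close>
  define D where "D j u = \<sigma> j (d j (inv_into (carrier (P (Suc j))) (\<sigma> (Suc j)) u))" for j u
  define \<epsilon> where "\<epsilon> u = e (inv_into (carrier (P 0)) (\<sigma> 0) u)" for u
  have D: "D j (\<sigma> (Suc j) x) = \<sigma> j (d j x)" if "x \<in> carrier (P (Suc j))" for j x
    using that by (simp add: D_def inv_into_f_f[OF inj])
  have \<epsilon>: "\<epsilon> (\<sigma> 0 x) = e x" if "x \<in> carrier (P 0)" for x
    using that by (simp add: \<epsilon>_def inv_into_f_f[OF inj])
  have sub: "msubmodule translate (V j)" for j unfolding V_def by (rule embedding_submodule[OF \<sigma>(1)])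
  note dc = left_module_homD(1)[OF d]
  have D_eq: "equivariant_on translate translate (V (Suc j)) (D j)" for j
  proof -
    interpret abelian_group "P (Suc j)" by (rule left_moduleD(1)[OF P])
    have "additive_on (V (Suc j)) (D j)"
    proof (rule additive_onI[OF msubmodule_subgrp(2)[OF sub]])
      fix u v assume "u \<in> V (Suc j)" "v \<in> V (Suc j)"
      then obtain x y where xy: "u = \<sigma> (Suc j) x" "v = \<sigma> (Suc j) y"
          "x \<in> carrier (P (Suc j))" "y \<in> carrier (P (Suc j))" unfolding V_def by blast
      have "D j (u + v) = \<sigma> j (d j (x \<oplus>\<^bsub>P (Suc j)\<^esub> y))"
        unfolding xy embeddingD(3)[OF \<sigma>(1) xy(3,4), symmetric] by (rule D) (simp add: xy)
      then show "D j (u + v) = D j u + D j v"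
        unfolding xy D[OF xy(3)] D[OF xy(4)] left_module_homD(2)[OF d xy(3,4)]
          embeddingD(3)[OF \<sigma>(1) dc[OF xy(3)] dc[OF xy(4)]] .
    qed
    moreover have "D j (translate m u) = translate m (D j u)" if m: "m \<in> carrier M" and u: "u \<in> V (Suc j)" for m u
    proof -
      obtain x where x: "u = \<sigma> (Suc j) x" "x \<in> carrier (P (Suc j))" using u unfolding V_def by blast
      show ?thesis
        unfolding x(1) D[OF x(2)] embedding_delta[OF \<sigma>(1) m x(2), symmetric]
          D[OF left_moduleD(3)[OF P delta_closed[OF m] x(2)]] left_module_homD(3)[OF d delta_closed[OF m] x(2)]
          embedding_delta[OF \<sigma>(1) m dc[OF x(2)]] ..
    qed
    ultimately show ?thesis by (simp add: equivariant_on_def)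
  qed
  have \<epsilon>_eq: "equivariant_on translate (\<lambda>x v. v) (V 0) \<epsilon>"
  proof -
    interpret abelian_group "P 0" by (rule left_moduleD(1)[OF P])
    have "additive_on (V 0) \<epsilon>"
    proof (rule additive_onI[OF msubmodule_subgrp(2)[OF sub]])
      fix u v assume "u \<in> V 0" "v \<in> V 0"
      then obtain x y where xy: "u = \<sigma> 0 x" "v = \<sigma> 0 y" "x \<in> carrier (P 0)" "y \<in> carrier (P 0)"
        unfolding V_def by blast
      have "\<epsilon> (u + v) = e (x \<oplus>\<^bsub>P 0\<^esub> y)"
        unfolding xy embeddingD(3)[OF \<sigma>(1) xy(3,4), symmetric] by (rule \<epsilon>) (simp add: xy)
      then show "\<epsilon> (u + v) = \<epsilon> u + \<epsilon> v"
        unfolding xy \<epsilon>[OF xy(3)] \<epsilon>[OF xy(4)] left_module_homD(2)[OF e(1) xy(3,4)]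
        by (simp add: trivial_module_def)
    qed
    moreover have "\<epsilon> (translate m u) = \<epsilon> u" if m: "m \<in> carrier M" and u: "u \<in> V 0" for m u
    proof -
      obtain x where x: "u = \<sigma> 0 x" "x \<in> carrier (P 0)" using u unfolding V_def by blast
      have "(\<Sum>k\<in>carrier M. delta m k) = 1" using sum_delta_mult[OF m, of "\<lambda>k. 1"] by simp
      then show ?thesis
        unfolding x(1) \<epsilon>[OF x(2)] embedding_delta[OF \<sigma>(1) m x(2), symmetric]
          \<epsilon>[OF left_moduleD(3)[OF P delta_closed[OF m] x(2)]] left_module_homD(3)[OF e(1) delta_closed[OF m] x(2)]
        by (simp add: trivial_smult[OF delta_closed[OF m]])
    qed
    ultimately show ?thesis by (simp add: equivariant_on_def)
  qed
  have \<epsilon>_onto: "\<epsilon> ` V 0 = UNIV"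
    using e(2) by (simp add: V_def image_image \<epsilon> cong: image_cong)
  have im: "D j ` V (Suc j) = \<sigma> j ` (d j ` carrier (P (Suc j)))" for j
    by (simp add: V_def image_image D cong: image_cong)
  have zero: "\<sigma> j x = 0 \<longleftrightarrow> x = \<zero>\<^bsub>P j\<^esub>" if "x \<in> carrier (P j)" for j x
  proof -
    interpret abelian_group "P j" by (rule left_moduleD(1)[OF P])
    show ?thesis using inj_on_eq_iff[OF inj[of j] that zero_closed] embedding_zero[OF \<sigma>(1)[of j]] by simp
  qed
  have exact0: "D 0 ` V 1 = {p\<in>V 0. \<epsilon> p = 0}"
  proof -
    have "d 0 ` carrier (P 1) = {x\<in>carrier (P 0). e x = 0}"
      using res by (simp add: projective_resolution_def a_kernel_def' trivial_module_def)
    then show ?thesis using im[of 0] \<epsilon> by (auto simp: V_def)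
  qed
  have exact: "D (Suc j) ` V (Suc (Suc j)) = {p\<in>V (Suc j). D j p = 0}" for j
  proof -
    have "d (Suc j) ` carrier (P (Suc (Suc j))) = {x\<in>carrier (P (Suc j)). d j x = \<zero>\<^bsub>P j\<^esub>}"
      using res by (simp add: projective_resolution_def a_kernel_def')
    then show ?thesis using im[of "Suc j"] D zero[OF dc] embedding_zero[OF \<sigma>(1)[of j]] by (auto simp: V_def)
  qed
  have acyclic: "homology_killed translate m 1 (V j) {0}" for j m unfolding V_def by (rule \<sigma>(2))
  have "\<exists>S. finite S \<and> S \<subseteq> V (Suc n) \<and>
     (\<forall>p\<in>V (Suc n). D n p \<in> augmentation translate (V n) \<longrightarrow>
       (\<exists>s\<in>S. \<exists>u\<in>augmentation translate (V (Suc n)). \<exists>q\<in>V (Suc (Suc n)). p = s + u + D (Suc n) q))"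
    by (rule resolution_homology_finite[OF action_translate sub acyclic D_eq \<epsilon>_eq \<epsilon>_onto exact0 exact fin])
  then obtain S where S: "finite S" "S \<subseteq> V (Suc n)"
     "\<forall>p\<in>V (Suc n). D n p \<in> augmentation translate (V n) \<longrightarrow>
       (\<exists>s\<in>S. \<exists>u\<in>augmentation translate (V (Suc n)). \<exists>q\<in>V (Suc (Suc n)). p = s + u + D (Suc n) q)"
    by (elim exE conjE)
  define H where "H = ?t (Suc n) ` carrier (TP (P (Suc (Suc n))))"
  have H: "subgroup H (TP (P (Suc n)))" unfolding H_def by (rule boundaries_subgroup[OF P P d])
  interpret G: group "TP (P (Suc n))" by (rule TP_facts(1)[OF P])
  let ?PS = "P (Suc n)"
  interpret PS: abelian_group ?PS by (rule left_moduleD(1)[OF P])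
  define rep where "rep s = H #>\<^bsub>TP ?PS\<^esub> tensor_class ?PS (frag_of (1, inv_into (carrier ?PS) (\<sigma> (Suc n)) s))" for s
  have cosets: "H #>\<^bsub>TP ?PS\<^esub> c \<in> rep ` S"
    if "c \<in> tensor_cycles ?R trivial_module P d (Suc n)" for c
  proof -
    have c: "c \<in> carrier (TP ?PS)" "?t n c = \<one>\<^bsub>TP (P n)\<^esub>"
      using that by (simp_all only: tensor_cycles.simps kernel_def mem_Collect_eq)
    obtain p where p: "p \<in> carrier ?PS" "c = tensor_class ?PS (frag_of (1, p))"
      by (rule tensor_class_representative[OF P c(1)])
    have "?t n c = tensor_class (P n) (frag_of (1, d n p))"
      unfolding p(2) tensor_map_class[OF P P d frag_of_closed[OF p(1)]] by simp
    then have "frag_of (1, d n p) - 0 \<in> T (P n)"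
      using c(2) unfolding TP_facts(3)[OF P] tensor_class_eq_iff[OF P, symmetric] by simp
    then have "frag_of (1, d n p) \<in> T (P n)" by simp
    then have "zmul 1 (\<sigma> n (d n p)) \<in> augmentation translate (V n)"
      unfolding V_def tensor_eval_frag_of[symmetric] by (rule tensor_eval_relations[OF \<sigma>(1)])
    then have "D n (\<sigma> (Suc n) p) \<in> augmentation translate (V n)"
      by (simp add: D[OF p(1)] zmul_def)
    then obtain s u q where s: "s \<in> S" "u \<in> augmentation translate (V (Suc n))" "q \<in> V (Suc (Suc n))"
        "\<sigma> (Suc n) p = s + u + D (Suc n) q"
      using S(3)[THEN bspec, of "\<sigma> (Suc n) p"] imageI[OF p(1), of "\<sigma> (Suc n)"] unfolding V_def by blast
    obtain a where a: "a \<in> carrier ?PS" "s = \<sigma> (Suc n) a" using s(1) S(2) V_def by blast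
    obtain w where w: "w \<in> carrier (P (Suc (Suc n)))" "q = \<sigma> (Suc (Suc n)) w" using s(3) V_def by blast
    define b where "b = d (Suc n) w"
    have b: "b \<in> carrier ?PS" unfolding b_def by (rule dc[OF w(1)])
    \<comment> \<open>The element \<open>v\<close> is the part of \<open>p\<close> that vanishes in the coinvariants.\<close>
    define v where "v = p \<ominus>\<^bsub>?PS\<^esub> (a \<oplus>\<^bsub>?PS\<^esub> b)"
    have ab: "a \<oplus>\<^bsub>?PS\<^esub> b \<in> carrier ?PS" using a b by simp
    have v: "v \<in> carrier ?PS" unfolding v_def using p(1) ab by simp
    have "\<sigma> (Suc n) v = \<sigma> (Suc n) p - (\<sigma> (Suc n) a + \<sigma> (Suc n) b)"
      unfolding v_def embedding_diff[OF \<sigma>(1) p(1) ab] embeddingD(3)[OF \<sigma>(1) a(1) b] ..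
    also have "\<dots> = u" unfolding s(4) a(2) w(2) D[OF w(1)] b_def by (simp add: algebra_simps)
    finally have "frag_of (1, v) \<in> T ?PS"
      using s(2) by (intro augmentation_relation[OF \<sigma>(1) v]) (simp add: V_def)
    then have "(frag_of (1, v) - (frag_of (1, v) - (frag_of (1, p) - frag_of (1, a \<oplus>\<^bsub>?PS\<^esub> b)))) +
        (frag_of (1, a \<oplus>\<^bsub>?PS\<^esub> b) - frag_of (1, a) - frag_of (1, b)) \<in> T ?PS"
      unfolding v_def
      by (intro subgrp_add subgrp_diff T_subgrp P frag_diff_relation p(1) ab relatorI(1) a(1) b)
    then have "frag_of (1, p) - (frag_of (1, b) + frag_of (1, a)) \<in> T ?PS" by (simp add: algebra_simps)
    then have "c = tensor_class ?PS (frag_of (1, b) + frag_of (1, a))" unfolding p(2) tensor_class_eq_iff[OF P] .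
    also have "\<dots> = tensor_class ?PS (frag_of (1, b)) \<otimes>\<^bsub>TP ?PS\<^esub> tensor_class ?PS (frag_of (1, a))"
      by (rule TP_facts(4)[OF P, symmetric]) (simp_all add: a b)
    also have "tensor_class ?PS (frag_of (1, b)) = ?t (Suc n) (tensor_class (P (Suc (Suc n))) (frag_of (1, w)))"
      unfolding tensor_map_class[OF P P d frag_of_closed[OF w(1)]] b_def by simp
    finally have ch: "c = ?t (Suc n) (tensor_class (P (Suc (Suc n))) (frag_of (1, w))) \<otimes>\<^bsub>TP ?PS\<^esub> tensor_class ?PS (frag_of (1, a))" .
    have "?t (Suc n) (tensor_class (P (Suc (Suc n))) (frag_of (1, w))) \<in> H"
      unfolding H_def TP_facts(2)[OF P] by (intro imageI frag_of_closed w)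
    then have "c \<in> H #>\<^bsub>TP ?PS\<^esub> tensor_class ?PS (frag_of (1, a))"
      unfolding r_coset_def using ch by blast
    moreover have "tensor_class ?PS (frag_of (1, a)) \<in> carrier (TP ?PS)"
      unfolding TP_facts(2)[OF P] by (intro imageI frag_of_closed a)
    ultimately have "H #>\<^bsub>TP ?PS\<^esub> tensor_class ?PS (frag_of (1, a)) = H #>\<^bsub>TP ?PS\<^esub> c"
      by (rule G.repr_independence[OF _ _ H])
    then show ?thesis using s(1) a by (intro image_eqI[of _ _ s]) (simp_all add: rep_def inv_into_f_f[OF inj])
  qed
  have Tor_eq: "carrier (Tor ?R trivial_module P d (Suc n)) =
      (\<lambda>c. H #>\<^bsub>TP ?PS\<^esub> c) ` tensor_cycles ?R trivial_module P d (Suc n)"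
  proof -
    have "carrier (G\<lparr>carrier := Z\<rparr> Mod H) = (\<lambda>c. H #>\<^bsub>G\<^esub> c) ` Z" for G :: "'g monoid" and Z H
      unfolding FactGroup_def RCOSETS_def r_coset_def by auto
    then show ?thesis unfolding Tor_def tensor_boundaries_def H_def .
  qed
  have "carrier (Tor ?R trivial_module P d (Suc n)) \<subseteq> rep ` S"
    unfolding Tor_eq by (rule image_subsetI) (rule cosets)
  then show ?thesis using finite_imageI[OF S(1)] by (rule finite_subset)
qed

end

theorem corollary5p16:
  fixes M :: "('m, 'u) monoid_scheme"
  assumes "monoid M" and "finite (carrier M)" and "regular_monoid M"
  shows "\<exists>N. \<forall>n\<ge>N. \<forall>(P :: nat \<Rightarrow> ('m \<Rightarrow> int, 'p) module) d e.
           projective_resolution (monoid_ring M) trivial_module P d e \<longrightarrow>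
           finite (carrier (Tor (monoid_ring M) trivial_module P d n))"
proof -
  interpret finite_monoid M
    using assms(1,2) by (simp add: finite_monoid_def finite_monoid_axioms_def)
  obtain N where N: "\<And>n. n \<ge> N \<Longrightarrow> homology_finite (\<lambda>x v. v) n (UNIV :: int set)"
    using trivial_homology_finite[OF assms(3)] by blast
  show ?thesis
  proof (intro exI[of _ "Suc N"] allI impI)
    fix n and P :: "nat \<Rightarrow> ('m \<Rightarrow> int, 'p) module" and d e
    assume n: "Suc N \<le> n" and res: "projective_resolution (monoid_ring M) trivial_module P d e"
    then obtain m where "n = Suc m" "N \<le> m" by (cases n) auto
    then show "finite (carrier (Tor (monoid_ring M) trivial_module P d n))"
      using tor_finite[OF N res] by simp
  qed
qed

end
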